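(* Let $m\geqslant1$, let $p_1,\ldots,p_m\geqslant 1$ be integers, and let $\mathbf f_i:(\mathbb C^{m+1},0)\to(\mathbb C,0)$, $i=1,\ldots,m$, be germs of holomorphic functions in the variables $(x,y)$, $x=(x_1,\ldots,x_m)$, with $y$ a scalar unknown. If the system $$x_i^{p_i}\,\frac{\partial y}{\partial x_i}=\mathbf f_i(x,y),\qquad i=1,\ldots,m,$$ is not completely integrable, then any formal power series solution $\varphi\in\mathbb C[[x]]$ of it (without constant term) converges near $0\in\mathbb C^m$.
   Context: A formal power series solution of the system is a series $\varphi=\sum_{|k|>0}c_k x^k\in\mathbb C[[x]]$ (with $k\in\mathbb Z_+^m$, $|k|=k_1+\ldots+k_m$, $x^k=x_1^{k_1}\cdots x_m^{k_m}$, so without constant term) such that $x_i^{p_i}\,\partial\varphi/\partial x_i=\mathbf f_i(x,\varphi)$ in $\mathbb C[[x]]$ for all $i$. Complete integrability: let $D$ be a connected open neighbourhood of $0\in\mathbb C^{m+1}$ in which all $\mathbf f_i$ are holomorphic, and let $\Sigma=\{(x,y)\in D\mid x_1\cdots x_m=0\}$. The system is called completely integrable (on $D\setminus\Sigma$) if for any $(x^0,y^0)\in D\setminus\Sigma$ there exists a unique solution $y=y(x)$, holomorphic near $x^0$ (unique as a germ at $x^0$), such that $y(x^0)=y^0$. Equivalently, all the functions $$\mathbf F_{ij}(x,y)=x_j^{p_j}\frac{\partial \mathbf f_i}{\partial x_j}-x_i^{p_i}\frac{\partial \mathbf f_j}{\partial x_i}+\frac{\partial \mathbf f_i}{\partial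 y}\mathbf f_j-\frac{\partial \mathbf f_j}{\partial y}\mathbf f_i,\qquad i,j=1,\ldots,m,$$ are identically zero. *)

theory Defs
  imports "HOL-Analysis.Analysis"
begin

text \<open>
  Throughout, the finite index type \<open>'m\<close> plays the role of \<open>{1, ..., m}\<close>, so that
  \<open>complex ^ 'm\<close> is the space of the variables \<open>x\<close> and \<open>(complex ^ 'm) \<times> complex\<close> is the
  space of the variables \<open>(x, y)\<close>.
\<close>

subsection \<open>Holomorphic functions of several variables\<close>

text \<open>
  Complex Frechet differentiability at every point of \<open>S\<close>. The type classes of HOL-Analysis
  only provide the real vector space structure of the domain, hence the complex scalar
  multiplication is passed as the argument \<open>scl\<close>.
\<close>

definition holo_on ::
    "(complex \<Rightarrow> 'a \<Rightarrow> 'a) \<Rightarrow> ('a::real_normed_vector \<Rightarrow> complex) \<Rightarrow> 'a set \<Rightarrow> bool" where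
  "holo_on scl f S \<longleftrightarrow>
     (\<forall>z\<in>S. \<exists>f'. (f has_derivative f') (at z) \<and> (\<forall>c v. f' (scl c v) = c * f' v))"

definition holo_x_on :: "(complex ^ 'm \<Rightarrow> complex) \<Rightarrow> (complex ^ 'm) set \<Rightarrow> bool" where
  "holo_x_on = holo_on (*s)"

definition holo_xy_on ::
    "((complex ^ 'm) \<times> complex \<Rightarrow> complex) \<Rightarrow> ((complex ^ 'm) \<times> complex) set \<Rightarrow> bool" where
  "holo_xy_on = holo_on (\<lambda>c (v, w). (c *s v, c * w))"

definition partial_deriv :: "'m \<Rightarrow> (complex ^ 'm \<Rightarrow> complex) \<Rightarrow> complex ^ 'm \<Rightarrow> complex" where
  "partial_deriv i u x = deriv (\<lambda>t. u (x + axis i t)) 0"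

subsection \<open>Complete integrability\<close>

definition Sigma_set :: "((complex ^ 'm) \<times> complex) set \<Rightarrow> ((complex ^ 'm) \<times> complex) set" where
  "Sigma_set D = {z \<in> D. (\<Prod>i\<in>UNIV. fst z $ i) = 0}"

definition solution_near ::
    "('m \<Rightarrow> nat) \<Rightarrow> ('m \<Rightarrow> (complex ^ 'm) \<times> complex \<Rightarrow> complex) \<Rightarrow>
     ((complex ^ 'm) \<times> complex) set \<Rightarrow> complex ^ 'm \<Rightarrow> complex \<Rightarrow>
     (complex ^ 'm \<Rightarrow> complex) \<Rightarrow> bool" where
  "solution_near p f D x0 y0 u \<longleftrightarrow>
     u x0 = y0 \<and>
     (\<exists>U. open U \<and> x0 \<in> U \<and> holo_x_on u U \<and>
        (\<forall>x\<in>U. (x, u x) \<in> D - Sigma_set D \<and>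
           (\<forall>i. (x $ i) ^ p i * partial_deriv i u x = f i (x, u x))))"

definition completely_integrable ::
    "('m \<Rightarrow> nat) \<Rightarrow> ('m \<Rightarrow> (complex ^ 'm) \<times> complex \<Rightarrow> complex) \<Rightarrow>
     ((complex ^ 'm) \<times> complex) set \<Rightarrow> bool" where
  "completely_integrable p f D \<longleftrightarrow>
     (\<forall>(x0, y0) \<in> D - Sigma_set D.
        (\<exists>u. solution_near p f D x0 y0 u) \<and>
        (\<forall>u v. solution_near p f D x0 y0 u \<and> solution_near p f D x0 y0 v \<longrightarrow>
           (\<forall>\<^sub>F x in nhds x0. u x = v x)))"

subsection \<open>Formal power series in the variables \<open>x\<close>\<close>

text \<open>A formal power series is represented by its coefficients, indexed by multi-indices.\<close>

type_synonym 'm mindex = "'m \<Rightarrow> nat"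
type_synonym 'm mps = "'m mindex \<Rightarrow> complex"

definition mdeg :: "('m::finite) mindex \<Rightarrow> nat" where
  "mdeg k = (\<Sum>i\<in>UNIV. k i)"

definition monomial :: "complex ^ 'm \<Rightarrow> ('m::finite) mindex \<Rightarrow> complex" where
  "monomial x k = (\<Prod>i\<in>UNIV. (x $ i) ^ k i)"

definition mps_one :: "'m mps" where
  "mps_one k = (if k = (\<lambda>_. 0) then 1 else 0)"

definition mps_mult :: "'m mps \<Rightarrow> 'm mps \<Rightarrow> 'm mps" where
  "mps_mult a b k = (\<Sum>(i, j) \<in> {(i, j). \<forall>v. i v + j v = k v}. a i * b j)"

primrec mps_power :: "'m mps \<Rightarrow> nat \<Rightarrow> 'm mps" where
  "mps_power a 0 = mps_one"
| "mps_power a (Suc n) = mps_mult a (mps_power a n)"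

definition mps_deriv :: "'m \<Rightarrow> 'm mps \<Rightarrow> 'm mps" where
  "mps_deriv i a k = of_nat (k i + 1) * a (k(i := k i + 1))"

text \<open>Multiplication by \<open>x\<^sub>i\<^sup>n\<close>.\<close>

definition mps_times_var_power :: "'m \<Rightarrow> nat \<Rightarrow> 'm mps \<Rightarrow> 'm mps" where
  "mps_times_var_power i n a k = (if n \<le> k i then a (k(i := k i - n)) else 0)"

text \<open>
  The Taylor coefficients at \<open>0\<close> of a function of \<open>(x, y)\<close>: the coefficient of \<open>x\<^sup>k y\<^sup>l\<close> is
  \<open>taylor f (k, l)\<close>. For \<open>f\<close> holomorphic near \<open>0\<close> this is well defined, the expansion of \<open>f\<close>
  into an (absolutely) convergent power series existing and being unique.
\<close>

definition taylor ::
    "((complex ^ ('m::finite)) \<times> complex \<Rightarrow> complex) \<Rightarrow> 'm mindex \<times> nat \<Rightarrow> complex" where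
  "taylor f = (THE a. \<exists>r>0. \<forall>x y. norm (x, y) < r \<longrightarrow>
     ((\<lambda>(k, l). a (k, l) * monomial x k * y ^ l) has_sum f (x, y)) UNIV)"

text \<open>
  The formal power series obtained by substituting \<open>y = \<phi>\<close>, where \<open>\<phi>\<close> has no constant term,
  into the series in \<open>(x, y)\<close> with coefficients \<open>a\<close>. As \<open>\<phi>\<^sup>l\<close> then only contains monomials of
  degree at least \<open>l\<close>, the terms with \<open>l > |k|\<close> do not contribute to the coefficient of \<open>x\<^sup>k\<close>.
\<close>

definition mps_subst :: "(('m::finite) mindex \<times> nat \<Rightarrow> complex) \<Rightarrow> 'm mps \<Rightarrow> 'm mps" where
  "mps_subst a \<phi> k = (\<Sum>l\<le>mdeg k. mps_mult (\<lambda>i. a (i, l)) (mps_power \<phi> l) k)"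

definition formal_solution ::
    "('m \<Rightarrow> nat) \<Rightarrow> ('m \<Rightarrow> (complex ^ ('m::finite)) \<times> complex \<Rightarrow> complex) \<Rightarrow> 'm mps \<Rightarrow> bool" where
  "formal_solution p f \<phi> \<longleftrightarrow>
     \<phi> (\<lambda>_. 0) = 0 \<and>
     (\<forall>i. mps_times_var_power i (p i) (mps_deriv i \<phi>) = mps_subst (taylor (f i)) \<phi>)"

definition converges_near_0 :: "('m::finite) mps \<Rightarrow> bool" where
  "converges_near_0 \<phi> \<longleftrightarrow>
     (\<exists>r>0. \<forall>x :: complex ^ 'm. norm x < r \<longrightarrow> (\<lambda>k. \<phi> k * monomial x k) summable_on UNIV)"

end

theory Submission
  imports Defs "HOL-Complex_Analysis.Complex_Analysis"
begin

text \<open>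
  Differentiating the \<open>i\<close>-th equation by \<open>x\<^sub>j\<close> and the \<open>j\<close>-th by \<open>x\<^sub>i\<close> and eliminating the second
  derivatives shows that every formal solution \<open>\<phi>\<close> satisfies \<open>F\<^sub>i\<^sub>j (x, \<phi>) = 0\<close>, where the \<open>F\<^sub>i\<^sub>j\<close> are
  the obstructions to integrability (\<open>formal_solution_annihilates\<close>). If the system is not
  completely integrable, some \<open>F\<^sub>i\<^sub>j\<close> is not identically zero, so \<open>\<phi>\<close> is a formal root of a
  nonzero convergent series, and such roots converge (\<open>formal_root_converges\<close>).

  That some \<open>F\<^sub>i\<^sub>j\<close> has a nonzero expansion at the origin is a form of Frobenius' theorem. If all
  these expansions vanish, the identity theorem on the connected domain gives \<open>F\<^sub>i\<^sub>j = 0\<close>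
  everywhere. Near a point with nonzero coordinates the system is then an integrable system
  \<open>\<partial>y / \<partial>x\<^sub>i = g\<^sub>i (x, y)\<close>. Its solution is constructed as a power series: the Euler combination
  of the equations determines the coefficients recursively, a majorant estimate gives
  convergence, and integrability makes the defects of the single equations vanish
  (\<open>frobenius_exists\<close>). Uniqueness of germs is uniqueness of the coefficients
  (\<open>frobenius_unique\<close>).

  For the convergence of a formal root \<open>\<phi>\<close> of \<open>F\<close> one replaces \<open>F\<close> by an iterated derivative in
  \<open>y\<close> for which \<open>\<phi>\<close> is a simple root. Let \<open>N\<close> be the order of the derivative in \<open>y\<close> along \<open>\<phi>\<close>,
  and subtract from \<open>\<phi>\<close> its part of degree at most \<open>N\<close>. On a line \<open>t \<mapsto> t \<xi>\<close> on which the
  leading form of this derivative does not vanish, Newton's method determines the remaining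
  coefficients, with bounds that are uniform for \<open>\<xi>\<close> in a small polydisc (\<open>newton_bound\<close>). So the
  homogeneous parts of \<open>\<phi>\<close> grow at most exponentially on that polydisc, and a form of degree \<open>d\<close>
  that is bounded on a polydisc is bounded on any other one, up to a factor exponential in \<open>d\<close>
  (\<open>form_bound\<close>).

  Power series in \<open>x\<close> form a commutative ring, and series in \<open>(x, y)\<close> are univariate series in \<open>y\<close>
  over that ring. The link with functions is provided by Osgood's lemma (\<open>osgood_induct\<close>),
  term-by-term differentiation (\<open>evalm_has_derivative\<close>), and the uniqueness of the coefficients.
\<close>

unbundle no Formal_Power_Series.fps_syntax

section \<open>The ring of formal power series in the variables \<open>x\<close>\<close>

text \<open>Formal series as a type of their own, so that the Cauchy product can serve as the multiplication
  of a type class; on plain functions this would conflict with the generic function space.\<close>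

typedef 'm mser = "UNIV :: 'm mps set"
  morphisms coef Mser ..

declare Mser_inverse [OF UNIV_I, simp] coef_inverse [simp]

lemma mser_eqI: "(\<And>k. coef a k = coef b k) \<Longrightarrow> a = b"
  using coef_inject by blast

text \<open>The index set of the Cauchy product.\<close>

definition splits :: "('m::finite) mindex \<Rightarrow> ('m mindex \<times> 'm mindex) set" where
  "splits k = {(i, j). \<forall>v. i v + j v = k v}"

lemma finite_le_mindex:
  fixes k :: "('m::finite) mindex"
  shows "finite {i. \<forall>v. i v \<le> k v}"
proof -
  have "{i. \<forall>v. i v \<le> k v} = PiE UNIV (\<lambda>v. {..k v})"
    by (auto simp: PiE_def Pi_def extensional_def)
  thus ?thesis by (simp add: finite_PiE)
qed

lemma finite_splits [simp]:
  fixes k :: "('m::finite) mindex"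
  shows "finite (splits k)"
proof (rule finite_subset)
  show "splits k \<subseteq> {i. \<forall>v. i v \<le> k v} \<times> {i. \<forall>v. i v \<le> k v}"
    by (auto simp: splits_def) (metis le_add1, metis le_add2)
  show "finite ({i :: 'm mindex. \<forall>v. i v \<le> k v} \<times> {i :: 'm mindex. \<forall>v. i v \<le> k v})"
    by (intro finite_cartesian_product finite_le_mindex)
qed

instantiation mser :: (finite) comm_ring_1
begin

definition "0 = Mser (\<lambda>_. 0)"
definition "1 = Mser mps_one"
definition "a + b = Mser (\<lambda>k. coef a k + coef b k)"
definition "a - b = Mser (\<lambda>k. coef a k - coef b k)"
definition "- a = Mser (\<lambda>k. - coef a k)"
definition "a * b = Mser (mps_mult (coef a) (coef b))"

lemma coef_simps:
  "coef 0 k = 0" "coef (1 :: 'a mser) k = (if k = (\<lambda>_. 0) then 1 else 0)"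
  "coef (a + b) k = coef a k + coef b k" "coef (a - b) k = coef a k - coef b k"
  "coef (- a) k = - coef a k"
  by (simp_all add: zero_mser_def one_mser_def mps_one_def plus_mser_def minus_mser_def
      uminus_mser_def)

lemma coef_mult: "coef (a * b) k = (\<Sum>(i, j)\<in>splits k. coef a i * coef b j)" for a b :: "'a mser"
  by (simp add: times_mser_def mps_mult_def splits_def)

instance
proof
  fix a b c :: "'a mser"
  show "a * b * c = a * (b * c)"
  proof (rule mser_eqI)
    fix k :: "'a mindex"
    have "coef (a * b * c) k =
        (\<Sum>u\<in>Sigma (splits k) (\<lambda>(i, j). splits i).
           case u of ((i, j), (p, q)) \<Rightarrow> coef a p * coef b q * coef c j)"
      by (simp add: coef_mult sum_distrib_right case_prod_unfold sum.Sigma)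
    also have "\<dots> = (\<Sum>u\<in>Sigma (splits k) (\<lambda>(i, j). splits j).
           case u of ((i, j), (p, q)) \<Rightarrow> coef a i * (coef b p * coef c q))"
      by (rule sum.reindex_bij_witness[of _
            "\<lambda>((i, j), (p, q)). ((\<lambda>v. i v + p v, q), (i, p))"
            "\<lambda>((i, j), (p, q)). ((p, \<lambda>v. q v + j v), (q, j))"])
        (auto simp: splits_def fun_eq_iff ac_simps)
    also have "\<dots> = coef (a * (b * c)) k"
      by (simp add: coef_mult sum_distrib_left case_prod_unfold sum.Sigma)
    finally show "coef (a * b * c) k = coef (a * (b * c)) k" .
  qed
  show "a * b = b * a"
    by (rule mser_eqI, unfold coef_mult,
        rule sum.reindex_bij_witness[of _ "\<lambda>(i, j). (j, i)" "\<lambda>(i, j). (j, i)"])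
      (auto simp: splits_def add.commute)
  show "1 * a = a"
  proof (rule mser_eqI)
    fix k :: "'a mindex"
    have "coef (1 * a) k = (\<Sum>(i, j)\<in>{(\<lambda>_. 0, k)}. coef 1 i * coef a j)"
      unfolding coef_mult
    proof (rule sum.mono_neutral_right)
      show "\<forall>u\<in>splits k - {(\<lambda>_. 0, k)}. (case u of (i, j) \<Rightarrow> coef 1 i * coef a j) = 0"
      proof (intro ballI)
        fix u assume "u \<in> splits k - {(\<lambda>_. 0, k)}"
        then obtain i j where u: "u = (i, j)" "(i, j) \<in> splits k" "(i, j) \<noteq> (\<lambda>_. 0, k)"
          by (cases u) auto
        hence "i \<noteq> (\<lambda>_. 0)"
          by (auto simp: splits_def)
        thus "(case u of (i, j) \<Rightarrow> coef 1 i * coef a j) = 0" by (simp add: coef_simps u)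
      qed
      show "{(\<lambda>_. 0, k)} \<subseteq> splits k" by (simp add: splits_def)
    qed simp
    thus "coef (1 * a) k = coef a k" by (simp add: coef_simps)
  qed
  show "(a + b) * c = a * c + b * c"
    by (rule mser_eqI)
      (simp add: coef_mult coef_simps distrib_right sum.distrib case_prod_unfold)
  show "(0 :: 'a mser) \<noteq> 1"
  proof
    assume "(0 :: 'a mser) = 1"
    hence "coef (0 :: 'a mser) (\<lambda>_. 0) = coef 1 (\<lambda>_. 0)" by simp
    thus False by (simp add: coef_simps)
  qed
qed (auto intro!: mser_eqI simp: coef_simps)

end

lemma coef_sum: "coef (sum f A) k = (\<Sum>x\<in>A. coef (f x) k)"
  by (induction A rule: infinite_finite_induct) (auto simp: coef_simps)

lemma coef_of_nat_mult: "coef (of_nat n * a) k = of_nat n * coef a k"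
  by (induction n) (auto simp: coef_simps algebra_simps)

lemma mps_power_coef: "mps_power (coef a) n = coef (a ^ n)"
  by (induction n) (simp_all add: one_mser_def times_mser_def)

subsection \<open>The degree filtration\<close>

text \<open>Series of order at least \<open>n\<close>, that is, the \<open>n\<close>-th power of the maximal ideal. Infinite
  sums of series are handled throughout by computing modulo these ideals.\<close>

definition ord_ge :: "nat \<Rightarrow> ('m::finite) mser \<Rightarrow> bool" where
  "ord_ge n a \<longleftrightarrow> (\<forall>k. mdeg k < n \<longrightarrow> coef a k = 0)"

lemma mdeg_add: "mdeg (\<lambda>v. i v + j v) = mdeg i + mdeg j"
  by (simp add: mdeg_def sum.distrib)

lemma splits_mdeg: "(i, j) \<in> splits k \<Longrightarrow> mdeg i + mdeg j = mdeg k"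
  using mdeg_add[of i j] by (simp add: splits_def)

lemma mdeg_eq_0: "mdeg k = 0 \<longleftrightarrow> k = (\<lambda>_. 0)"
  by (auto simp: mdeg_def)

lemma ord_ge_mult:
  fixes a b :: "('m::finite) mser"
  assumes "ord_ge m a" "ord_ge n b" shows "ord_ge (m + n) (a * b)"
  unfolding ord_ge_def coef_mult
proof (intro allI impI sum.neutral ballI)
  fix k :: "'m mindex" and u assume "mdeg k < m + n" "u \<in> splits k"
  then obtain i j where u: "u = (i, j)" "mdeg i + mdeg j < m + n"
    by (metis splits_mdeg surj_pair)
  hence "mdeg i < m \<or> mdeg j < n" by linarith
  thus "(case u of (i, j) \<Rightarrow> coef a i * coef b j) = 0"
    using assms u by (auto simp: ord_ge_def)
qed

lemma ord_ge_0 [simp]: "ord_ge 0 a" "ord_ge n 0"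
  by (auto simp: ord_ge_def coef_simps)

lemma ord_ge_mono: "ord_ge n a \<Longrightarrow> m \<le> n \<Longrightarrow> ord_ge m a"
  by (auto simp: ord_ge_def)

lemma ord_ge_add: "ord_ge n a \<Longrightarrow> ord_ge n b \<Longrightarrow> ord_ge n (a + b)"
  and ord_ge_diff: "ord_ge n a \<Longrightarrow> ord_ge n b \<Longrightarrow> ord_ge n (a - b)"
  and ord_ge_uminus: "ord_ge n a \<Longrightarrow> ord_ge n (- a)"
  by (auto simp: ord_ge_def coef_simps)

lemma ord_ge_sum: "(\<And>x. x \<in> A \<Longrightarrow> ord_ge n (f x)) \<Longrightarrow> ord_ge n (sum f A)"
  by (auto simp: ord_ge_def coef_sum)

lemma ord_ge_mult_left: "ord_ge n b \<Longrightarrow> ord_ge n (a * b)"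
  and ord_ge_mult_right: "ord_ge n a \<Longrightarrow> ord_ge n (a * b)"
  using ord_ge_mult[of 0 a n b] ord_ge_mult[of n a 0 b] by auto

lemma ord_ge_power:
  assumes "ord_ge m a" shows "ord_ge (n * m) (a ^ n)"
proof (induction n)
  case (Suc n)
  thus ?case using ord_ge_mult[OF assms Suc.IH] by simp
qed simp

lemma ord_ge_power1: "ord_ge 1 a \<Longrightarrow> ord_ge n (a ^ n)"
  using ord_ge_power[of 1 a n] by simp

lemma ord_ge_zeroI: "(\<And>n. ord_ge n a) \<Longrightarrow> a = 0"
  by (rule mser_eqI) (auto simp: ord_ge_def coef_simps)

lemma ord_ge_coef: "ord_ge n (a - b) \<Longrightarrow> mdeg k < n \<Longrightarrow> coef a k = coef b k"
  by (auto simp: ord_ge_def coef_simps)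

lemma ord_ge_trans: "ord_ge n (a - b) \<Longrightarrow> ord_ge n (b - c) \<Longrightarrow> ord_ge n (a - c)"
  by (auto simp: ord_ge_def coef_simps)

lemma ord_ge_sym: "ord_ge n (a - b) \<Longrightarrow> ord_ge n (b - a)"
  by (auto simp: ord_ge_def coef_simps)

lemma ord_ge_cong_mult:
  assumes "ord_ge n (a - a')" "ord_ge n (b - b')" shows "ord_ge n (a * b - a' * b')"
proof -
  have "a * b - a' * b' = (a - a') * b + a' * (b - b')" by (simp add: algebra_simps)
  thus ?thesis using assms by (metis ord_ge_add ord_ge_mult_left ord_ge_mult_right)
qed

lemma ord_ge_cong_add:
  "ord_ge n (a - a') \<Longrightarrow> ord_ge n (b - b') \<Longrightarrow> ord_ge n (a + b - (a' + b'))"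
  by (auto simp: ord_ge_def coef_simps)

lemma ord_ge_cong_power: "ord_ge n (a - a') \<Longrightarrow> ord_ge n (a ^ j - a' ^ j)"
  by (induction j) (auto intro: ord_ge_cong_mult)

subsection \<open>Variables and partial derivatives\<close>

definition Xv :: "'m::finite \<Rightarrow> 'm mser" where
  "Xv i = Mser (\<lambda>k. if k = (\<lambda>v. if v = i then 1 else 0) then 1 else 0)"

definition pd :: "'m::finite \<Rightarrow> 'm mser \<Rightarrow> 'm mser" where
  "pd i a = Mser (mps_deriv i (coef a))"

lemma coef_pd: "coef (pd i a) k = of_nat (k i + 1) * coef a (k(i := k i + 1))"
  by (simp add: pd_def mps_deriv_def)

text \<open>Multiplication by a variable shifts the coefficients. This identifies the given multiplication
  by powers of a variable with a multiplication in the ring.\<close>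

lemma coef_Xv_mult: "coef (Xv i * a) k = (if k i = 0 then 0 else coef a (k(i := k i - 1)))"
proof -
  let ?e = "\<lambda>v. if v = i then 1 else 0 :: nat"
  have "coef (Xv i * a) k = (\<Sum>(p, q)\<in>splits k. if p = ?e then coef a q else 0)"
    by (auto simp: coef_mult Xv_def intro!: sum.cong)
  also have "\<dots> = (\<Sum>(p, q)\<in>(if k i = 0 then {} else {(?e, k(i := k i - 1))}).
      if p = ?e then coef a q else 0)"
  proof (rule sum.mono_neutral_cong_right)
    show "(if k i = 0 then {} else {(?e, k(i := k i - 1))}) \<subseteq> splits k"
      by (auto simp: splits_def)
    show "\<forall>u\<in>splits k - (if k i = 0 then {} else {(?e, k(i := k i - 1))}).
        (case u of (p, q) \<Rightarrow> if p = ?e then coef a q else 0) = 0"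
    proof (intro ballI)
      fix u assume u: "u \<in> splits k - (if k i = 0 then {} else {(?e, k(i := k i - 1))})"
      obtain p q where pq: "u = (p, q)" by (cases u)
      have "p \<noteq> ?e"
      proof
        assume p: "p = ?e"
        have k: "k v = ?e v + q v" for v using u pq p by (simp add: splits_def)
        hence "q = k(i := k i - 1)" "k i \<noteq> 0" by (auto simp: fun_eq_iff)
        thus False using u pq p by simp
      qed
      thus "(case u of (p, q) \<Rightarrow> if p = ?e then coef a q else 0) = 0" by (simp add: pq)
    qed
  qed auto
  finally show ?thesis by (auto split: if_splits)
qed

lemma mps_times_var_power_coef:
  fixes a :: "('m::finite) mser"
  shows   "mps_times_var_power i n (coef a) = coef (Xv i ^ n * a)"
proof (induction n)
  case (Suc n)
  show ?case
  proof
    fix k :: "'m mindex"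
    have "coef (Xv i ^ Suc n * a) k = (if k i = 0 then 0 else coef (Xv i ^ n * a) (k(i := k i - 1)))"
      by (simp add: coef_Xv_mult mult.assoc)
    thus "mps_times_var_power i (Suc n) (coef a) k = coef (Xv i ^ Suc n * a) k"
      by (auto simp: mps_times_var_power_def simp flip: Suc.IH)
  qed
qed (auto simp: mps_times_var_power_def)

lemma pd_add: "pd i (a + b) = pd i a + pd i b"
  and pd_diff: "pd i (a - b) = pd i a - pd i b"
  by (auto intro!: mser_eqI simp: coef_pd coef_simps algebra_simps)

lemma pd_0 [simp]: "pd i 0 = 0"
  by (auto intro!: mser_eqI simp: coef_pd coef_simps)

lemma pd_sum: "pd i (sum f A) = (\<Sum>x\<in>A. pd i (f x))"
  by (induction A rule: infinite_finite_induct) (auto simp: pd_add)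

lemma pd_commute: "pd i (pd j a) = pd j (pd i a)"
  by (cases "i = j") (auto intro!: mser_eqI simp: coef_pd fun_upd_twist[of i j])

text \<open>The Leibniz rule, by splitting the factor \<open>k i + 1\<close> of a coefficient into the two exponents of
  \<open>x\<^sub>i\<close> of each pair of indices in the Cauchy product.\<close>

lemma pd_mult: "pd i (a * b) = pd i a * b + a * pd i b"
proof (rule mser_eqI)
  fix k :: "'a mindex"
  let ?k = "k(i := k i + 1)"
  have left: "(\<Sum>(p, q)\<in>splits ?k. of_nat (p i) * (coef a p * coef b q)) = coef (pd i a * b) k"
  proof -
    have "(\<Sum>(p, q)\<in>splits ?k. of_nat (p i) * (coef a p * coef b q)) =
        (\<Sum>(p, q)\<in>{(p, q)\<in>splits ?k. p i \<noteq> 0}. of_nat (p i) * (coef a p * coef b q))"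
      by (rule sum.mono_neutral_right) auto
    also have "\<dots> = (\<Sum>(p, q)\<in>splits k. coef (pd i a) p * coef b q)"
      by (rule sum.reindex_bij_witness[of _ "\<lambda>(p, q). (p(i := p i + 1), q)"
            "\<lambda>(p, q). (p(i := p i - 1), q)"])
        (auto simp: splits_def coef_pd split: if_splits)
    finally show ?thesis by (simp add: coef_mult)
  qed
  have right: "(\<Sum>(p, q)\<in>splits ?k. of_nat (q i) * (coef a p * coef b q)) = coef (a * pd i b) k"
  proof -
    have "(\<Sum>(p, q)\<in>splits ?k. of_nat (q i) * (coef a p * coef b q)) =
        (\<Sum>(p, q)\<in>{(p, q)\<in>splits ?k. q i \<noteq> 0}. of_nat (q i) * (coef a p * coef b q))"
      by (rule sum.mono_neutral_right) auto
    also have "\<dots> = (\<Sum>(p, q)\<in>splits k. coef a p * coef (pd i b) q)"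
      by (rule sum.reindex_bij_witness[of _ "\<lambda>(p, q). (p, q(i := q i + 1))"
            "\<lambda>(p, q). (p, q(i := q i - 1))"])
        (auto simp: splits_def coef_pd split: if_splits)
    finally show ?thesis by (simp add: coef_mult)
  qed
  have "coef (pd i (a * b)) k = (\<Sum>(p, q)\<in>splits ?k. of_nat (k i + 1) * (coef a p * coef b q))"
    by (simp add: coef_pd coef_mult sum_distrib_left case_prod_unfold)
  also have "\<dots> = (\<Sum>(p, q)\<in>splits ?k. of_nat (p i) * (coef a p * coef b q)
      + of_nat (q i) * (coef a p * coef b q))"
  proof (rule sum.cong[OF refl], clarify)
    fix p q assume "(p, q) \<in> splits ?k"
    hence "p i + q i = k i + 1" by (auto simp: splits_def dest: spec[of _ i])
    thus "of_nat (k i + 1) * (coef a p * coef b q) =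
        of_nat (p i) * (coef a p * coef b q) + of_nat (q i) * (coef a p * coef b q)"
      by (metis distrib_right of_nat_add)
  qed
  also have "\<dots> = coef (pd i a * b + a * pd i b) k"
    by (simp add: case_prod_unfold sum.distrib coef_simps flip: left right)
  finally show "coef (pd i (a * b)) k = coef (pd i a * b + a * pd i b) k" .
qed

lemma pd_power: "pd i (a ^ n) = of_nat n * a ^ (n - 1) * pd i a"
proof (induction n)
  case 0
  have "pd i 1 = 0" using pd_mult[of i 1 1] by simp
  thus ?case by simp
next
  case (Suc n)
  thus ?case by (cases n) (auto simp: pd_mult algebra_simps)
qed

lemma mdeg_upd_Suc: "mdeg (k(i := k i + 1)) = mdeg k + 1"
proof -
  have "mdeg (k(i := k i + 1)) = mdeg (\<lambda>v. k v + (if v = i then 1 else 0))"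
    by (rule arg_cong[where f = mdeg]) auto
  thus ?thesis by (simp add: mdeg_add) (simp add: mdeg_def)
qed

lemma ord_ge_pd: "ord_ge (Suc n) a \<Longrightarrow> ord_ge n (pd i a)"
  using mdeg_upd_Suc[of _ i] by (auto simp: ord_ge_def coef_pd)

lemma pd_Xv: "pd i (Xv j) = (if i = j then 1 else 0)"
proof (rule mser_eqI)
  fix k :: "'a mindex"
  have "k(i := k i + 1) = (\<lambda>v. if v = j then 1 else 0) \<longleftrightarrow> i = j \<and> k = (\<lambda>_. 0)"
  proof
    assume eq: "k(i := k i + 1) = (\<lambda>v. if v = j then 1 else 0)"
    have "i = j" using fun_cong[OF eq, of i] by (simp split: if_splits)
    moreover have "k v = 0" for v
      using fun_cong[OF eq, of v] \<open>i = j\<close> by (simp split: if_splits)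
    ultimately show "i = j \<and> k = (\<lambda>_. 0)" by auto
  qed auto
  thus "coef (pd i (Xv j)) k = coef (if i = j then 1 else 0) k"
    by (auto simp: coef_pd Xv_def coef_simps)
qed

lemma pd_Xv_power: "i \<noteq> j \<Longrightarrow> pd i (Xv j ^ n * a) = Xv j ^ n * pd i a"
  by (simp add: pd_mult pd_power pd_Xv)

section \<open>Substituting a series for \<open>y\<close>\<close>

text \<open>As \<open>\<phi>\<close> has no constant term, \<open>\<phi>\<^sup>l\<close> contributes to a coefficient of degree \<open>d\<close> only for \<open>l \<le> d\<close>.
  This makes the sum finite, but \<open>subst_y F \<phi>\<close> is only manageable through its approximations by
  partial sums modulo powers of the maximal ideal.\<close>

definition subst_y :: "('m::finite) mser fps \<Rightarrow> 'm mser \<Rightarrow> 'm mser" where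
  "subst_y F \<phi> = Mser (\<lambda>k. \<Sum>l\<le>mdeg k. coef (fps_nth F l * \<phi> ^ l) k)"

lemma subst_y_trunc:
  assumes "ord_ge 1 \<phi>"
  shows "ord_ge (Suc N) (subst_y F \<phi> - (\<Sum>l\<le>N. fps_nth F l * \<phi> ^ l))"
  unfolding ord_ge_def
proof (intro allI impI)
  fix k :: "'a mindex" assume k: "mdeg k < Suc N"
  have "coef (fps_nth F l * \<phi> ^ l) k = 0" if "l \<in> {..N} - {..mdeg k}" for l
    using ord_ge_mult_left[OF ord_ge_power1[OF assms, of l], of "fps_nth F l"] that
    by (auto simp: ord_ge_def)
  hence "(\<Sum>l\<le>N. coef (fps_nth F l * \<phi> ^ l) k) = (\<Sum>l\<le>mdeg k. coef (fps_nth F l * \<phi> ^ l) k)"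
    using k by (intro sum.mono_neutral_right) auto
  thus "coef (subst_y F \<phi> - (\<Sum>l\<le>N. fps_nth F l * \<phi> ^ l)) k = 0"
    by (simp add: subst_y_def coef_simps coef_sum)
qed

lemma mser_eqI_ord: "(\<And>N. ord_ge (Suc N) (a - b)) \<Longrightarrow> a = b"
  using ord_ge_zeroI[of "a - b"] by (metis eq_iff_diff_eq_0 le_SucI ord_ge_mono order_refl)

lemma subst_y_eqI:
  assumes "ord_ge 1 \<phi>" "\<And>N. ord_ge (Suc N) (a - (\<Sum>l\<le>N. fps_nth F l * \<phi> ^ l))"
  shows "subst_y F \<phi> = a"
  by (rule mser_eqI_ord) (meson assms ord_ge_sym ord_ge_trans subst_y_trunc)

text \<open>In a product of two partial sums the terms beyond the triangle are of high order. This accounts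
  both for the multiplicativity of the substitution and for its Taylor expansion.\<close>

lemma ord_ge_triangle:
  fixes T :: "nat \<Rightarrow> nat \<Rightarrow> ('m::finite) mser"
  assumes "\<And>i j. ord_ge (i + j) (T i j)"
  shows "ord_ge (Suc N) ((\<Sum>i\<le>N. \<Sum>j\<le>N. T i j) - (\<Sum>n\<le>N. \<Sum>i\<le>n. T i (n - i)))"
proof -
  let ?D = "{(i, j). i + j \<le> N}"
  have sub: "?D \<subseteq> {..N} \<times> {..N}" by auto
  have "(\<Sum>i\<le>N. \<Sum>j\<le>N. T i j) - (\<Sum>n\<le>N. \<Sum>i\<le>n. T i (n - i)) =
      (\<Sum>(i, j)\<in>{..N} \<times> {..N}. T i j) - (\<Sum>(i, j)\<in>?D. T i j)"
    by (simp add: sum.cartesian_product sum.triangle_reindex_eq)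
  also have "\<dots> = (\<Sum>(i, j)\<in>{..N} \<times> {..N} - ?D. T i j)"
    using sub by (subst sum_diff) auto
  finally show ?thesis
    by (auto intro!: ord_ge_sum intro: ord_ge_mono[OF assms])
qed

lemma subst_y_add: "subst_y (F + G) \<phi> = subst_y F \<phi> + subst_y G \<phi>"
  by (rule mser_eqI) (simp add: subst_y_def coef_simps distrib_right sum.distrib)

lemma subst_y_diff: "subst_y (F - G) \<phi> = subst_y F \<phi> - subst_y G \<phi>"
  by (rule mser_eqI) (simp add: subst_y_def coef_simps left_diff_distrib sum_subtractf)

lemma subst_y_const: "subst_y (fps_const c) \<phi> = c"
proof (rule mser_eqI)
  fix k
  have "coef (subst_y (fps_const c) \<phi>) k = (\<Sum>l\<in>{0}. coef (fps_nth (fps_const c) l * \<phi> ^ l) k)"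
    unfolding subst_y_def Mser_inverse[OF UNIV_I]
    by (rule sum.mono_neutral_right) (auto simp: coef_simps)
  thus "coef (subst_y (fps_const c) \<phi>) k = coef c k" by simp
qed

lemma subst_y_mult:
  assumes \<phi>: "ord_ge 1 \<phi>" shows "subst_y (F * G) \<phi> = subst_y F \<phi> * subst_y G \<phi>"
proof (rule subst_y_eqI[OF \<phi>])
  fix N
  let ?T = "\<lambda>i j. fps_nth F i * fps_nth G j * \<phi> ^ (i + j)"
  have 1: "ord_ge (Suc N) (subst_y F \<phi> * subst_y G \<phi> -
      (\<Sum>l\<le>N. fps_nth F l * \<phi> ^ l) * (\<Sum>l\<le>N. fps_nth G l * \<phi> ^ l))"
    by (intro ord_ge_cong_mult subst_y_trunc \<phi>)
  have 2: "(\<Sum>l\<le>N. fps_nth F l * \<phi> ^ l) * (\<Sum>l\<le>N. fps_nth G l * \<phi> ^ l) =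
      (\<Sum>i\<le>N. \<Sum>j\<le>N. ?T i j)"
    by (simp add: sum_product power_add algebra_simps)
  have 3: "ord_ge (Suc N) ((\<Sum>i\<le>N. \<Sum>j\<le>N. ?T i j) - (\<Sum>n\<le>N. \<Sum>i\<le>n. ?T i (n - i)))"
    by (intro ord_ge_triangle ord_ge_mult_left ord_ge_power1 \<phi>)
  have 4: "(\<Sum>n\<le>N. \<Sum>i\<le>n. ?T i (n - i)) = (\<Sum>l\<le>N. fps_nth (F * G) l * \<phi> ^ l)"
    by (simp add: fps_mult_nth sum_distrib_right atLeast0AtMost)
  show "ord_ge (Suc N)
      (subst_y F \<phi> * subst_y G \<phi> - (\<Sum>l\<le>N. fps_nth (F * G) l * \<phi> ^ l))"
    by (rule ord_ge_trans[OF 1[unfolded 2] 3[unfolded 4]])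
qed

definition pdF :: "'m::finite \<Rightarrow> 'm mser fps \<Rightarrow> 'm mser fps" where
  "pdF i F = Abs_fps (\<lambda>l. pd i (fps_nth F l))"

text \<open>The chain rule. One more power of \<open>y\<close> is kept in the approximation, since differentiating loses
  one order.\<close>

lemma subst_y_chain:
  assumes \<phi>: "ord_ge 1 \<phi>"
  shows "pd i (subst_y F \<phi>) = subst_y (pdF i F) \<phi> + subst_y (fps_deriv F) \<phi> * pd i \<phi>"
proof (rule mser_eqI_ord)
  fix N
  have "ord_ge (Suc N) (pd i (subst_y F \<phi> - (\<Sum>l\<le>Suc N. fps_nth F l * \<phi> ^ l)))"
    by (intro ord_ge_pd subst_y_trunc \<phi>)
  also have "pd i (subst_y F \<phi> - (\<Sum>l\<le>Suc N. fps_nth F l * \<phi> ^ l)) =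
      pd i (subst_y F \<phi>) - ((\<Sum>l\<le>Suc N. fps_nth (pdF i F) l * \<phi> ^ l)
        + (\<Sum>l\<le>N. fps_nth (fps_deriv F) l * \<phi> ^ l) * pd i \<phi>)"
  proof -
    have "(\<Sum>l\<le>Suc N. fps_nth F l * (of_nat l * \<phi> ^ (l - 1) * pd i \<phi>)) =
        (\<Sum>l\<le>N. fps_nth (fps_deriv F) l * \<phi> ^ l) * pd i \<phi>"
      by (subst sum.atMost_Suc_shift) (simp add: sum_distrib_left sum_distrib_right algebra_simps)
    thus ?thesis
      by (simp add: pd_diff pd_sum pd_mult pd_power pdF_def sum.distrib algebra_simps
          del: sum.atMost_Suc)
  qed
  finally have 1: "ord_ge (Suc N) (pd i (subst_y F \<phi>) -
      ((\<Sum>l\<le>Suc N. fps_nth (pdF i F) l * \<phi> ^ l)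
        + (\<Sum>l\<le>N. fps_nth (fps_deriv F) l * \<phi> ^ l) * pd i \<phi>))" .
  have "ord_ge (Suc N) ((\<Sum>l\<le>Suc N. fps_nth (pdF i F) l * \<phi> ^ l) - subst_y (pdF i F) \<phi>)"
    using ord_ge_mono[OF ord_ge_sym[OF subst_y_trunc[OF \<phi>, of "Suc N" "pdF i F"]], of "Suc N"]
    by simp
  moreover have "ord_ge (Suc N) ((\<Sum>l\<le>N. fps_nth (fps_deriv F) l * \<phi> ^ l) * pd i \<phi>
      - subst_y (fps_deriv F) \<phi> * pd i \<phi>)"
    unfolding left_diff_distrib[symmetric]
    by (rule ord_ge_mult_right[OF ord_ge_sym[OF subst_y_trunc[OF \<phi>]]])
  ultimately show "ord_ge (Suc N) (pd i (subst_y F \<phi>) -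
      (subst_y (pdF i F) \<phi> + subst_y (fps_deriv F) \<phi> * pd i \<phi>))"
    by (rule ord_ge_trans[OF 1 ord_ge_cong_add])
qed

lemma subst_y_cong:
  assumes "ord_ge 1 \<phi>" "ord_ge 1 \<psi>" "ord_ge n (\<phi> - \<psi>)"
  shows "ord_ge n (subst_y F \<phi> - subst_y F \<psi>)"
proof (cases n)
  case (Suc N)
  have "(\<Sum>l\<le>N. fps_nth F l * \<phi> ^ l) - (\<Sum>l\<le>N. fps_nth F l * \<psi> ^ l) =
      (\<Sum>l\<le>N. fps_nth F l * (\<phi> ^ l - \<psi> ^ l))"
    by (simp add: sum_subtractf algebra_simps)
  hence "ord_ge (Suc N) ((\<Sum>l\<le>N. fps_nth F l * \<phi> ^ l) - (\<Sum>l\<le>N. fps_nth F l * \<psi> ^ l))"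
    using assms(3) Suc by (auto intro!: ord_ge_sum ord_ge_mult_left ord_ge_cong_power)
  thus ?thesis
    unfolding Suc
    by (rule ord_ge_trans[OF ord_ge_trans[OF subst_y_trunc[OF assms(1)]]
          ord_ge_sym[OF subst_y_trunc[OF assms(2)]]])
qed simp

subsection \<open>Taylor expansion at a series\<close>

text \<open>The divided derivatives in \<open>y\<close>; the ordinary \<open>j\<close>-th derivative is \<open>j!\<close> times this one.\<close>

definition hasse :: "nat \<Rightarrow> 'a::comm_ring_1 fps \<Rightarrow> 'a fps" where
  "hasse j F = Abs_fps (\<lambda>l. of_nat ((l + j) choose j) * fps_nth F (l + j))"

text \<open>The series of \<open>F (x, P (x) + z)\<close> in powers of \<open>z\<close>.\<close>

definition shift_y :: "('m::finite) mser fps \<Rightarrow> 'm mser \<Rightarrow> 'm mser fps" where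
  "shift_y F P = Abs_fps (\<lambda>j. subst_y (hasse j F) P)"

lemma subst_y_shift:
  assumes P: "ord_ge 1 P" and Z: "ord_ge 1 Z"
  shows "subst_y (shift_y F P) Z = subst_y F (P + Z)"
proof (rule subst_y_eqI[OF Z])
  fix N
  have PZ: "ord_ge 1 (P + Z)" by (intro ord_ge_add P Z)
  let ?T = "\<lambda>l j. of_nat ((l + j) choose j) * fps_nth F (l + j) * P ^ l * Z ^ j"
  have T: "ord_ge (l + j) (?T l j)" for l j
    unfolding mult.assoc
    by (intro ord_ge_mult_left ord_ge_mult ord_ge_power1 P Z)
  have "ord_ge (Suc N) (subst_y F (P + Z) - (\<Sum>n\<le>N. fps_nth F n * (P + Z) ^ n))"
    by (rule subst_y_trunc[OF PZ])
  also have "(\<Sum>n\<le>N. fps_nth F n * (P + Z) ^ n) = (\<Sum>n\<le>N. \<Sum>i\<le>n. ?T i (n - i))"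
  proof (rule sum.cong[OF refl])
    fix n
    have "fps_nth F n * (P + Z) ^ n =
        (\<Sum>i\<le>n. fps_nth F n * (of_nat (n choose i) * P ^ i * Z ^ (n - i)))"
      by (simp add: binomial_ring sum_distrib_left)
    also have "\<dots> = (\<Sum>i\<le>n. ?T i (n - i))"
      by (rule sum.cong[OF refl]) (auto simp: algebra_simps dest: binomial_symmetric)
    finally show "fps_nth F n * (P + Z) ^ n = (\<Sum>i\<le>n. ?T i (n - i))" .
  qed
  finally have 1: "ord_ge (Suc N)
      (subst_y F (P + Z) - (\<Sum>n\<le>N. \<Sum>i\<le>n. ?T i (n - i)))" .
  have 2: "ord_ge (Suc N) ((\<Sum>n\<le>N. \<Sum>i\<le>n. ?T i (n - i)) - (\<Sum>l\<le>N. \<Sum>j\<le>N. ?T l j))"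
    by (rule ord_ge_sym[OF ord_ge_triangle]) (rule T)
  have 3: "(\<Sum>l\<le>N. \<Sum>j\<le>N. ?T l j) =
      (\<Sum>j\<le>N. (\<Sum>l\<le>N. fps_nth (hasse j F) l * P ^ l) * Z ^ j)"
    by (subst sum.swap) (simp add: hasse_def sum_distrib_right)
  have 4: "ord_ge (Suc N) ((\<Sum>j\<le>N. (\<Sum>l\<le>N. fps_nth (hasse j F) l * P ^ l) * Z ^ j)
      - (\<Sum>j\<le>N. fps_nth (shift_y F P) j * Z ^ j))"
    unfolding sum_subtractf[symmetric] left_diff_distrib[symmetric] shift_y_def fps_nth_Abs_fps
    by (intro ord_ge_sum ord_ge_mult_right ord_ge_sym[OF subst_y_trunc] P)
  show "ord_ge (Suc N) (subst_y F (P + Z) - (\<Sum>j\<le>N. fps_nth (shift_y F P) j * Z ^ j))"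
    by (rule ord_ge_trans[OF ord_ge_trans[OF 1 2, unfolded 3] 4])
qed

lemma hasse_1: "hasse 1 F = fps_deriv F"
  by (rule fps_ext) (simp add: hasse_def)

section \<open>Series in the variables \<open>(x, y)\<close>\<close>

text \<open>The monomial \<open>x\<^sup>k y\<^sup>l\<close> is treated as a monomial in variables indexed by \<open>'m option\<close>, the
  index \<open>None\<close> standing for \<open>y\<close>.\<close>

definition pk :: "'m mindex \<Rightarrow> nat \<Rightarrow> 'm option mindex" where
  "pk k l = case_option l k"

lemma pk_simps [simp]: "pk k l None = l" "pk k l (Some i) = k i"
  by (auto simp: pk_def)

lemma pk_eta [simp]: "pk (\<lambda>v. K (Some v)) (K None) = K"
  by (auto simp: pk_def fun_eq_iff split: option.split)

definition y_fps :: "('m::finite) option mser \<Rightarrow> 'm mser fps" where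
  "y_fps A = Abs_fps (\<lambda>l. Mser (\<lambda>k. coef A (pk k l)))"

lemma coef_y_fps: "coef (fps_nth (y_fps A) l) k = coef A (pk k l)"
  by (simp add: y_fps_def)

lemma mser_fps_eqI: "(\<And>l k. coef (fps_nth F l) k = coef (fps_nth G l) k) \<Longrightarrow> F = G"
  by (intro fps_ext mser_eqI)

lemma y_fps_inject: "y_fps A = y_fps B \<Longrightarrow> A = B"
  by (rule mser_eqI) (metis coef_y_fps pk_eta)

lemma y_fps_add: "y_fps (A + B) = y_fps A + y_fps B"
  and y_fps_diff: "y_fps (A - B) = y_fps A - y_fps B"
  and y_fps_0: "y_fps 0 = 0"
  by (auto intro!: mser_fps_eqI simp: coef_y_fps coef_simps)

lemma pk_eta_split:
  "(\<forall>v. I v + J v = pk k l v) \<longleftrightarrow>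
    I None + J None = l \<and> (\<forall>v. I (Some v) + J (Some v) = k v)"
  by (metis not_None_eq pk_simps)

lemma y_fps_mult: "y_fps (A * B) = y_fps A * y_fps B"
proof (rule mser_fps_eqI)
  fix l and k :: "'a mindex"
  have "coef (fps_nth (y_fps A * y_fps B) l) k =
      (\<Sum>p\<in>{0..l}. \<Sum>u\<in>splits k. coef A (pk (fst u) p) * coef B (pk (snd u) (l - p)))"
    by (simp add: fps_mult_nth coef_sum coef_mult coef_y_fps case_prod_unfold)
  also have "\<dots> = (\<Sum>u\<in>{0..l} \<times> splits k.
      coef A (pk (fst (snd u)) (fst u)) * coef B (pk (snd (snd u)) (l - fst u)))"
    by (simp add: sum.cartesian_product case_prod_unfold)
  also have "\<dots> = (\<Sum>(I, J)\<in>splits (pk k l). coef A I * coef B J)"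
    by (rule sum.reindex_bij_witness[of _
          "\<lambda>(I, J). (I None, (\<lambda>v. I (Some v), \<lambda>v. J (Some v)))"
          "\<lambda>(p, (i, j)). (pk i p, pk j (l - p))"])
      (auto simp: splits_def pk_eta_split)
  finally show "coef (fps_nth (y_fps (A * B)) l) k = coef (fps_nth (y_fps A * y_fps B) l) k"
    by (simp add: coef_y_fps coef_mult)
qed

lemma pk_upd_Some: "(pk k l)(Some i := n) = pk (k(i := n)) l"
  and pk_upd_None: "(pk k l)(None := n) = pk k n"
  by (auto simp: fun_eq_iff pk_def split: option.split)

lemma y_fps_pd_Some: "y_fps (pd (Some i) A) = pdF i (y_fps A)"
  by (rule mser_fps_eqI) (simp add: coef_y_fps pdF_def coef_pd pk_upd_Some)

lemma y_fps_pd_None: "y_fps (pd None A) = fps_deriv (y_fps A)"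
proof (rule mser_fps_eqI)
  fix l and k :: "'a mindex"
  show "coef (fps_nth (y_fps (pd None A)) l) k = coef (fps_nth (fps_deriv (y_fps A)) l) k"
    using coef_of_nat_mult[of "l + 1" "fps_nth (y_fps A) (l + 1)" k]
    by (simp add: coef_y_fps coef_pd pk_upd_None)
qed

lemma y_fps_Xv_Some_power: "y_fps (Xv (Some i) ^ n) = fps_const (Xv i ^ n)"
proof (induction n)
  case 0
  show ?case
  proof (rule mser_fps_eqI)
    fix l and k :: "'a mindex"
    have "pk k l = (\<lambda>_. 0) \<longleftrightarrow> k = (\<lambda>_. 0) \<and> l = 0"
      by (auto simp: fun_eq_iff pk_def split: option.splits)
    thus "coef (fps_nth (y_fps (Xv (Some i) ^ 0)) l) k = coef (fps_nth (fps_const (Xv i ^ 0)) l) k"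
      by (simp add: coef_y_fps coef_simps)
  qed
next
  case (Suc n)
  have "y_fps (Xv (Some i)) = fps_const (Xv i)"
  proof (rule mser_fps_eqI)
    fix l and k :: "'a mindex"
    have "pk k l = (\<lambda>v. if v = Some i then 1 else 0) \<longleftrightarrow>
        k = (\<lambda>v. if v = i then 1 else 0) \<and> l = 0"
      by (auto simp: fun_eq_iff pk_def split: option.splits)
    thus "coef (fps_nth (y_fps (Xv (Some i))) l) k = coef (fps_nth (fps_const (Xv i)) l) k"
      by (simp add: coef_y_fps coef_simps Xv_def)
  qed
  thus ?case using Suc by (simp add: y_fps_mult)
qed

lemma mps_subst_coef:
  assumes "\<And>k l. a (k, l) = coef (fps_nth F l) k"
  shows "mps_subst a (coef \<phi>) = coef (subst_y F \<phi>)"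
proof
  fix k
  have "mps_subst a (coef \<phi>) k =
      (\<Sum>l\<le>mdeg k. mps_mult (coef (fps_nth F l)) (coef (\<phi> ^ l)) k)"
    by (simp add: mps_subst_def mps_power_coef assms)
  thus "mps_subst a (coef \<phi>) k = coef (subst_y F \<phi>) k"
    by (simp add: subst_y_def times_mser_def)
qed

section \<open>Graded norms\<close>

lemma finite_mdeg [simp]: "finite {k :: ('m::finite) mindex. mdeg k = d}"
proof (rule finite_subset)
  show "{k :: 'm mindex. mdeg k = d} \<subseteq> {k. \<forall>v. k v \<le> (\<lambda>_. d) v}"
    by (auto simp: mdeg_def intro: member_le_sum)
qed (rule finite_le_mindex)

text \<open>The Cauchy product respects the grading by degree.\<close>

lemma sum_splits_mdeg:
  fixes g :: "('m::finite) mindex \<Rightarrow> 'm mindex \<Rightarrow> 'b::comm_monoid_add"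
  shows "(\<Sum>k | mdeg k = d. \<Sum>(i, j)\<in>splits k. g i j) =
    (\<Sum>e\<le>d. \<Sum>i | mdeg i = e. \<Sum>j | mdeg j = d - e. g i j)"
proof -
  have "(\<Sum>k | mdeg k = d. \<Sum>(i, j)\<in>splits k. g i j) =
      (\<Sum>u\<in>Sigma {k. mdeg k = d} splits. case u of (k, (i, j)) \<Rightarrow> g i j)"
    by (simp add: sum.Sigma case_prod_unfold)
  also have "\<dots> = (\<Sum>u\<in>Sigma {..d} (\<lambda>e. {i. mdeg i = e} \<times> {j. mdeg j = d - e}).
      case u of (e, (i, j)) \<Rightarrow> g i j)"
    by (rule sum.reindex_bij_witness[of _ "\<lambda>(e, (i, j)). (\<lambda>v. i v + j v, (i, j))"
          "\<lambda>(k, (i, j)). (mdeg i, (i, j))"])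
      (auto simp: mdeg_add dest: splits_mdeg simp: splits_def fun_eq_iff)
  also have "\<dots> = (\<Sum>e\<le>d. \<Sum>i | mdeg i = e. \<Sum>j | mdeg j = d - e. g i j)"
    by (simp add: sum.Sigma case_prod_unfold sum.cartesian_product)
  finally show ?thesis .
qed

text \<open>The size of the degree-\<open>d\<close> part of a series, measured in two ways: by the sum of the
  absolute values of the coefficients, and by the absolute value at a point \<open>\<xi>\<close>. Both satisfy
  the axioms below, so that the weighted partial sums \<open>gN\<close> are submultiplicative.\<close>

definition nabs :: "('m::finite) mser \<Rightarrow> nat \<Rightarrow> real" where
  "nabs a d = (\<Sum>k | mdeg k = d. norm (coef a k))"

definition hpart :: "complex ^ 'm \<Rightarrow> ('m::finite) mser \<Rightarrow> nat \<Rightarrow> complex" where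
  "hpart \<xi> a d = (\<Sum>k | mdeg k = d. coef a k * monomial \<xi> k)"

lemma monomial_add: "monomial x (\<lambda>v. i v + j v) = monomial x i * monomial x j"
  by (simp add: monomial_def power_add prod.distrib)

lemma splits_monomial: "(i, j) \<in> splits k \<Longrightarrow> monomial x k = monomial x i * monomial x j"
  using monomial_add[of x i j] by (simp add: splits_def)

lemma hpart_mult: "hpart \<xi> (a * b) d = (\<Sum>e\<le>d. hpart \<xi> a e * hpart \<xi> b (d - e))"
proof -
  have "hpart \<xi> (a * b) d = (\<Sum>k | mdeg k = d. \<Sum>(i, j)\<in>splits k.
      (coef a i * monomial \<xi> i) * (coef b j * monomial \<xi> j))"
    unfolding hpart_def coef_mult sum_distrib_right
    by (intro sum.cong refl) (auto simp: splits_monomial)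
  thus ?thesis by (simp add: sum_splits_mdeg hpart_def sum_product)
qed

locale graded_norm =
  fixes \<nu> :: "('m::finite) mser \<Rightarrow> nat \<Rightarrow> real"
  assumes nonneg: "\<nu> a d \<ge> 0"
    and add: "\<nu> (a + b) d \<le> \<nu> a d + \<nu> b d"
    and uminus: "\<nu> (- a) d = \<nu> a d"
    and mult: "\<nu> (a * b) d \<le> (\<Sum>e\<le>d. \<nu> a e * \<nu> b (d - e))"
    and one: "\<nu> 1 d \<le> (if d = 0 then 1 else 0)"
    and local: "(\<And>k. mdeg k = d \<Longrightarrow> coef a k = 0) \<Longrightarrow> \<nu> a d = 0"

lemma coef_1_mdeg: "coef 1 k = (if mdeg k = 0 then 1 else 0)"
  by (simp add: coef_simps mdeg_eq_0)

lemma mdeg_zero_set: "{k. mdeg k = 0} = {\<lambda>_. 0}"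
  by (auto simp: mdeg_eq_0)

interpretation nabs: graded_norm nabs
proof
  fix a b :: "'a mser" and d
  show "nabs a d \<ge> 0" by (simp add: nabs_def sum_nonneg)
  show "nabs (a + b) d \<le> nabs a d + nabs b d"
    by (simp add: nabs_def coef_simps sum_mono norm_triangle_ineq flip: sum.distrib)
  show "nabs (- a) d = nabs a d" by (simp add: nabs_def coef_simps)
  show "nabs (a * b) d \<le> (\<Sum>e\<le>d. nabs a e * nabs b (d - e))"
  proof -
    have "nabs (a * b) d \<le>
        (\<Sum>k | mdeg k = d. \<Sum>(i, j)\<in>splits k. norm (coef a i) * norm (coef b j))"
      unfolding nabs_def coef_mult
      by (intro sum_mono order_trans[OF norm_sum]) (auto simp: norm_mult case_prod_unfold)
    thus ?thesis by (simp add: sum_splits_mdeg nabs_def sum_product)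
  qed
  show "nabs 1 d \<le> (if d = 0 then 1 else 0 :: real)"
    by (auto simp: nabs_def coef_1_mdeg mdeg_zero_set)
  show "nabs a d = 0" if "\<And>k. mdeg k = d \<Longrightarrow> coef a k = 0"
    using that by (simp add: nabs_def)
qed

interpretation nhom: graded_norm "\<lambda>a d. norm (hpart \<xi> a d)" for \<xi>
proof
  fix a b :: "'a mser" and d
  show "norm (hpart \<xi> (a + b) d) \<le> norm (hpart \<xi> a d) + norm (hpart \<xi> b d)"
    by (simp add: hpart_def coef_simps distrib_right sum.distrib norm_triangle_ineq)
  show "norm (hpart \<xi> (- a) d) = norm (hpart \<xi> a d)"
    by (simp add: hpart_def coef_simps sum_negf)
  show "norm (hpart \<xi> (a * b) d) \<le> (\<Sum>e\<le>d. norm (hpart \<xi> a e) * norm (hpart \<xi> b (d - e)))"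
    unfolding hpart_mult by (rule order_trans[OF norm_sum]) (simp add: norm_mult)
  show "norm (hpart \<xi> 1 d) \<le> (if d = 0 then 1 else 0 :: real)"
    by (auto simp: hpart_def coef_1_mdeg mdeg_zero_set monomial_def)
  show "norm (hpart \<xi> a d) = 0" if "\<And>k. mdeg k = d \<Longrightarrow> coef a k = 0"
    using that by (simp add: hpart_def)
qed simp

lemma norm_monomial_le:
  assumes "\<And>i. norm (x $ i) \<le> r" shows "norm (monomial x k) \<le> r ^ mdeg k"
proof -
  have "norm (monomial x k) = (\<Prod>i\<in>UNIV. norm (x $ i) ^ k i)"
    by (simp add: monomial_def norm_power flip: prod_norm)
  also have "\<dots> \<le> (\<Prod>i\<in>UNIV. r ^ k i)"
    by (intro prod_mono conjI power_mono assms) auto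
  finally show ?thesis by (simp add: mdeg_def power_sum)
qed

lemma norm_hpart_le:
  assumes "\<And>i. norm (\<xi> $ i) \<le> 1" shows "norm (hpart \<xi> a d) \<le> nabs a d"
  unfolding hpart_def nabs_def
  using norm_monomial_le[of \<xi> 1] assms
  by (intro sum_norm_le) (auto simp: norm_mult intro!: mult_left_le)

definition gN :: "(('m::finite) mser \<Rightarrow> nat \<Rightarrow> real) \<Rightarrow> real \<Rightarrow> nat \<Rightarrow> 'm mser \<Rightarrow> real" where
  "gN \<nu> r n a = (\<Sum>d\<le>n. \<nu> a d * r ^ d)"

context graded_norm
begin


lemma N_nonneg: "0 \<le> r \<Longrightarrow> 0 \<le> gN \<nu> r n a"
  by (simp add: gN_def sum_nonneg nonneg)

lemma N_add: "0 \<le> r \<Longrightarrow> gN \<nu> r n (a + b) \<le> gN \<nu> r n a + gN \<nu> r n b"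
  by (simp add: gN_def sum_mono mult_right_mono add flip: sum.distrib distrib_right)

lemma N_uminus: "gN \<nu> r n (- a) = gN \<nu> r n a"
  by (simp add: gN_def uminus)

lemma N_diff: "0 \<le> r \<Longrightarrow> gN \<nu> r n (a - b) \<le> gN \<nu> r n a + gN \<nu> r n b"
  using N_add[of r n a "- b"] by (simp add: N_uminus)

lemma zero: "\<nu> 0 d = 0"
  by (rule local) (simp add: coef_simps)

lemma N_zero [simp]: "gN \<nu> r n 0 = 0"
  by (simp add: gN_def zero)

lemma N_sum: "0 \<le> r \<Longrightarrow> gN \<nu> r n (sum f A) \<le> (\<Sum>x\<in>A. gN \<nu> r n (f x))"
proof (induction A rule: infinite_finite_induct)
  case (insert x A)
  thus ?case using N_add[of r n "f x" "sum f A"] by simp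
qed auto

lemma N_mult:
  assumes "0 \<le> r" shows "gN \<nu> r n (a * b) \<le> gN \<nu> r n a * gN \<nu> r n b"
proof -
  let ?T = "\<lambda>i j. (\<nu> a i * r ^ i) * (\<nu> b j * r ^ j)"
  have "gN \<nu> r n (a * b) \<le> (\<Sum>d\<le>n. (\<Sum>e\<le>d. \<nu> a e * \<nu> b (d - e)) * r ^ d)"
    unfolding gN_def using assms by (intro sum_mono mult_right_mono mult) auto
  also have "\<dots> = (\<Sum>d\<le>n. \<Sum>e\<le>d. ?T e (d - e))"
    by (auto intro!: sum.cong simp: sum_distrib_right simp flip: power_add)
  also have "\<dots> = (\<Sum>(i, j)\<in>{(i, j). i + j \<le> n}. ?T i j)"
    by (simp add: sum.triangle_reindex_eq)
  also have "\<dots> \<le> (\<Sum>(i, j)\<in>{..n} \<times> {..n}. ?T i j)"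
    using assms by (intro sum_mono2) (auto simp: nonneg)
  finally show ?thesis by (simp add: gN_def sum_product sum.cartesian_product)
qed

lemma N_one: "0 \<le> r \<Longrightarrow> gN \<nu> r n 1 \<le> 1"
proof -
  assume r: "0 \<le> r"
  have "gN \<nu> r n 1 \<le> (\<Sum>d\<le>n. (if d = 0 then 1 else 0) * r ^ d)"
    unfolding gN_def using r by (intro sum_mono mult_right_mono one) auto
  also have "\<dots> = (\<Sum>d\<le>n. if d = 0 then 1 else 0)"
    by (intro sum.cong) auto
  finally show ?thesis by simp
qed

lemma N_power: "0 \<le> r \<Longrightarrow> gN \<nu> r n (a ^ j) \<le> gN \<nu> r n a ^ j"
proof (induction j)
  case (Suc j)
  have "gN \<nu> r n (a ^ Suc j) \<le> gN \<nu> r n a * gN \<nu> r n (a ^ j)"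
    using N_mult Suc by simp
  also have "\<dots> \<le> gN \<nu> r n a * gN \<nu> r n a ^ j"
    using Suc by (intro mult_left_mono N_nonneg) auto
  finally show ?case by simp
qed (simp add: N_one)

lemma N_of_nat_mult: "0 \<le> r \<Longrightarrow> gN \<nu> r n (of_nat c * a) \<le> of_nat c * gN \<nu> r n a"
proof (induction c)
  case (Suc c)
  thus ?case using N_add[of r n a "of_nat c * a"] by (simp add: algebra_simps)
qed simp

lemma cong:
  assumes "\<And>k. mdeg k = d \<Longrightarrow> coef a k = coef b k" shows "\<nu> a d = \<nu> b d"
proof -
  have "\<nu> (a - b) d = 0" "\<nu> (b - a) d = 0"
    using assms by (auto intro!: local simp: coef_simps)
  thus ?thesis using add[of "a - b" b d] add[of "b - a" a d] by simp
qed

lemma N_cong: "ord_ge (Suc n) (a - b) \<Longrightarrow> gN \<nu> r n a = gN \<nu> r n b"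
  unfolding gN_def by (intro sum.cong refl arg_cong2[where f = "(*)"] cong)
    (auto intro: ord_ge_coef)

lemma N_scale:
  assumes "ord_ge m a" "0 \<le> r" "r \<le> r0" "r0 > 0"
  shows "gN \<nu> r n a \<le> (r / r0) ^ m * gN \<nu> r0 n a"
  unfolding gN_def sum_distrib_left
proof (rule sum_mono)
  fix d
  show "\<nu> a d * r ^ d \<le> (r / r0) ^ m * (\<nu> a d * r0 ^ d)"
  proof (cases "d < m")
    case True
    thus ?thesis using assms(1) local[of d a] by (auto simp: ord_ge_def)
  next
    case False
    have "r ^ d = (r / r0) ^ d * r0 ^ d" using assms by (simp add: power_divide)
    also have "\<dots> \<le> (r / r0) ^ m * r0 ^ d"
      using False assms by (intro mult_right_mono power_decreasing) auto
    finally have "\<nu> a d * r ^ d \<le> \<nu> a d * ((r / r0) ^ m * r0 ^ d)"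
      by (rule mult_left_mono[OF _ nonneg])
    thus ?thesis by (simp add: mult_ac)
  qed
qed

lemma N_subst_y:
  assumes "ord_ge 1 \<phi>" "0 \<le> r"
  shows "gN \<nu> r n (subst_y F \<phi>) \<le> (\<Sum>l\<le>n. gN \<nu> r n (fps_nth F l) * gN \<nu> r n \<phi> ^ l)"
proof -
  have "gN \<nu> r n (subst_y F \<phi>) = gN \<nu> r n (\<Sum>l\<le>n. fps_nth F l * \<phi> ^ l)"
    by (rule N_cong[OF subst_y_trunc[OF assms(1)]])
  also have "\<dots> \<le> (\<Sum>l\<le>n. gN \<nu> r n (fps_nth F l * \<phi> ^ l))"
    by (rule N_sum[OF assms(2)])
  also have "\<dots> \<le> (\<Sum>l\<le>n. gN \<nu> r n (fps_nth F l) * gN \<nu> r n \<phi> ^ l)"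
    using assms(2)
    by (intro sum_mono order_trans[OF N_mult] mult_left_mono N_power N_nonneg) auto
  finally show ?thesis .
qed

end

section \<open>Convergent series\<close>

text \<open>Convergence is expressed by bounds for all partial sums of absolute values, which stay finite
  for divergent series and so can be used in inductions.\<close>

definition x_conv :: "('m::finite) mser \<Rightarrow> bool" where
  "x_conv a \<longleftrightarrow> (\<exists>r>0. \<exists>C. \<forall>n. gN nabs r n a \<le> C)"

definition xy_bound :: "('m::finite) mser fps \<Rightarrow> real \<Rightarrow> real \<Rightarrow> real \<Rightarrow> bool" where
  "xy_bound F r \<rho> C \<longleftrightarrow> 0 < r \<and> 0 < \<rho> \<and>
     (\<forall>n L. (\<Sum>l\<le>L. gN nabs r n (fps_nth F l) * \<rho> ^ l) \<le> C)"

definition xy_conv :: "('m::finite) mser fps \<Rightarrow> bool" where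
  "xy_conv F \<longleftrightarrow> (\<exists>r \<rho> C. xy_bound F r \<rho> C)"

lemma nabs_N_mono_r: "0 \<le> r \<Longrightarrow> r \<le> r' \<Longrightarrow> gN nabs r n a \<le> gN nabs r' n a"
  unfolding gN_def by (intro sum_mono mult_left_mono power_mono nabs.nonneg) auto

lemma xy_bound_mono:
  assumes "xy_bound F r \<rho> C" "0 < r'" "r' \<le> r" shows "xy_bound F r' \<rho> C"
proof -
  have "(\<Sum>l\<le>L. gN nabs r' n (fps_nth F l) * \<rho> ^ l) \<le> (\<Sum>l\<le>L. gN nabs r n (fps_nth F l) * \<rho> ^ l)"
    for n L
    using assms by (intro sum_mono mult_right_mono nabs_N_mono_r) (auto simp: xy_bound_def)
  thus ?thesis using assms unfolding xy_bound_def by (meson order_trans)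
qed

text \<open>The factors \<open>l + 1\<close> produced by differentiating are absorbed by halving the radius, as
  \<open>l + 1 \<le> 2\<^sup>l\<close>.\<close>

lemma xy_conv_deriv:
  assumes "xy_conv F" shows "xy_conv (fps_deriv F)"
proof -
  obtain r \<rho> C where b: "0 < r" "0 < \<rho>"
    "\<And>n L. (\<Sum>l\<le>L. gN nabs r n (fps_nth F l) * \<rho> ^ l) \<le> C"
    using assms unfolding xy_conv_def xy_bound_def by blast
  have "(\<Sum>l\<le>L. gN nabs r n (fps_nth (fps_deriv F) l) * (\<rho> / 2) ^ l) \<le> C / \<rho>" for n L
  proof -
    have "gN nabs r n (fps_nth (fps_deriv F) l) * (\<rho> / 2) ^ l \<le>
        gN nabs r n (fps_nth F (Suc l)) * \<rho> ^ Suc l / \<rho>" for l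
    proof -
      have "of_nat (l + 1) \<le> (2 :: real) ^ l"
        by (induction l) auto
      hence l: "of_nat (l + 1) * (\<rho> / 2) ^ l \<le> \<rho> ^ l"
        using b by (simp add: power_divide divide_simps)
      have "gN nabs r n (fps_nth (fps_deriv F) l) \<le> of_nat (l + 1) * gN nabs r n (fps_nth F (Suc l))"
        using nabs.N_of_nat_mult[of r n "l + 1" "fps_nth F (Suc l)"] b by simp
      hence "gN nabs r n (fps_nth (fps_deriv F) l) * (\<rho> / 2) ^ l \<le>
          gN nabs r n (fps_nth F (Suc l)) * (of_nat (l + 1) * (\<rho> / 2) ^ l)"
        using b mult_right_mono[of _ _ "(\<rho> / 2) ^ l"] by (simp add: mult_ac)
      also have "\<dots> \<le> gN nabs r n (fps_nth F (Suc l)) * \<rho> ^ l"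
        using l b by (intro mult_left_mono nabs.N_nonneg) auto
      finally show ?thesis using b by simp
    qed
    hence "(\<Sum>l\<le>L. gN nabs r n (fps_nth (fps_deriv F) l) * (\<rho> / 2) ^ l) \<le>
        (\<Sum>l\<le>L. gN nabs r n (fps_nth F (Suc l)) * \<rho> ^ Suc l) / \<rho>"
      unfolding sum_divide_distrib by (rule sum_mono)
    also have "(\<Sum>l\<le>L. gN nabs r n (fps_nth F (Suc l)) * \<rho> ^ Suc l) \<le>
        (\<Sum>l\<le>Suc L. gN nabs r n (fps_nth F l) * \<rho> ^ l)"
      unfolding sum.atMost_Suc_shift using b nabs.N_nonneg[of r n] by simp
    also have "\<dots> \<le> C" by (rule b)
    finally show ?thesis using b by (simp add: divide_right_mono)
  qed
  hence "xy_bound (fps_deriv F) r (\<rho> / 2) (C / \<rho>)"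
    using b by (simp add: xy_bound_def)
  thus ?thesis unfolding xy_conv_def by blast
qed

lemma small_radius:
  assumes P: "ord_ge 1 P" "x_conv P" and e: "0 < e" "0 < r"
  obtains s where "0 < s" "s \<le> r" "\<And>n. gN nabs s n P \<le> e"
proof -
  obtain r1 B where B: "r1 > 0" "\<And>n. gN nabs r1 n P \<le> B"
    using P unfolding x_conv_def by blast
  have B0: "0 \<le> B" using B(2)[of 0] nabs.N_nonneg[of r1 0 P] B(1) by linarith
  define s where "s = min r (min r1 (r1 * e / (B + 1)))"
  have s: "0 < s" "s \<le> r" "s \<le> r1" "s \<le> r1 * e / (B + 1)"
    using e B B0 by (auto simp: s_def)
  have "gN nabs s n P \<le> e" for n
  proof -
    have "gN nabs s n P \<le> (s / r1) ^ 1 * gN nabs r1 n P"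
      using nabs.N_scale[OF P(1), of s r1 n] s B by simp
    also have "\<dots> \<le> (s / r1) * (B + 1)"
      unfolding power_one_right using B(2)[of n] s B(1) by (intro mult_left_mono) auto
    also have "\<dots> \<le> (r1 * e / (B + 1) / r1) * (B + 1)"
      using s B B0 by (intro mult_right_mono divide_right_mono) auto
    also have "\<dots> = e"
    proof -
      have "r1 * e / b / r1 * b = e" if "b > 0" for b
        using that B(1) by (simp add: field_simps)
      from this[of "B + 1"] show ?thesis using B0 by auto
    qed
    finally show ?thesis .
  qed
  thus ?thesis using s by (intro that[of s])
qed

text \<open>Expanding around \<open>y = P (x)\<close> costs the size of \<open>P\<close> in the radius of convergence in
  \<open>y\<close>, and this size is small on a small polydisc.\<close>

lemma xy_conv_shift:
  assumes F: "xy_conv F" and P: "ord_ge 1 P" "x_conv P"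
  shows "xy_conv (shift_y F P)"
proof -
  obtain r \<rho> C where F': "xy_bound F r \<rho> C"
    using F unfolding xy_conv_def by blast
  hence r: "0 < r" "0 < \<rho>" by (auto simp: xy_bound_def)
  obtain r2 where r2: "0 < r2" "r2 \<le> r" and NP: "\<And>n. gN nabs r2 n P \<le> \<rho> / 2"
    using small_radius[OF P, of "\<rho> / 2" r] r by auto
  have "(\<Sum>j\<le>J. gN nabs r2 n (fps_nth (shift_y F P) j) * (\<rho> / 2) ^ j) \<le> C" for n J
  proof -
    let ?N = "\<lambda>m. gN nabs r2 n (fps_nth F m)"
    let ?T = "\<lambda>l j. of_nat ((l + j) choose j) * ?N (l + j) * (\<rho> / 2) ^ l * (\<rho> / 2) ^ j"
    have T0: "?T l j \<ge> 0" for l j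
      using r r2 by (intro mult_nonneg_nonneg nabs.N_nonneg) auto
    have "gN nabs r2 n (fps_nth (shift_y F P) j) * (\<rho> / 2) ^ j \<le> (\<Sum>l\<le>n. ?T l j)" for j
    proof -
      have "gN nabs r2 n (fps_nth (shift_y F P) j) \<le>
          (\<Sum>l\<le>n. gN nabs r2 n (fps_nth (hasse j F) l) * gN nabs r2 n P ^ l)"
        unfolding shift_y_def fps_nth_Abs_fps using r2 by (intro nabs.N_subst_y P) auto
      also have "\<dots> \<le> (\<Sum>l\<le>n. (of_nat ((l + j) choose j) * ?N (l + j)) * (\<rho> / 2) ^ l)"
        using r2 unfolding hasse_def fps_nth_Abs_fps
        by (intro sum_mono mult_mono nabs.N_of_nat_mult power_mono NP nabs.N_nonneg
            mult_nonneg_nonneg zero_le_power) auto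
      finally have "gN nabs r2 n (fps_nth (shift_y F P) j) * (\<rho> / 2) ^ j \<le>
          (\<Sum>l\<le>n. (of_nat ((l + j) choose j) * ?N (l + j)) * (\<rho> / 2) ^ l) * (\<rho> / 2) ^ j"
        using r by (intro mult_right_mono) auto
      thus ?thesis by (simp add: sum_distrib_right)
    qed
    hence "(\<Sum>j\<le>J. gN nabs r2 n (fps_nth (shift_y F P) j) * (\<rho> / 2) ^ j) \<le>
        (\<Sum>j\<le>J. \<Sum>l\<le>n. ?T l j)"
      by (rule sum_mono)
    also have "\<dots> = (\<Sum>(l, j)\<in>{..n} \<times> {..J}. ?T l j)"
      by (subst sum.swap) (simp add: sum.cartesian_product)
    also have "\<dots> \<le> (\<Sum>(l, j)\<in>{(l, j). l + j \<le> n + J}. ?T l j)"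
    proof (rule sum_mono2)
      have "{(l, j). l + j \<le> n + J} \<subseteq> {..n + J} \<times> {..n + J}" by auto
      thus "finite {(l, j). l + j \<le> n + J}" by (rule finite_subset) auto
    qed (use T0 in auto)
    also have "\<dots> = (\<Sum>m\<le>n + J. \<Sum>i\<le>m. ?T i (m - i))"
      by (simp add: sum.triangle_reindex_eq)
    also have "\<dots> = (\<Sum>m\<le>n + J. ?N m * \<rho> ^ m)"
    proof (rule sum.cong[OF refl])
      fix m
      have "(\<Sum>i\<le>m. ?T i (m - i)) =
          (\<Sum>i\<le>m. ?N m * (of_nat (m choose i) * (\<rho> / 2) ^ i * (\<rho> / 2) ^ (m - i)))"
        by (rule sum.cong[OF refl]) (auto simp: mult_ac dest: binomial_symmetric)
      also have "\<dots> = ?N m * (\<rho> / 2 + \<rho> / 2) ^ m"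
        by (simp only: binomial_ring sum_distrib_left)
      finally show "(\<Sum>i\<le>m. ?T i (m - i)) = ?N m * \<rho> ^ m" by simp
    qed
    also have "\<dots> \<le> C"
      using xy_bound_mono[OF F' r2(1,2)] by (simp add: xy_bound_def)
    finally show ?thesis .
  qed
  hence "xy_bound (shift_y F P) r2 (\<rho> / 2) C"
    using r r2 by (simp add: xy_bound_def)
  thus ?thesis unfolding xy_conv_def by blast
qed

lemma sum_mdeg_le:
  fixes g :: "('m::finite) mindex \<Rightarrow> real"
  assumes "finite K" "\<And>k. g k \<ge> 0"
  obtains n where "(\<Sum>k\<in>K. g k) \<le> (\<Sum>d\<le>n. \<Sum>k | mdeg k = d. g k)"
proof
  let ?n = "Max (insert 0 (mdeg ` K))"
  have "(\<Sum>k\<in>K. g k) \<le> (\<Sum>k\<in>(\<Union>d\<in>{..?n}. {k. mdeg k = d}). g k)"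
    using assms by (intro sum_mono2) auto
  also have "\<dots> = (\<Sum>d\<le>?n. \<Sum>k | mdeg k = d. g k)"
    by (rule sum.UNION_disjoint) auto
  finally show "(\<Sum>k\<in>K. g k) \<le> (\<Sum>d\<le>?n. \<Sum>k | mdeg k = d. g k)" .
qed

lemma nabs_bound_abs_summable:
  fixes a :: "('m::finite) mser"
  assumes C: "\<And>n. gN nabs r n a \<le> C" and x: "\<And>i. norm (x $ i) \<le> r"
  shows "(\<lambda>k. norm (coef a k * monomial x k)) summable_on UNIV"
proof (rule nonneg_bounded_partial_sums_imp_summable_on[where C = C])
  show "\<forall>\<^sub>F K in finite_subsets_at_top UNIV. (\<Sum>k\<in>K. norm (coef a k * monomial x k)) \<le> C"
  proof (intro eventually_finite_subsets_at_top_weakI)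
    fix K :: "'m mindex set" assume "finite K"
    then obtain n where "(\<Sum>k\<in>K. norm (coef a k * monomial x k)) \<le>
        (\<Sum>d\<le>n. \<Sum>k | mdeg k = d. norm (coef a k * monomial x k))"
      using sum_mdeg_le[of K "\<lambda>k. norm (coef a k * monomial x k)"] by auto
    also have "\<dots> \<le> (\<Sum>d\<le>n. \<Sum>k | mdeg k = d. norm (coef a k) * r ^ d)"
      using norm_monomial_le[OF x] by (intro sum_mono) (auto simp: norm_mult intro!: mult_left_mono)
    also have "\<dots> = gN nabs r n a" by (simp add: gN_def nabs_def sum_distrib_right)
    also have "\<dots> \<le> C" by (rule C)
    finally show "(\<Sum>k\<in>K. norm (coef a k * monomial x k)) \<le> C" .
  qed
qed simp

lemma x_conv_converges_near_0:
  assumes "x_conv a" shows "converges_near_0 (coef a)"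
proof -
  obtain r C where r: "r > 0" "\<And>n. gN nabs r n a \<le> C"
    using assms unfolding x_conv_def by blast
  have "(\<lambda>k. coef a k * monomial x k) summable_on UNIV" if "norm x < r" for x :: "complex ^ 'a"
  proof -
    have "norm (x $ i) \<le> r" for i
      using Finite_Cartesian_Product.norm_nth_le[of x i] that by linarith
    thus ?thesis
      by (rule abs_summable_summable[OF nabs_bound_abs_summable[OF r(2)]])
  qed
  thus ?thesis unfolding converges_near_0_def using r(1) by blast
qed

section \<open>Sums of convergent power series\<close>

text \<open>The sum is taken by degrees: as an ordinary series it is compatible with Cauchy products and
  with term-by-term differentiation, and where the partial sums of absolute values are bounded it
  agrees with the unordered sum over all monomials.\<close>

definition evalm :: "('m::finite) mser \<Rightarrow> complex ^ 'm \<Rightarrow> complex" where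
  "evalm A h = (\<Sum>d. hpart h A d)"

definition bdd_at :: "real \<Rightarrow> ('m::finite) mser \<Rightarrow> bool" where
  "bdd_at r A \<longleftrightarrow> (\<exists>C. \<forall>n. gN nabs r n A \<le> C)"

lemma bdd_at_iff_summable:
  assumes "0 \<le> r" shows "bdd_at r A \<longleftrightarrow> summable (\<lambda>d. nabs A d * r ^ d)"
proof
  assume "bdd_at r A"
  then obtain C where "\<And>n. (\<Sum>d\<le>n. nabs A d * r ^ d) \<le> C"
    unfolding bdd_at_def gN_def by blast
  thus "summable (\<lambda>d. nabs A d * r ^ d)"
    using assms by (intro bounded_imp_summable[where B = C]) (auto simp: nabs.nonneg)
next
  assume s: "summable (\<lambda>d. nabs A d * r ^ d)"
  have "gN nabs r n A \<le> (\<Sum>d. nabs A d * r ^ d)" for n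
    unfolding gN_def using assms by (intro sum_le_suminf s) (auto simp: nabs.nonneg)
  thus "bdd_at r A" unfolding bdd_at_def by blast
qed

lemma x_conv_iff: "x_conv A \<longleftrightarrow> (\<exists>r>0. bdd_at r A)"
  by (simp add: x_conv_def bdd_at_def)

lemma bdd_at_mono: "bdd_at r A \<Longrightarrow> 0 \<le> r' \<Longrightarrow> r' \<le> r \<Longrightarrow> bdd_at r' A"
  unfolding bdd_at_def by (meson nabs_N_mono_r order_trans)

lemma bdd_at_diff: "bdd_at r A \<Longrightarrow> bdd_at r B \<Longrightarrow> 0 \<le> r \<Longrightarrow> bdd_at r (A - B)"
  unfolding bdd_at_def by (meson add_mono nabs.N_diff order_trans)

lemma bdd_at_add: "bdd_at r A \<Longrightarrow> bdd_at r B \<Longrightarrow> 0 \<le> r \<Longrightarrow> bdd_at r (A + B)"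
  unfolding bdd_at_def by (meson add_mono nabs.N_add order_trans)

lemma bdd_at_mult:
  assumes "bdd_at r A" "bdd_at r B" "0 \<le> r" shows "bdd_at r (A * B)"
proof -
  obtain C D where C: "\<And>n. gN nabs r n A \<le> C" and D: "\<And>n. gN nabs r n B \<le> D"
    using assms unfolding bdd_at_def by blast
  have "0 \<le> C" using order_trans[OF nabs.N_nonneg[OF assms(3)] C] .
  have "gN nabs r n (A * B) \<le> C * D" for n
    by (rule order_trans[OF nabs.N_mult[OF assms(3)]])
      (intro mult_mono C D nabs.N_nonneg assms \<open>0 \<le> C\<close>)
  thus ?thesis unfolding bdd_at_def by blast
qed

lemma norm_hpart_le_box:
  assumes "\<And>i. norm (h $ i) \<le> r" shows "norm (hpart h A d) \<le> nabs A d * r ^ d"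
  unfolding hpart_def nabs_def sum_distrib_right
  using norm_monomial_le[OF assms]
  by (intro sum_norm_le) (auto simp: norm_mult intro!: mult_left_mono)

lemma hpart_abs_summable:
  assumes "bdd_at r A" "0 \<le> r" "\<And>i. norm (h $ i) \<le> r"
  shows "summable (\<lambda>d. norm (hpart h A d))"
  by (rule summable_comparison_test[of _ "\<lambda>d. nabs A d * r ^ d"])
    (use assms norm_hpart_le_box[OF assms(3)] in \<open>auto simp: bdd_at_iff_summable\<close>)

lemma evalm_sums:
  assumes "bdd_at r A" "0 \<le> r" "\<And>i. norm (h $ i) \<le> r"
  shows "(\<lambda>d. hpart h A d) sums evalm A h"
  unfolding evalm_def
  by (rule summable_sums[OF summable_norm_cancel[OF hpart_abs_summable[OF assms]]])

lemma has_sum_mdeg_sums: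
  fixes g :: "('m::finite) mindex \<Rightarrow> complex"
  assumes "(g has_sum s) UNIV"
  shows "(\<lambda>d. \<Sum>k | mdeg k = d. g k) sums s"
proof -
  have bij: "bij_betw snd (Sigma UNIV (\<lambda>d. {k :: 'm mindex. mdeg k = d})) UNIV"
    by (rule bij_betwI[of _ _ _ "\<lambda>k. (mdeg k, k)"]) auto
  have "((\<lambda>u. g (snd u)) has_sum s) (Sigma UNIV (\<lambda>d. {k. mdeg k = d}))"
    using has_sum_reindex_bij_betw[OF bij, of g s] assms by simp
  moreover have "((\<lambda>k. g (snd (d, k))) has_sum (\<Sum>k | mdeg k = d. g k)) {k. mdeg k = d}" for d
    by (simp add: has_sum_finite)
  ultimately have "((\<lambda>d. \<Sum>k | mdeg k = d. g k) has_sum s) UNIV"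
    by (rule has_sum_Sigma')
  thus ?thesis by (rule has_sum_imp_sums)
qed

lemma evalm_has_sum:
  assumes "bdd_at r A" "\<And>i. norm (h $ i) \<le> r"
  shows "((\<lambda>k. coef A k * monomial h k) has_sum evalm A h) UNIV"
proof -
  obtain C where "\<And>n. gN nabs r n A \<le> C" using assms unfolding bdd_at_def by blast
  from nabs_bound_abs_summable[OF this assms(2)]
  have "(\<lambda>k. coef A k * monomial h k) summable_on UNIV"
    by (rule abs_summable_summable)
  then obtain s where s: "((\<lambda>k. coef A k * monomial h k) has_sum s) UNIV"
    by (auto simp: summable_on_def)
  from has_sum_mdeg_sums[OF this] have "s = evalm A h"
    by (simp add: evalm_def hpart_def sums_unique)
  thus ?thesis using s by simp
qed

lemma summable_imp_bdd_at:
  fixes A :: "('m::finite) mser"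
  assumes "(\<lambda>k. coef A k * monomial (\<chi> i. of_real r) k) summable_on UNIV" "0 \<le> r"
  shows "bdd_at r A"
proof -
  let ?g = "\<lambda>k. norm (coef A k * monomial (\<chi> i. of_real r) k)"
  have s: "?g summable_on UNIV"
    using assms(1) by (simp only: summable_on_iff_abs_summable_on_complex)
  have g: "?g k = norm (coef A k) * r ^ mdeg k" for k
    using assms(2)
    by (simp add: norm_mult monomial_def norm_power mdeg_def power_sum flip: prod_norm)
  have "gN nabs r n A \<le> infsum ?g UNIV" for n
  proof -
    have "gN nabs r n A = (\<Sum>d\<le>n. \<Sum>k | mdeg k = d. ?g k)"
      unfolding gN_def nabs_def sum_distrib_right by (intro sum.cong refl) (auto simp: g)
    also have "\<dots> = (\<Sum>k\<in>(\<Union>d\<in>{..n}. {k. mdeg k = d}). ?g k)"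
      by (rule sum.UNION_disjoint[symmetric]) auto
    also have "\<dots> \<le> infsum ?g UNIV"
      by (intro finite_sum_le_infsum s) auto
    finally show ?thesis .
  qed
  thus ?thesis unfolding bdd_at_def by blast
qed

lemma evalm_add:
  assumes "bdd_at r A" "bdd_at r B" "0 \<le> r" "\<And>i. norm (h $ i) \<le> r"
  shows "evalm (A + B) h = evalm A h + evalm B h"
proof -
  have "(\<lambda>d. hpart h A d + hpart h B d) sums (evalm A h + evalm B h)"
    by (intro sums_add evalm_sums[OF _ assms(3,4)] assms)
  moreover have "hpart h (A + B) d = hpart h A d + hpart h B d" for d
    by (simp add: hpart_def coef_simps distrib_right sum.distrib)
  ultimately show ?thesis by (simp add: evalm_def sums_iff)
qed

lemma hpart_diff: "hpart h (A - B) d = hpart h A d - hpart h B d"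
  by (simp add: hpart_def coef_simps left_diff_distrib sum_subtractf)

lemma evalm_diff:
  assumes "bdd_at r A" "bdd_at r B" "0 \<le> r" "\<And>i. norm (h $ i) \<le> r"
  shows "evalm (A - B) h = evalm A h - evalm B h"
proof -
  have "(\<lambda>d. hpart h A d - hpart h B d) sums (evalm A h - evalm B h)"
    by (intro sums_diff evalm_sums[OF _ assms(3,4)] assms)
  thus ?thesis by (simp add: evalm_def hpart_diff sums_iff)
qed

text \<open>By degrees, the product of series is the Cauchy product.\<close>

lemma evalm_mult:
  assumes "bdd_at r A" "bdd_at r B" "0 \<le> r" "\<And>i. norm (h $ i) \<le> r"
  shows "evalm (A * B) h = evalm A h * evalm B h"
  unfolding evalm_def hpart_mult
  by (rule Cauchy_product[symmetric]) (intro hpart_abs_summable[OF _ assms(3,4)] assms)+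

subsection \<open>Differentiation\<close>

lemma mdeg_minus_1:
  fixes k :: "('m::finite) mindex"
  assumes "k i \<noteq> 0" shows "mdeg (k(i := k i - 1)) + 1 = mdeg k"
  using mdeg_upd_Suc[of "k(i := k i - 1)" i] assms by simp

lemma sum_mdeg_pred:
  fixes k :: "('m::finite) mindex" and g :: "('m::finite) mindex \<Rightarrow> 'b::comm_monoid_add"
  assumes "\<And>k. k i = 0 \<Longrightarrow> g k = 0"
  shows "(\<Sum>k | mdeg k = Suc d. g k) = (\<Sum>k | mdeg k = d. g (k(i := k i + 1)))"
proof -
  have "(\<Sum>k | mdeg k = Suc d. g k) = (\<Sum>k\<in>{k. mdeg k = Suc d \<and> k i \<noteq> 0}. g k)"
  proof (rule sum.mono_neutral_right)
    show "finite {k :: 'm mindex. mdeg k = Suc d}" by simp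
  qed (use assms in auto)
  also have "\<dots> = (\<Sum>k | mdeg k = d. g (k(i := k i + 1)))"
  proof -
    have pred: "mdeg (k(i := k i - 1)) = d" if "mdeg k = Suc d" "k i \<noteq> 0" for k :: "'m mindex"
      using mdeg_minus_1[of k i] that by simp
    show ?thesis
    by (rule sum.reindex_bij_witness[of _ "\<lambda>k. k(i := k i + 1)" "\<lambda>k. k(i := k i - 1)"])
      (use mdeg_upd_Suc[of _ i] pred in auto)
  qed
  finally show ?thesis .
qed

lemma nabs_pd: "nabs (pd i A) d \<le> of_nat (d + 1) * nabs A (Suc d)"
proof -
  let ?g = "\<lambda>k. if k i = 0 then 0 else norm (coef A k)"
  have "nabs (pd i A) d \<le> (\<Sum>k | mdeg k = d. of_nat (d + 1) * ?g (k(i := k i + 1)))"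
    unfolding nabs_def
  proof (rule sum_mono)
    fix k :: "'a mindex" assume "k \<in> {k. mdeg k = d}"
    hence "k i \<le> d" by (auto simp: mdeg_def intro: member_le_sum)
    hence "real (k i + 1) * norm (coef A (k(i := k i + 1))) \<le>
        real (d + 1) * norm (coef A (k(i := k i + 1)))"
      by (intro mult_right_mono) auto
    moreover have "norm (1 + complex_of_nat (k i)) = 1 + real (k i)"
      by (metis norm_of_nat of_nat_Suc)
    ultimately show "norm (coef (pd i A) k) \<le> of_nat (d + 1) * ?g (k(i := k i + 1))"
      by (simp add: coef_pd norm_mult)
  qed
  also have "\<dots> = of_nat (d + 1) * (\<Sum>k | mdeg k = Suc d. ?g k)"
    by (subst sum_mdeg_pred[where i = i]) (auto simp: sum_distrib_left)
  also have "\<dots> \<le> of_nat (d + 1) * nabs A (Suc d)"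
    unfolding nabs_def by (intro mult_left_mono sum_mono) auto
  finally show ?thesis .
qed

lemma bdd_at_pd:
  assumes "bdd_at r A" "0 < r" shows "bdd_at (r / 2) (pd i A)"
proof -
  have "summable (\<lambda>d. nabs A (Suc d) * r ^ Suc d)"
    using assms by (subst summable_Suc_iff) (simp add: bdd_at_iff_summable)
  hence s: "summable (\<lambda>d. nabs A (Suc d) * r ^ Suc d / r)" by (rule summable_divide)
  have "summable (\<lambda>d. nabs (pd i A) d * (r / 2) ^ d)"
  proof (rule summable_comparison_test'[OF s, of 0])
    fix d
    have "of_nat (d + 1) \<le> (2 :: real) ^ d" by (induction d) auto
    hence d: "of_nat (d + 1) * (r / 2) ^ d \<le> r ^ d"
      using assms by (simp add: power_divide divide_simps)
    have "nabs (pd i A) d * (r / 2) ^ d \<le> (of_nat (d + 1) * nabs A (Suc d)) * (r / 2) ^ d"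
      using assms by (intro mult_right_mono nabs_pd) auto
    also have "\<dots> = nabs A (Suc d) * (of_nat (d + 1) * (r / 2) ^ d)" by (simp add: mult_ac)
    also have "\<dots> \<le> nabs A (Suc d) * r ^ d" by (intro mult_left_mono d nabs.nonneg)
    finally show "norm (nabs (pd i A) d * (r / 2) ^ d) \<le> nabs A (Suc d) * r ^ Suc d / r"
      using assms by (simp add: nabs.nonneg)
  qed
  thus ?thesis using assms by (simp add: bdd_at_iff_summable)
qed

lemma monomial_has_derivative:
  "((\<lambda>x. monomial x k) has_derivative
     (\<lambda>v. \<Sum>i\<in>UNIV. v $ i * (of_nat (k i) * monomial x (k(i := k i - 1))))) (at x within S)"
  for x :: "complex ^ ('m::finite)"
proof -
  have "((\<lambda>x. monomial x k) has_derivative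
     (\<lambda>v. \<Sum>i\<in>UNIV. (of_nat (k i) * v $ i * (x $ i) ^ (k i - 1)) *
        (\<Prod>j\<in>UNIV - {i}. (x $ j) ^ k j))) (at x within S)"
    unfolding monomial_def
    by (intro has_derivative_prod has_derivative_power bounded_linear_imp_has_derivative
        bounded_linear_vec_nth)
  also have "(\<lambda>v. \<Sum>i\<in>UNIV. (of_nat (k i) * v $ i * (x $ i) ^ (k i - 1)) *
        (\<Prod>j\<in>UNIV - {i}. (x $ j) ^ k j)) =
      (\<lambda>v. \<Sum>i\<in>UNIV. v $ i * (of_nat (k i) * monomial x (k(i := k i - 1))))"
  proof (intro ext sum.cong refl)
    fix v :: "complex ^ 'm" and i :: 'm
    have "monomial x (k(i := k i - 1)) =
        (x $ i) ^ (k i - 1) * (\<Prod>j\<in>UNIV - {i}. (x $ j) ^ (k(i := k i - 1)) j)"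
      unfolding monomial_def by (subst prod.remove[of _ i]) auto
    also have "(\<Prod>j\<in>UNIV - {i}. (x $ j) ^ (k(i := k i - 1)) j) =
        (\<Prod>j\<in>UNIV - {i}. (x $ j) ^ k j)"
      by (rule prod.cong) auto
    finally have m: "monomial x (k(i := k i - 1)) =
        (x $ i) ^ (k i - 1) * (\<Prod>j\<in>UNIV - {i}. (x $ j) ^ k j)" .
    show "(of_nat (k i) * v $ i * (x $ i) ^ (k i - 1)) *
        (\<Prod>j\<in>UNIV - {i}. (x $ j) ^ k j) =
        v $ i * (of_nat (k i) * monomial x (k(i := k i - 1)))"
      unfolding m by (simp only: mult_ac)
  qed
  finally show ?thesis .
qed

lemma hpart_has_derivative:
  fixes x :: "complex ^ ('m::finite)"
  shows "((\<lambda>x. hpart x A (Suc d)) has_derivative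
     (\<lambda>v. \<Sum>i\<in>UNIV. v $ i * hpart x (pd i A) d)) (at x within S)"
proof -
  have "((\<lambda>x. hpart x A (Suc d)) has_derivative
     (\<lambda>v. \<Sum>k | mdeg k = Suc d. coef A k *
        (\<Sum>i\<in>UNIV. v $ i * (of_nat (k i) * monomial x (k(i := k i - 1)))))) (at x within S)"
    unfolding hpart_def
    by (intro has_derivative_sum has_derivative_mult_right monomial_has_derivative)
  also have "(\<lambda>v. \<Sum>k | mdeg k = Suc d. coef A k *
        (\<Sum>i\<in>UNIV. v $ i * (of_nat (k i) * monomial x (k(i := k i - 1))))) =
      (\<lambda>v. \<Sum>i\<in>UNIV. v $ i * hpart x (pd i A) d)"
  proof
    fix v :: "complex ^ 'm"
    let ?g = "\<lambda>i k. of_nat (k i) * coef A k * monomial x (k(i := k i - 1))"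
    have "(\<Sum>k | mdeg k = Suc d. coef A k *
        (\<Sum>i\<in>UNIV. v $ i * (of_nat (k i) * monomial x (k(i := k i - 1))))) =
        (\<Sum>i\<in>UNIV. v $ i * (\<Sum>k | mdeg k = Suc d. ?g i k))"
      unfolding sum_distrib_left by (subst sum.swap) (simp add: mult_ac)
    moreover have "(\<Sum>k | mdeg k = Suc d. ?g i k) = hpart x (pd i A) d" for i
      unfolding hpart_def by (subst sum_mdeg_pred[where i = i]) (auto simp: coef_pd)
    ultimately show "(\<Sum>k | mdeg k = Suc d. coef A k *
        (\<Sum>i\<in>UNIV. v $ i * (of_nat (k i) * monomial x (k(i := k i - 1))))) =
        (\<Sum>i\<in>UNIV. v $ i * hpart x (pd i A) d)"
      by simp
  qed
  finally show ?thesis .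
qed

definition box_at :: "real \<Rightarrow> (complex ^ 'm) set" where
  "box_at r = {h. \<forall>i. norm (h $ i) < r}"

lemma open_box_at: "open (box_at r :: (complex ^ 'm) set)"
proof -
  have "box_at r = (\<Inter>i\<in>UNIV. {h :: complex ^ 'm. norm (h $ i) < r})"
    by (auto simp: box_at_def)
  moreover have "open {h :: complex ^ 'm. norm (h $ i) < r}" for i
    by (intro open_Collect_less continuous_intros)
  ultimately show ?thesis by auto
qed

lemma convex_box_at: "convex (box_at r :: (complex ^ 'm) set)"
proof -
  have "box_at r = (\<Inter>i\<in>UNIV. (\<lambda>h :: complex ^ 'm. h $ i) -` ball 0 r)"
    by (auto simp: box_at_def)
  thus ?thesis
    by (auto intro!: convex_INT convex_linear_vimage bounded_linear.linear bounded_linear_vec_nth)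
qed

lemma box_at_mono: "r \<le> r' \<Longrightarrow> box_at r \<subseteq> box_at r'"
  unfolding box_at_def by (auto intro: less_le_trans)

lemma zero_in_box_at [simp]: "0 < r \<Longrightarrow> 0 \<in> box_at r"
  by (simp add: box_at_def)

lemma hpart_0: "hpart x A 0 = coef A (\<lambda>_. 0)"
  by (simp add: hpart_def mdeg_zero_set monomial_def)

lemma evalm_uniform_limit:
  fixes A :: "('m::finite) mser"
  assumes "bdd_at r A" "0 \<le> r"
  shows "uniform_limit (box_at r) (\<lambda>n x. \<Sum>d<n. hpart x A d) (evalm A) sequentially"
proof -
  have "uniform_limit (box_at r :: (complex ^ 'm) set)
      (\<lambda>n x. \<Sum>d<n. hpart x A d) (\<lambda>x. \<Sum>d. hpart x A d) sequentially"
  proof (rule Weierstrass_m_test)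
    show "summable (\<lambda>d. nabs A d * r ^ d)" using assms by (simp add: bdd_at_iff_summable)
    show "norm (hpart x A d) \<le> nabs A d * r ^ d" if "x \<in> box_at r" for d and x :: "complex ^ 'm"
      using that by (intro norm_hpart_le_box) (auto simp: box_at_def intro: less_imp_le)
  qed
  thus ?thesis by (simp add: evalm_def[abs_def])
qed

text \<open>Term-by-term differentiation: the series of derivatives converges uniformly on the
  polydisc of half the radius.\<close>

lemma evalm_has_derivative:
  fixes A :: "('m::finite) mser"
  assumes bd: "bdd_at r A" and r: "0 < r" and h: "h \<in> box_at (r / 2)"
  shows "(evalm A has_derivative (\<lambda>v. \<Sum>i\<in>UNIV. v $ i * evalm (pd i A) h)) (at h)"
proof -
  let ?S = "box_at (r / 2) :: (complex ^ 'm) set"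
  let ?f' = "\<lambda>d x v. case d of 0 \<Rightarrow> 0 | Suc d \<Rightarrow> \<Sum>i\<in>UNIV. v $ i * hpart x (pd i A) d"
  have S: "norm (x $ i) \<le> r" if "x \<in> ?S" for x i
  proof -
    have "norm (x $ i) < r / 2" using that unfolding box_at_def by blast
    thus ?thesis using r by linarith
  qed
  have "\<exists>g. \<forall>x\<in>?S. (\<lambda>d. hpart x A d) sums g x \<and>
      (g has_derivative (\<lambda>v. \<Sum>i\<in>UNIV. v $ i * evalm (pd i A) x)) (at x within ?S)"
  proof (rule has_derivative_series[where f' = ?f' and x = h and l = "evalm A h"])
    show "((\<lambda>x. hpart x A d) has_derivative ?f' d x) (at x within ?S)" for d x
      by (cases d) (simp_all add: hpart_0 hpart_has_derivative)
    show "(\<lambda>d. hpart h A d) sums evalm A h"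
      using S[OF h] r by (intro evalm_sums[OF bd]) auto
    fix e :: real assume e: "e > 0"
    let ?e = "e / CARD('m)"
    have e': "?e > 0" using e by simp
    have "\<forall>\<^sub>F n in sequentially. \<forall>x\<in>?S. \<forall>i.
        dist (\<Sum>d<n. hpart x (pd i A) d) (evalm (pd i A) x) < ?e"
    proof -
      have "\<forall>\<^sub>F n in sequentially. \<forall>x\<in>?S.
          dist (\<Sum>d<n. hpart x (pd i A) d) (evalm (pd i A) x) < ?e" for i
        using evalm_uniform_limit[OF bdd_at_pd[OF bd r], of i] r e'
        by (auto simp: uniform_limit_iff)
      hence "\<forall>\<^sub>F n in sequentially. \<forall>i. \<forall>x\<in>?S.
          dist (\<Sum>d<n. hpart x (pd i A) d) (evalm (pd i A) x) < ?e"
        by (rule eventually_all_finite)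
      thus ?thesis by eventually_elim auto
    qed
    then obtain N where N: "\<And>n x i. n \<ge> N \<Longrightarrow> x \<in> ?S \<Longrightarrow>
        dist (\<Sum>d<n. hpart x (pd i A) d) (evalm (pd i A) x) < ?e"
      unfolding eventually_sequentially by blast
    have "norm ((\<Sum>d<n. ?f' d x v) - (\<Sum>i\<in>UNIV. v $ i * evalm (pd i A) x)) \<le> e * norm v"
      if n: "n \<ge> Suc N" and x: "x \<in> ?S" for n x v
    proof -
      obtain n' where n': "n = Suc n'" "n' \<ge> N" using n by (cases n) auto
      have "(\<Sum>d<n. ?f' d x v) = (\<Sum>d<n'. \<Sum>i\<in>UNIV. v $ i * hpart x (pd i A) d)"
        unfolding n' by (subst sum.lessThan_Suc_shift) simp
      also have "\<dots> = (\<Sum>i\<in>UNIV. v $ i * (\<Sum>d<n'. hpart x (pd i A) d))"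
        by (subst sum.swap) (simp add: sum_distrib_left)
      finally have "(\<Sum>d<n. ?f' d x v) - (\<Sum>i\<in>UNIV. v $ i * evalm (pd i A) x) =
          (\<Sum>i\<in>UNIV. v $ i * ((\<Sum>d<n'. hpart x (pd i A) d) - evalm (pd i A) x))"
        by (simp add: right_diff_distrib sum_subtractf)
      also have "norm \<dots> \<le> (\<Sum>i\<in>(UNIV :: 'm set). norm v * ?e)"
      proof (rule sum_norm_le)
        fix i :: 'm
        have "norm ((\<Sum>d<n'. hpart x (pd i A) d) - evalm (pd i A) x) \<le> ?e"
          using N[OF n'(2) x, of i] by (simp add: dist_norm)
        thus "norm (v $ i * ((\<Sum>d<n'. hpart x (pd i A) d) - evalm (pd i A) x)) \<le> norm v * ?e"
          unfolding norm_mult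
          by (intro mult_mono Finite_Cartesian_Product.norm_nth_le) auto
      qed
      finally show ?thesis by (simp add: mult.commute)
    qed
    thus "\<forall>\<^sub>F n in sequentially. \<forall>x\<in>?S. \<forall>v.
        norm ((\<Sum>d<n. ?f' d x v) - (\<Sum>i\<in>UNIV. v $ i * evalm (pd i A) x)) \<le> e * norm v"
      unfolding eventually_sequentially by blast
  qed (use h in \<open>auto intro: convex_box_at\<close>)
  then obtain g where g: "\<And>x. x \<in> ?S \<Longrightarrow> (\<lambda>d. hpart x A d) sums g x"
    "(g has_derivative (\<lambda>v. \<Sum>i\<in>UNIV. v $ i * evalm (pd i A) h)) (at h within ?S)"
    using h by blast
  have "g x = evalm A x" if "x \<in> ?S" for x
    using g(1)[OF that] by (simp add: evalm_def sums_unique)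
  hence "(evalm A has_derivative (\<lambda>v. \<Sum>i\<in>UNIV. v $ i * evalm (pd i A) h)) (at h within ?S)"
    using has_derivative_transform[OF h _ g(2), of "evalm A"] by simp
  thus ?thesis using at_within_open[OF h open_box_at] by simp
qed

lemma evalm_at_0: "evalm A 0 = coef A (\<lambda>_. 0)" for A :: "('m::finite) mser"
proof -
  have "(\<lambda>d. hpart 0 A d) sums hpart 0 A 0"
  proof (rule sums_single[THEN sums_cong[THEN iffD1, rotated], of 0])
    fix d
    have "monomial 0 k = 0" if "mdeg k = Suc n" for k :: "'m mindex" and n
    proof -
      have "\<not> (\<forall>i. k i = 0)" using that mdeg_eq_0[of k] by (auto simp: fun_eq_iff)
      then obtain i where "k i \<noteq> 0" by blast
      thus ?thesis by (auto simp: monomial_def)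
    qed
    thus "(if d = 0 then hpart 0 A d else 0) = hpart 0 A d"
      by (cases d) (auto simp: hpart_def)
  qed
  thus ?thesis
    by (simp add: evalm_def sums_unique[symmetric] hpart_0)
qed

text \<open>A coefficient of degree \<open>d + 1\<close> is, up to a nonzero factor, a coefficient of degree \<open>d\<close> of a partial
  derivative, whose sum vanishes as well.\<close>

lemma evalm_eq_0_imp_0:
  assumes "0 < r" "bdd_at r A" "\<And>h. h \<in> box_at r \<Longrightarrow> evalm A h = 0"
  shows "A = 0"
proof -
  have "\<forall>k. mdeg k = d \<longrightarrow> coef A k = 0" if "0 < r" "bdd_at r A" "\<forall>h\<in>box_at r. evalm A h = 0"
    for d r and A :: "'a mser"
    using that
  proof (induction d arbitrary: r A)
    case 0
    thus ?case using evalm_at_0[of A] by (auto simp: mdeg_eq_0)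
  next
    case (Suc d)
    show ?case
    proof (intro allI impI)
      fix k :: "'a mindex" assume k: "mdeg k = Suc d"
      have "\<not> (\<forall>i. k i = 0)" using k mdeg_eq_0[of k] by (auto simp: fun_eq_iff)
      then obtain i where i: "k i \<noteq> 0" by blast
      have "evalm (pd i A) h = 0" if h: "h \<in> box_at (r / 2)" for h
      proof -
        have sub: "box_at (r / 2) \<subseteq> (box_at r :: (complex ^ 'a) set)"
          using Suc.prems(1) by (intro box_at_mono) auto
        have "(evalm A has_derivative (\<lambda>v. 0)) (at h)"
        proof (rule has_derivative_transform_within_open[OF _ open_box_at h])
          show "((\<lambda>_. 0) has_derivative (\<lambda>v. 0)) (at h)" by simp
        qed (use Suc.prems(3) sub in auto)
        hence "(\<lambda>v. \<Sum>i\<in>UNIV. v $ i * evalm (pd i A) h) = (\<lambda>v. 0)"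
          using evalm_has_derivative[OF Suc.prems(2,1) h] by (rule has_derivative_unique[symmetric])
        from fun_cong[OF this, of "axis i 1"] show ?thesis
          by (simp add: axis_def if_distrib[where f = "\<lambda>x. x * _"] cong: if_cong)
      qed
      hence "\<forall>k. mdeg k = d \<longrightarrow> coef (pd i A) k = 0"
        using Suc.prems by (intro Suc.IH[of "r / 2"] bdd_at_pd) auto
      moreover have "mdeg (k(i := k i - 1)) = d" using mdeg_minus_1[of k i, OF i] k by simp
      ultimately have "coef (pd i A) (k(i := k i - 1)) = 0" by blast
      thus "coef A k = 0" using i by (simp add: coef_pd)
    qed
  qed
  thus ?thesis using assms by (intro mser_eqI) (auto simp: coef_simps)
qed

section \<open>Power series expansions of functions\<close>

text \<open>Expansions are required on polydiscs rather than balls, and together with a bound on the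
  absolute values, so that sums, products and derivatives are available without further
  convergence arguments.\<close>

definition expands :: "(complex ^ 'm \<Rightarrow> complex) \<Rightarrow> ('m::finite) mser \<Rightarrow> complex ^ 'm \<Rightarrow> bool" where
  "expands f A z \<longleftrightarrow> (\<exists>r>0. bdd_at r A \<and> (\<forall>h\<in>box_at r. f (z + h) = evalm A h))"

lemma box_at_bound: "h \<in> box_at r \<Longrightarrow> norm (h $ i) \<le> r"
  by (auto simp: box_at_def intro: less_imp_le)

lemma norm_le_box:
  fixes h :: "complex ^ 'm" and r :: real
  assumes "h \<in> box_at r" shows "norm h \<le> CARD('m) * r"
proof -
  have "norm h \<le> (\<Sum>i\<in>UNIV. norm (h $ i))"
    unfolding norm_vec_def by (rule L2_set_le_sum) auto
  also have "\<dots> \<le> (\<Sum>i\<in>(UNIV :: 'm set). r)"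
    by (intro sum_mono box_at_bound assms)
  finally show ?thesis by simp
qed

lemma box_in_open:
  fixes z :: "complex ^ 'm"
  assumes "open U" "z \<in> U"
  obtains r where "0 < r" "\<And>h. h \<in> box_at r \<Longrightarrow> z + h \<in> U"
proof -
  obtain e where e: "e > 0" "ball z e \<subseteq> U"
    using assms open_contains_ball by blast
  let ?r = "e / (2 * CARD('m))"
  have "z + h \<in> U" if "h \<in> box_at ?r" for h
  proof -
    have "norm h \<le> e / 2" using norm_le_box[OF that] by simp
    thus ?thesis using e by (auto simp: dist_norm)
  qed
  thus ?thesis using e by (intro that[of ?r]) auto
qed

lemma open_box_around: "open {w. w - z \<in> box_at r}" for z :: "complex ^ 'm"
proof -
  have "open ((\<lambda>w. w - z) -` box_at r)"
    by (intro open_vimage open_box_at continuous_intros)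
  thus ?thesis by (simp add: vimage_def)
qed

lemma expandsE:
  assumes "expands f A z" "0 < e"
  obtains r where "0 < r" "r \<le> e" "bdd_at r A" "\<And>h. h \<in> box_at r \<Longrightarrow> f (z + h) = evalm A h"
proof -
  obtain r where r: "0 < r" "bdd_at r A" "\<forall>h\<in>box_at r. f (z + h) = evalm A h"
    using assms(1) unfolding expands_def by blast
  show ?thesis
    using r assms(2) box_at_mono[of "min r e" r]
    by (intro that[of "min r e"] bdd_at_mono[OF r(2)]) auto
qed

lemma expandsE2:
  assumes "expands f A z" "expands g B z" "0 < e"
  obtains r where "0 < r" "r \<le> e" "bdd_at r A" "bdd_at r B"
    "\<forall>h\<in>box_at r. f (z + h) = evalm A h \<and> g (z + h) = evalm B h"
proof -
  obtain r1 where r1: "0 < r1" "r1 \<le> e" "bdd_at r1 A" "\<And>h. h \<in> box_at r1 \<Longrightarrow> f (z + h) = evalm A h"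
    using expandsE[OF assms(1,3)] by blast
  obtain r2 where r2: "0 < r2" "r2 \<le> r1" "bdd_at r2 B" "\<And>h. h \<in> box_at r2 \<Longrightarrow> g (z + h) = evalm B h"
    using expandsE[OF assms(2) r1(1)] by blast
  show ?thesis
    using r1 r2 box_at_mono[OF r2(2)]
    by (intro that[of r2] bdd_at_mono[OF r1(3)]) auto
qed

lemma expands_cong:
  assumes "expands f A z" "open U" "z \<in> U" "\<And>w. w \<in> U \<Longrightarrow> f w = g w"
  shows "expands g A z"
proof -
  obtain e where e: "0 < e" "\<And>h. h \<in> box_at e \<Longrightarrow> z + h \<in> U"
    using box_in_open[OF assms(2,3)] by blast
  obtain r where r: "0 < r" "r \<le> e" "bdd_at r A" "\<And>h. h \<in> box_at r \<Longrightarrow> f (z + h) = evalm A h"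
    using expandsE[OF assms(1) e(1)] by blast
  have "g (z + h) = evalm A h" if h: "h \<in> box_at r" for h
  proof -
    have "h \<in> box_at e" using h box_at_mono[OF r(2)] by blast
    thus ?thesis using r(4)[OF h] assms(4)[OF e(2)] by simp
  qed
  thus ?thesis unfolding expands_def by (intro exI[of _ r] conjI r ballI)
qed

lemma expands_add:
  assumes "expands f A z" "expands g B z" shows "expands (\<lambda>w. f w + g w) (A + B) z"
proof -
  obtain r where r: "0 < r" "r \<le> 1" "bdd_at r A" "bdd_at r B"
    "\<forall>h\<in>box_at r. f (z + h) = evalm A h \<and> g (z + h) = evalm B h"
    using expandsE2[OF assms zero_less_one] by blast
  have "evalm (A + B) h = f (z + h) + g (z + h)" if "h \<in> box_at r" for h
    using r(1) bspec[OF r(5) that] evalm_add[OF r(3,4) _ box_at_bound[OF that]] by simp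
  thus ?thesis using r bdd_at_add[OF r(3,4)] unfolding expands_def by (intro exI[of _ r]) auto
qed

lemma expands_diff:
  assumes "expands f A z" "expands g B z" shows "expands (\<lambda>w. f w - g w) (A - B) z"
proof -
  obtain r where r: "0 < r" "r \<le> 1" "bdd_at r A" "bdd_at r B"
    "\<forall>h\<in>box_at r. f (z + h) = evalm A h \<and> g (z + h) = evalm B h"
    using expandsE2[OF assms zero_less_one] by blast
  have "evalm (A - B) h = f (z + h) - g (z + h)" if "h \<in> box_at r" for h
    using r(1) bspec[OF r(5) that] evalm_diff[OF r(3,4) _ box_at_bound[OF that]] by simp
  thus ?thesis using r bdd_at_diff[OF r(3,4)] unfolding expands_def by (intro exI[of _ r]) auto
qed

lemma expands_mult:
  assumes "expands f A z" "expands g B z" shows "expands (\<lambda>w. f w * g w) (A * B) z"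
proof -
  obtain r where r: "0 < r" "r \<le> 1" "bdd_at r A" "bdd_at r B"
    "\<forall>h\<in>box_at r. f (z + h) = evalm A h \<and> g (z + h) = evalm B h"
    using expandsE2[OF assms zero_less_one] by blast
  have "evalm (A * B) h = f (z + h) * g (z + h)" if "h \<in> box_at r" for h
    using r(1) bspec[OF r(5) that] evalm_mult[OF r(3,4) _ box_at_bound[OF that]] by simp
  thus ?thesis using r bdd_at_mult[OF r(3,4)] unfolding expands_def by (intro exI[of _ r]) auto
qed

lemma expands_unique:
  assumes "expands f A z" "expands f B z" shows "A = B"
proof -
  obtain r where r: "0 < r" "r \<le> 1" "bdd_at r A" "bdd_at r B"
    "\<forall>h\<in>box_at r. f (z + h) = evalm A h \<and> f (z + h) = evalm B h"
    using expandsE2[OF assms zero_less_one] by blast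
  have "evalm (A - B) h = 0" if "h \<in> box_at r" for h
    using r(1) bspec[OF r(5) that] evalm_diff[OF r(3,4) _ box_at_bound[OF that]] by (metis diff_self less_imp_le)
  hence "A - B = 0"
    using r bdd_at_diff[OF r(3,4)] by (intro evalm_eq_0_imp_0[of r]) auto
  thus ?thesis by simp
qed

lemma expands_unique_nhd:
  assumes "expands f A z" "expands g B z" "open U" "z \<in> U" "\<And>w. w \<in> U \<Longrightarrow> f w = g w"
  shows "A = B"
  using expands_cong[OF assms(1,3-5)] assms(2) by (rule expands_unique)

lemma expands_finite:
  assumes "\<And>k. mdeg k > n \<Longrightarrow> coef A k = 0"
  shows "expands (\<lambda>z. \<Sum>d\<le>n. hpart z A d) A 0"
proof -
  have 0: "nabs A d = 0" "hpart z A d = 0" if "d > n" for d z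
    using assms that by (auto simp: nabs_def hpart_def)
  have "gN nabs 1 m A \<le> (\<Sum>d\<le>n. nabs A d)" for m
  proof -
    have "gN nabs 1 m A = (\<Sum>d\<in>{..m} \<inter> {..n}. nabs A d)"
      unfolding gN_def using 0(1) by (intro sum.mono_neutral_cong_right) (auto, metis not_le_imp_less)
    also have "\<dots> \<le> (\<Sum>d\<le>n. nabs A d)"
      by (intro sum_mono2) (auto simp: nabs.nonneg)
    finally show ?thesis .
  qed
  hence "bdd_at 1 A" unfolding bdd_at_def by blast
  moreover have "(\<Sum>d\<le>n. hpart h A d) = evalm A h" for h
    unfolding evalm_def using 0 by (intro suminf_finite[symmetric]) auto
  ultimately show ?thesis
    unfolding expands_def by (intro exI[of _ 1]) auto
qed

lemma expands_one: "expands (\<lambda>_. 1) 1 0"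
proof -
  have "expands (\<lambda>z. \<Sum>d\<le>0. hpart z 1 d) 1 0"
    by (rule expands_finite) (simp add: coef_1_mdeg)
  thus ?thesis by (simp add: hpart_0 coef_simps)
qed

lemma hpart_Xv: "hpart z (Xv i) 1 = z $ i"
proof -
  let ?e = "\<lambda>v. if v = i then 1 else 0 :: nat"
  have e: "mdeg ?e = 1" by (simp add: mdeg_def)
  have "hpart z (Xv i) 1 = (\<Sum>k\<in>{?e}. coef (Xv i) k * monomial z k)"
    unfolding hpart_def using e by (intro sum.mono_neutral_right) (auto simp: Xv_def)
  also have "\<dots> = monomial z ?e" by (simp add: Xv_def)
  also have "\<dots> = (\<Prod>v\<in>{i}. (z $ v) ^ ?e v)"
    unfolding monomial_def by (rule prod.mono_neutral_right) auto
  finally show ?thesis by simp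
qed

lemma expands_Xv: "expands (\<lambda>z. z $ i) (Xv i) 0"
proof -
  have "coef (Xv i) k = 0" if "mdeg k > 1" for k
    using that by (auto simp: Xv_def mdeg_def)
  moreover have "hpart z (Xv i) 0 = 0" for z
    by (auto simp: hpart_0 Xv_def fun_eq_iff)
  ultimately show ?thesis
    using expands_finite[of 1 "Xv i"] hpart_Xv[of _ i] by simp
qed

lemma expands_Xv_power: "expands (\<lambda>z. (z $ i) ^ n) (Xv i ^ n) 0"
  by (induction n) (auto intro: expands_one expands_mult expands_Xv)

subsection \<open>Differentiation\<close>

lemma expands_has_derivative:
  assumes "expands f A z"
  obtains r where "0 < r" "\<And>h. h \<in> box_at r \<Longrightarrow>
    (f has_derivative (\<lambda>v. \<Sum>i\<in>UNIV. v $ i * evalm (pd i A) h)) (at (z + h))"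
proof -
  obtain r where r: "0 < r" "bdd_at r A" "\<And>h. h \<in> box_at r \<Longrightarrow> f (z + h) = evalm A h"
    using expandsE[OF assms zero_less_one] by blast
  have "(f has_derivative (\<lambda>v. \<Sum>i\<in>UNIV. v $ i * evalm (pd i A) h)) (at (z + h))"
    if h: "h \<in> box_at (r / 2)" for h
  proof -
    let ?U = "{w. w - z \<in> box_at r}"
    have "h \<in> box_at r" using h box_at_mono[of "r / 2" r] r(1) by auto
    hence zU: "z + h \<in> ?U" by simp
    have "((\<lambda>w. w - z) has_derivative (\<lambda>v. v)) (at (z + h))"
      by (auto intro!: derivative_eq_intros)
    moreover have "(evalm A has_derivative (\<lambda>v. \<Sum>i\<in>UNIV. v $ i * evalm (pd i A) h))
        (at ((\<lambda>w. w - z) (z + h)))"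
      using evalm_has_derivative[OF r(2,1) h] by simp
    ultimately have "((\<lambda>w. evalm A (w - z)) has_derivative
        (\<lambda>v. \<Sum>i\<in>UNIV. v $ i * evalm (pd i A) h)) (at (z + h))"
      by (rule has_derivative_compose)
    thus ?thesis
    proof (rule has_derivative_transform_within_open[OF _ open_box_around zU])
      fix w assume "w \<in> ?U"
      thus "evalm A (w - z) = f w" using r(3)[of "w - z"] by simp
    qed
  qed
  thus ?thesis using r(1) by (intro that[of "r / 2"]) auto
qed

lemma bounded_linear_smult: "bounded_linear (\<lambda>s. s *s b)" for b :: "complex ^ 'm"
  by (rule bounded_linear_intro[where K = "norm b"])
    (auto simp: vec_eq_iff algebra_simps norm_vec_def norm_mult L2_set_right_distrib)

text \<open>A derivative of the given form is complex linear, so it gives complex derivatives along complex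
  lines.\<close>

lemma has_derivative_line:
  fixes x b :: "complex ^ 'm"
  assumes "(f has_derivative (\<lambda>v. \<Sum>i\<in>UNIV. v $ i * c i)) (at (x + t *s b))"
  shows "((\<lambda>t. f (x + t *s b)) has_field_derivative (\<Sum>i\<in>UNIV. b $ i * c i)) (at t)"
proof -
  have "((\<lambda>s. x + s *s b) has_derivative (\<lambda>s. s *s b)) (at t)"
    by (auto intro!: derivative_eq_intros
        bounded_linear_imp_has_derivative[OF bounded_linear_smult])
  from has_derivative_compose[OF this assms]
  have "((\<lambda>t. f (x + t *s b)) has_derivative (\<lambda>s. \<Sum>i\<in>UNIV. (s *s b) $ i * c i)) (at t)" .
  moreover have "(\<lambda>s. \<Sum>i\<in>UNIV. (s *s b) $ i * c i) = (*) (\<Sum>i\<in>UNIV. b $ i * c i)"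
    by (auto simp: sum_distrib_left sum_distrib_right mult_ac)
  ultimately show ?thesis by (simp add: has_field_derivative_def)
qed

lemma axis_scale: "axis i t = t *s axis i 1" for t :: complex
  by (simp add: vec_eq_iff axis_def)

lemma partial_deriv_eq:
  fixes x :: "complex ^ 'm"
  assumes "(f has_derivative (\<lambda>v. \<Sum>i\<in>UNIV. v $ i * c i)) (at x)"
  shows "((\<lambda>t. f (x + axis i t)) has_field_derivative c i) (at 0)" "partial_deriv i f x = c i"
proof -
  have "(\<Sum>j\<in>UNIV. axis i 1 $ j * c j) = (\<Sum>j\<in>UNIV. if j = i then c j else 0)"
    by (intro sum.cong) (auto simp: axis_def)
  hence "(\<Sum>j\<in>UNIV. axis i 1 $ j * c j) = c i" by simp
  moreover have "(f has_derivative (\<lambda>v. \<Sum>i\<in>UNIV. v $ i * c i)) (at (x + 0 *s axis i 1))"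
    using assms by simp
  moreover have "(\<lambda>t. f (x + axis i t)) = (\<lambda>t. f (x + t *s axis i 1))"
    by (rule ext, subst axis_scale) (rule refl)
  ultimately show "((\<lambda>t. f (x + axis i t)) has_field_derivative c i) (at 0)"
    using has_derivative_line[of f c x 0 "axis i 1"] by simp
  thus "partial_deriv i f x = c i"
    unfolding partial_deriv_def by (rule DERIV_imp_deriv)
qed

lemma expands_partial_deriv:
  assumes "expands f A z" shows "expands (partial_deriv i f) (pd i A) z"
proof -
  obtain r where r: "0 < r" "\<And>h. h \<in> box_at r \<Longrightarrow>
    (f has_derivative (\<lambda>v. \<Sum>i\<in>UNIV. v $ i * evalm (pd i A) h)) (at (z + h))"
    using expands_has_derivative[OF assms] by blast
  obtain s where s: "0 < s" "bdd_at s A"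
    using assms unfolding expands_def by blast
  have "bdd_at (min r (s / 2)) (pd i A)"
    using bdd_at_mono[OF bdd_at_pd[OF s(2,1)], of "min r (s / 2)"] r(1) s(1) by auto
  moreover have "partial_deriv i f (z + h) = evalm (pd i A) h" if "h \<in> box_at (min r (s / 2))" for h
    using that box_at_mono[of "min r (s / 2)" r] by (intro partial_deriv_eq(2)[OF r(2)]) auto
  ultimately show ?thesis
    using r(1) s(1) unfolding expands_def by (intro exI[of _ "min r (s / 2)"]) auto
qed

section \<open>The identity theorem\<close>

text \<open>Any point of the polydisc is joined to \<open>w\<close> by a complex line, whose intersection with the
  polydisc is convex; there the identity theorem in one variable applies.\<close>

lemma zero_near_imp_zero_on_box:
  fixes z :: "complex ^ ('m::finite)"
  assumes der: "\<And>h. h \<in> box_at r \<Longrightarrow> \<exists>c. (f has_derivative (\<lambda>v. \<Sum>i\<in>UNIV. v $ i * c i)) (at (z + h))"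
    and w: "w - z \<in> box_at r" and W: "open W" "w \<in> W" "\<And>x. x \<in> W \<Longrightarrow> f x = 0"
    and v: "v - z \<in> box_at r"
  shows "f v = 0"
proof -
  let ?l = "\<lambda>t. w + t *s (v - w)"
  let ?S = "{t. ?l t - z \<in> box_at r}"
  have bl: "bounded_linear (\<lambda>t. t *s (v - w))"
    by (rule bounded_linear_smult)
  have cont: "continuous_on UNIV ?l"
    by (intro continuous_intros linear_continuous_on bl)
  have "open ((\<lambda>t. ?l t - z) -` box_at r)"
    by (intro open_vimage open_box_at continuous_intros cont)
  hence S: "open ?S" by (simp add: vimage_def)
  have "?S = (\<lambda>t. t *s (v - w)) -` ((+) (z - w) ` box_at r)"
    by (force simp: algebra_simps image_iff intro: exI[of _ "_ - z"])
  hence "convex ?S"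
    using convex_linear_vimage[OF bounded_linear.linear[OF bl]] convex_translation[OF convex_box_at]
    by metis
  hence conn: "connected ?S" by (rule convex_connected)
  have "open (?l -` W)" by (intro open_vimage W cont)
  hence T: "open (?S \<inter> ?l -` W)" using S by blast
  have "0 \<in> ?S \<inter> ?l -` W" using w W(2) by simp
  hence ne: "?S \<inter> ?l -` W \<noteq> {}" by blast
  have hol: "(\<lambda>t. f (?l t)) holomorphic_on ?S"
    unfolding holomorphic_on_def
  proof
    fix t assume t: "t \<in> ?S"
    then obtain c where "(f has_derivative (\<lambda>v. \<Sum>i\<in>UNIV. v $ i * c i)) (at (z + (?l t - z)))"
      using der by blast
    hence "(f has_derivative (\<lambda>v. \<Sum>i\<in>UNIV. v $ i * c i)) (at (?l t))" by simp
    from has_derivative_line[OF this]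
    show "(\<lambda>t. f (?l t)) field_differentiable (at t within ?S)"
      unfolding field_differentiable_def using has_field_derivative_at_within by blast
  qed
  have one: "(1 :: complex) \<in> ?S" using v by (simp add: algebra_simps)
  have "f (?l 1) = 0"
    by (rule analytic_continuation_open[OF T S ne conn _ hol holomorphic_on_const _ one])
      (use W(3) in auto)
  thus ?thesis by simp
qed

text \<open>The set of points near which \<open>f\<close> vanishes is open, and by the previous lemma it is closed in \<open>D\<close>.\<close>

lemma identity_theorem:
  fixes D :: "(complex ^ ('m::finite)) set"
  assumes D: "open D" "connected D" and f: "\<And>z. z \<in> D \<Longrightarrow> \<exists>A. expands f A z"
    and z0: "z0 \<in> D" "expands f 0 z0" and z: "z \<in> D"
  shows "f z = 0"
proof -
  define Z where "Z = {z \<in> D. \<exists>W. open W \<and> z \<in> W \<and> (\<forall>w\<in>W. f w = 0)}"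
  have "open Z"
  proof (subst open_subopen, intro ballI)
    fix z assume "z \<in> Z"
    then obtain W where "z \<in> D" "open W" "z \<in> W" "\<forall>w\<in>W. f w = 0" unfolding Z_def by blast
    thus "\<exists>T. open T \<and> z \<in> T \<and> T \<subseteq> Z"
      using D(1) by (intro exI[of _ "W \<inter> D"]) (auto simp: Z_def)
  qed
  have cl: "z \<in> Z" if "z \<in> D" "z \<in> closure Z" for z
  proof -
    obtain A where "expands f A z" using f[OF \<open>z \<in> D\<close>] by blast
    then obtain r where r: "0 < r" "\<And>h. h \<in> box_at r \<Longrightarrow>
        (f has_derivative (\<lambda>v. \<Sum>i\<in>UNIV. v $ i * evalm (pd i A) h)) (at (z + h))"
      using expands_has_derivative by blast
    let ?B = "{w. w - z \<in> box_at r}"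
    have B: "open ?B" "z \<in> ?B" using r(1) by (auto simp: open_box_around)
    hence "?B \<inter> Z \<noteq> {}"
      using \<open>z \<in> closure Z\<close> open_Int_closure_eq_empty[OF B(1), of Z] by blast
    then obtain w where w: "w - z \<in> box_at r" "w \<in> Z" by blast
    then obtain W where W: "open W" "w \<in> W" "\<And>x. x \<in> W \<Longrightarrow> f x = 0" unfolding Z_def by blast
    have "f v = 0" if "v \<in> ?B" for v
    proof (rule zero_near_imp_zero_on_box[OF _ w(1) W])
      show "\<exists>c. (f has_derivative (\<lambda>v. \<Sum>i\<in>UNIV. v $ i * c i)) (at (z + h))"
        if "h \<in> box_at r" for h
        by (rule exI[of _ "\<lambda>i. evalm (pd i A) h"]) (rule r(2)[OF that])
    qed (use that in auto)
    thus ?thesis using B \<open>z \<in> D\<close> unfolding Z_def by blast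
  qed
  have "z0 \<in> Z"
  proof -
    obtain r where r: "0 < r" "\<And>h. h \<in> box_at r \<Longrightarrow> f (z0 + h) = evalm 0 h"
      using expandsE[OF z0(2) zero_less_one] by blast
    have "f w = 0" if "w - z0 \<in> box_at r" for w
      using r(2)[OF that] by (simp add: evalm_def hpart_def coef_simps)
    thus ?thesis
      using r(1) z0(1) open_box_around[of z0 r] unfolding Z_def
      by (intro CollectI conjI exI[of _ "{w. w - z0 \<in> box_at r}"]) auto
  qed
  moreover have "Z \<inter> D = {} \<or> (D - closure Z) \<inter> D = {}"
  proof (rule connectedD[OF D(2) \<open>open Z\<close>])
    show "open (D - closure Z)" using D(1) by (intro open_Diff) auto
    show "Z \<inter> (D - closure Z) \<inter> D = {}" using closure_subset by blast
    show "D \<subseteq> Z \<union> (D - closure Z)" using cl by blast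
  qed
  ultimately have "z \<in> Z" using z0(1) z cl by blast
  thus ?thesis unfolding Z_def by blast
qed

section \<open>Functions of \<open>(x, y)\<close>\<close>

text \<open>Functions of \<open>(x, y)\<close> are transported to the space of vectors indexed by \<open>'m option\<close>, on which the
  results on functions of several variables apply.\<close>

definition join :: "complex ^ 'm \<Rightarrow> complex \<Rightarrow> complex ^ ('m option)" where
  "join x y = (\<chi> v. case v of None \<Rightarrow> y | Some i \<Rightarrow> x $ i)"

definition xpart :: "complex ^ ('m option) \<Rightarrow> complex ^ 'm" where
  "xpart z = (\<chi> i. z $ Some i)"

definition opt :: "((complex ^ 'm) \<times> complex \<Rightarrow> complex) \<Rightarrow> complex ^ ('m option) \<Rightarrow> complex" where
  "opt f z = f (xpart z, z $ None)"

lemma join_simps [simp]: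
  "join x y $ None = y" "join x y $ Some i = x $ i" "xpart (join x y) = x"
  by (simp_all add: join_def xpart_def vec_eq_iff)

lemma join_xpart: "join (xpart z) (z $ None) = z"
  by (simp add: vec_eq_iff join_def xpart_def split: option.split)

lemma join_add: "join x y + join x' y' = join (x + x') (y + y')"
  by (simp add: vec_eq_iff join_def split: option.split)

lemma opt_join [simp]: "opt f (join x y) = f (x, y)"
  by (simp add: opt_def)

lemma join_0: "join 0 0 = 0"
  by (simp add: vec_eq_iff join_def split: option.split)

lemma UNIV_option: "(UNIV :: 'm option set) = insert None (range Some)"
  by (auto simp: notin_range_Some)

lemma monomial_join: "monomial (join x y) (pk k l) = monomial x k * y ^ l"
  for x :: "complex ^ ('m::finite)"
  by (simp add: monomial_def UNIV_option prod.reindex mult.commute)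

lemma join_in_box_at: "join x y \<in> box_at r \<longleftrightarrow> x \<in> box_at r \<and> norm y < r"
proof -
  have "(\<forall>v. norm (join x y $ v) < r) \<longleftrightarrow> (\<forall>i. norm (x $ i) < r) \<and> norm y < r"
    by (metis join_simps(1,2) not_None_eq)
  thus ?thesis by (simp add: box_at_def)
qed

lemma has_sum_join_iff:
  fixes x :: "complex ^ ('m::finite)"
  shows "((\<lambda>(k, l). a (pk k l) * monomial x k * y ^ l) has_sum s) UNIV \<longleftrightarrow>
    ((\<lambda>K. a K * monomial (join x y) K) has_sum s) UNIV"
proof -
  have bij: "bij_betw (\<lambda>(k, l). pk k l) UNIV (UNIV :: 'm option mindex set)"
    by (rule bij_betwI[of _ _ _ "\<lambda>K. (\<lambda>v. K (Some v), K None)"]) auto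
  show ?thesis
    using has_sum_reindex_bij_betw[OF bij, of "\<lambda>K. a K * monomial (join x y) K" s]
    by (simp add: case_prod_unfold monomial_join mult.assoc)
qed

text \<open>The Taylor coefficients are defined by a definite description. An expansion on a polydisc is a
  witness for it, and any other witness is an expansion of the same function.\<close>

lemma taylor_eq:
  fixes f :: "(complex ^ ('m::finite)) \<times> complex \<Rightarrow> complex"
  assumes "expands (opt f) A 0"
  shows "taylor f (k, l) = coef A (pk k l)"
proof -
  let ?P = "\<lambda>a. \<exists>r>0. \<forall>x y. norm (x, y) < r \<longrightarrow>
     ((\<lambda>(k, l). a (k, l) * monomial x k * y ^ l) has_sum f (x, y)) UNIV"
  let ?a = "\<lambda>(k, l). coef A (pk k l)"
  obtain r where r: "0 < r" "bdd_at r A" "\<And>h. h \<in> box_at r \<Longrightarrow> opt f (0 + h) = evalm A h"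
    using expandsE[OF assms zero_less_one] by blast
  have "((\<lambda>(k, l). ?a (k, l) * monomial x k * y ^ l) has_sum f (x, y)) UNIV"
    if "norm (x, y) < r" for x y
  proof -
    have "norm (x $ i) < r" for i
      using that norm_fst_le[of x y] Finite_Cartesian_Product.norm_nth_le[of x i] by simp
    moreover have "norm y < r" using that norm_snd_le[of y x] by simp
    ultimately have b: "join x y \<in> box_at r"
      by (subst join_in_box_at) (simp add: box_at_def)
    have "((\<lambda>K. coef A K * monomial (join x y) K) has_sum f (x, y)) UNIV"
      using evalm_has_sum[OF r(2) box_at_bound[OF b]] r(3)[OF b] by simp
    thus ?thesis using has_sum_join_iff[of "coef A" x y "f (x, y)"] by simp
  qed
  hence ex: "?P ?a" using r(1) by blast
  have "b = ?a" if b: "?P b" for b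
  proof -
    obtain s where s: "0 < s" "\<And>x y. norm (x, y) < s \<Longrightarrow>
        ((\<lambda>(k, l). b (k, l) * monomial x k * y ^ l) has_sum f (x, y)) UNIV"
      using b by blast
    define B where "B = Mser (\<lambda>K. b (\<lambda>v. K (Some v), K None))"
    have B: "coef B (pk k l) = b (k, l)" for k l by (simp add: B_def)
    \<comment> \<open>With this radius the sum of the absolute values of the \<open>CARD('m) + 1\<close> coordinates stays
      below \<open>s\<close>, and so does the norm.\<close>
    let ?t = "s / (2 * (CARD('m) + 1))"
    have t: "0 < ?t" using s by simp
    have hs: "((\<lambda>K. coef B K * monomial h K) has_sum opt f h) UNIV" if h: "\<And>v. norm (h $ v) \<le> ?t"
      for h :: "complex ^ ('m option)"
    proof -
      have "norm (xpart h) \<le> (\<Sum>i\<in>UNIV. norm (xpart h $ i))"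
        unfolding norm_vec_def by (rule L2_set_le_sum) auto
      also have "\<dots> \<le> (\<Sum>i\<in>(UNIV :: 'm set). ?t)"
        using h by (intro sum_mono) (simp add: xpart_def)
      finally have "norm (xpart h) + norm (h $ None) \<le> CARD('m) * ?t + ?t"
        using h[of None] by simp
      also have "\<dots> = (CARD('m) + 1) * ?t"
        by (simp add: algebra_simps add_divide_distrib)
      also have "\<dots> = s / 2" by (simp add: field_simps)
      finally have "norm (xpart h, h $ None) < s"
        using s(1) norm_Pair_le[of "xpart h" "h $ None"] by linarith
      from s(2)[OF this] show ?thesis
        using has_sum_join_iff[of "coef B" "xpart h" "h $ None"] by (simp add: B join_xpart opt_def)
    qed
    have bB: "bdd_at ?t B"
    proof (rule summable_imp_bdd_at)
      show "(\<lambda>k. coef B k * monomial (\<chi> i. of_real ?t) k) summable_on UNIV"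
        unfolding summable_on_def
      proof (rule exI, rule hs)
        show "norm ((\<chi> i. complex_of_real ?t) $ v) \<le> ?t" for v :: "'m option"
          using t by (simp del: of_real_divide)
      qed
    qed (use t in auto)
    have "expands (opt f) B 0"
      unfolding expands_def
    proof (intro exI conjI ballI)
      fix h :: "complex ^ ('m option)" assume "h \<in> box_at ?t"
      hence h: "norm (h $ v) \<le> ?t" for v by (rule box_at_bound)
      show "opt f (0 + h) = evalm B h"
        using has_sum_unique[OF hs[OF h] evalm_has_sum[OF bB h]] by simp
    qed (use t bB in auto)
    hence "A = B" using expands_unique[OF assms] by simp
    thus ?thesis using B by auto
  qed
  hence "taylor f = ?a" unfolding taylor_def using ex by (intro the_equality)
  thus ?thesis by simp
qed

section \<open>Holomorphic functions of several variables have power series expansions\<close>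

text \<open>Finite partial sums are bounded by a sum over a box of exponents, which is a product of
  one-dimensional geometric sums.\<close>

lemma summable_on_geometric_multi:
  fixes q :: "'m::finite \<Rightarrow> real"
  assumes "\<And>i. 0 \<le> q i" "\<And>i. q i < 1"
  shows "(\<lambda>k. \<Prod>i\<in>UNIV. q i ^ k i) summable_on UNIV"
proof (rule nonneg_bounded_partial_sums_imp_summable_on)
  let ?C = "\<Prod>i\<in>UNIV. 1 / (1 - q i)"
  show "\<forall>\<^sub>F K in finite_subsets_at_top UNIV. (\<Sum>k\<in>K. \<Prod>i\<in>UNIV. q i ^ k i) \<le> ?C"
  proof (intro eventually_finite_subsets_at_top_weakI)
    fix K :: "'m mindex set" assume K: "finite K"
    let ?N = "Max (insert 0 (mdeg ` K))"
    have "k i \<le> ?N" if "k \<in> K" for k i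
    proof -
      have "k i \<le> mdeg k" by (auto simp: mdeg_def intro: member_le_sum)
      also have "\<dots> \<le> ?N" using K that by (intro Max_ge) auto
      finally show ?thesis .
    qed
    hence "K \<subseteq> PiE UNIV (\<lambda>_. {..?N})" by auto
    hence "(\<Sum>k\<in>K. \<Prod>i\<in>UNIV. q i ^ k i) \<le> (\<Sum>k\<in>PiE UNIV (\<lambda>_. {..?N}). \<Prod>i\<in>UNIV. q i ^ k i)"
      using assms by (intro sum_mono2 prod_nonneg finite_PiE) auto
    also have "\<dots> = (\<Prod>i\<in>UNIV. \<Sum>n\<le>?N. q i ^ n)"
      by (subst prod_sum_PiE) auto
    also have "\<dots> \<le> ?C"
    proof (intro prod_mono conjI sum_nonneg)
      fix i
      have "(\<Sum>n\<le>?N. q i ^ n) \<le> (\<Sum>n. q i ^ n)"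
        using assms[of i] by (intro sum_le_suminf summable_geometric) auto
      thus "(\<Sum>n\<le>?N. q i ^ n) \<le> 1 / (1 - q i)"
        using assms[of i] by (simp add: suminf_geometric)
    qed (use assms in auto)
    finally show "(\<Sum>k\<in>K. \<Prod>i\<in>UNIV. q i ^ k i) \<le> ?C" .
  qed
qed (use assms in \<open>auto intro: prod_nonneg\<close>)

text \<open>Cauchy coefficients in one of the variables. They depend holomorphically on the other
  variables: by induction on \<open>n\<close>, the \<open>n\<close>-th coefficient is the uniform limit, as \<open>w\<close> tends to
  \<open>0\<close>, of the function minus its Taylor polynomial of degree \<open>n - 1\<close> in \<open>w\<close>, divided by \<open>w\<^sup>n\<close>.\<close>

definition slice_coef ::
    "('m \<Rightarrow> complex) \<Rightarrow> 'm \<Rightarrow> (('m \<Rightarrow> complex) \<Rightarrow> complex) \<Rightarrow> nat \<Rightarrow> complex" where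
  "slice_coef x i f n = (deriv ^^ n) (\<lambda>z. f (x(i := z))) 0 / fact n"

text \<open>Separate holomorphy in the variables in \<open>S\<close> with a common bound \<open>M\<close>: a hypothesis that passes to
  the Cauchy coefficients, with \<open>M\<close> replaced by Cauchy's estimate.\<close>

definition sep_holo :: "'m set \<Rightarrow> real \<Rightarrow> real \<Rightarrow> (('m \<Rightarrow> complex) \<Rightarrow> complex) \<Rightarrow> bool" where
  "sep_holo S R M f \<longleftrightarrow> (\<forall>x. (\<forall>j. norm (x j) < R) \<longrightarrow>
     norm (f x) \<le> M \<and> (\<forall>i\<in>S. (\<lambda>z. f (x(i := z))) holomorphic_on ball 0 R))"

lemma slice_coef_props:
  assumes f: "sep_holo S R M f" and i: "i \<in> S" and x: "\<And>j. norm (x j) < R"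
    and r: "0 < r" "r < R"
  shows "norm (slice_coef x i f n) \<le> M / r ^ n"
    and "norm w < R \<Longrightarrow> (\<lambda>n. slice_coef x i f n * w ^ n) sums f (x(i := w))"
proof -
  let ?g = "\<lambda>z. f (x(i := z))"
  have hol: "?g holomorphic_on ball 0 R"
    using f i x unfolding sep_holo_def by blast
  have "norm ((deriv ^^ n) ?g 0) \<le> fact n * M / r ^ n"
  proof (rule Cauchy_inequality)
    show "?g holomorphic_on ball 0 r" using hol r by (auto intro: holomorphic_on_subset)
    show "continuous_on (cball 0 r) ?g"
      using holomorphic_on_imp_continuous_on[OF hol] r by (auto intro: continuous_on_subset)
    fix z :: complex assume "norm (0 - z) = r"
    hence "\<forall>j. norm ((x(i := z)) j) < R" using r x by auto
    thus "norm (?g z) \<le> M" using f unfolding sep_holo_def by blast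
  qed (use r in auto)
  from divide_right_mono[OF this, of "fact n"]
  show "norm (slice_coef x i f n) \<le> M / r ^ n"
    by (simp add: slice_coef_def norm_divide)
  assume "norm w < R"
  thus "(\<lambda>n. slice_coef x i f n * w ^ n) sums f (x(i := w))"
    using holomorphic_power_series[OF hol, of w] by (simp add: slice_coef_def)
qed

lemma slice_coef_upd [simp]: "slice_coef (x(i := z)) i f n = slice_coef x i f n"
  by (simp add: slice_coef_def)

text \<open>The point \<open>t r\<close> lies in the disc on which Cauchy's estimates hold with radius \<open>r\<close>, so the tail of
  the series is dominated by a geometric series with ratio \<open>t\<close>.\<close>

lemma slice_remainder:
  assumes f: "sep_holo S R M f" and i: "i \<in> S" and x: "\<And>j. norm (x j) < R"
    and r: "0 < r" "r < R" and t: "0 < t" "t < 1"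
  shows "norm ((f (x(i := of_real (t * r))) - (\<Sum>q<n. slice_coef x i f q * of_real (t * r) ^ q))
      / of_real (t * r) ^ n - slice_coef x i f n) \<le> M / r ^ n * (t / (1 - t))"
proof -
  let ?w = "of_real (t * r) :: complex" and ?c = "slice_coef x i f"
  have w: "norm ?w = t * r" "?w \<noteq> 0" "norm ?w < R"
  proof -
    have "t * r < r" using r t by simp
    hence "t * r < R" using r(2) by (rule less_trans)
    moreover show n: "norm ?w = t * r" unfolding norm_of_real using r t by simp
    ultimately show "norm ?w < R" by simp
    show "?w \<noteq> 0" using r t by simp
  qed
  have "(\<lambda>m. ?c (m + n) * ?w ^ (m + n)) sums (f (x(i := ?w)) - (\<Sum>q<n. ?c q * ?w ^ q))"
    by (rule sums_split_initial_segment[OF slice_coef_props(2)[OF f i x r w(3)]])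
  from sums_divide[OF this, of "?w ^ n"]
  have "(\<lambda>m. ?c (m + n) * ?w ^ m) sums ((f (x(i := ?w)) - (\<Sum>q<n. ?c q * ?w ^ q)) / ?w ^ n)"
    using w(2) by (simp add: power_add)
  from sums_split_initial_segment[OF this, of 1]
  have s: "(\<lambda>m. ?c (Suc m + n) * ?w ^ Suc m) sums
      ((f (x(i := ?w)) - (\<Sum>q<n. ?c q * ?w ^ q)) / ?w ^ n - ?c n)"
    by simp
  have M: "0 \<le> M" using order_trans[OF norm_ge_zero slice_coef_props(1)[OF f i x r, where n = 0]] by simp
  have le: "norm (?c (Suc m + n) * ?w ^ Suc m) \<le> M / r ^ n * t * t ^ m" for m
  proof -
    have "norm (?c (Suc m + n) * ?w ^ Suc m) \<le> M / r ^ (Suc m + n) * (t * r) ^ Suc m"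
      unfolding norm_mult norm_power w(1) using r t
      by (intro mult_right_mono slice_coef_props(1)[OF f i x r]) auto
    also have "\<dots> = M / r ^ n * t * t ^ m"
      using r by (simp add: power_add power_mult_distrib field_simps)
    finally show ?thesis .
  qed
  have g: "(\<lambda>m. M / r ^ n * t * t ^ m) sums (M / r ^ n * t * (1 / (1 - t)))"
    using t by (intro sums_mult geometric_sums) auto
  have "norm ((f (x(i := ?w)) - (\<Sum>q<n. ?c q * ?w ^ q)) / ?w ^ n - ?c n) \<le>
      M / r ^ n * t * (1 / (1 - t))"
    using norm_suminf_le[OF le sums_summable[OF g]] sums_unique[OF s] sums_unique[OF g] by simp
  thus ?thesis by simp
qed

lemma slice_coef_sep_holo:
  assumes f: "sep_holo (insert i S) R M f" and i: "i \<notin> S" and r: "0 < r" "r < R"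
  shows "sep_holo S R (M / r ^ n) (\<lambda>x. slice_coef x i f n)"
  unfolding sep_holo_def
proof (intro allI impI conjI ballI)
  fix x :: "'a \<Rightarrow> complex" assume x: "\<forall>j. norm (x j) < R"
  show "norm (slice_coef x i f n) \<le> M / r ^ n"
    using slice_coef_props(1)[OF f insertI1 _ r] x by blast
  fix j assume j: "j \<in> S"
  hence ij: "i \<noteq> j" using i by blast
  show "(\<lambda>z. slice_coef (x(j := z)) i f n) holomorphic_on ball 0 R"
  proof (induction n rule: less_induct)
    case (less n)
    \<comment> \<open>Any sequence tending to \<open>0\<close> inside the disc of radius \<open>r\<close> would do.\<close>
    define w :: "nat \<Rightarrow> complex" where "w N = of_real (1 / (of_nat N + 2) * r)" for N
    define g where "g N z = (f ((x(j := z))(i := w N))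
        - (\<Sum>q<n. slice_coef (x(j := z)) i f q * w N ^ q)) / w N ^ n" for N z
    show ?case
    proof (rule holomorphic_uniform_sequence[where f = g])
      fix N
      have nw: "norm (w N) = 1 / (real N + 2) * r"
        unfolding w_def norm_of_real using r by (intro abs_of_nonneg) auto
      have "1 / (real N + 2) * r \<le> 1 * r" using r by (intro mult_right_mono) auto
      hence wN: "norm (w N) < R" using r nw by linarith
      have "(\<lambda>z. f ((x(i := w N))(j := z))) holomorphic_on ball 0 R"
        using f j x wN unfolding sep_holo_def by simp
      hence "(\<lambda>z. f ((x(j := z))(i := w N))) holomorphic_on ball 0 R"
        by (simp add: fun_upd_twist[OF ij])
      moreover have "norm (w N) > 0" unfolding nw using r by simp
      hence "w N \<noteq> 0" by simp
      ultimately show "g N holomorphic_on ball 0 R"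
        unfolding g_def by (intro holomorphic_intros less) auto
    next
      fix y :: complex assume y: "y \<in> ball 0 R"
      then obtain d where d: "0 < d" "cball y d \<subseteq> ball 0 R"
        using open_contains_cball[of "ball 0 R"] by blast
      have le: "norm (g N z - slice_coef (x(j := z)) i f n) \<le> M / r ^ n * (1 / (real N + 1))"
        if "z \<in> cball y d" for N z
      proof -
        have "norm z < R" using d that by auto
        hence xz: "norm ((x(j := z)) v) < R" for v using x by simp
        have t: "0 < 1 / (real N + 2)" "1 / (real N + 2) < 1" by auto
        from slice_remainder[OF f insertI1 xz r t, where n = n]
        have "norm (g N z - slice_coef (x(j := z)) i f n) \<le>
            M / r ^ n * (1 / (real N + 2) / (1 - 1 / (real N + 2)))"
          by (simp only: g_def w_def)
        also have "1 / (real N + 2) / (1 - 1 / (real N + 2)) = 1 / (real N + 1)"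
          by (simp add: divide_simps)
        finally show ?thesis .
      qed
      have "uniform_limit (cball y d) g (\<lambda>z. slice_coef (x(j := z)) i f n) sequentially"
      proof (rule uniform_limitI)
        fix e :: real assume e: "e > 0"
        have "(\<lambda>N. M / r ^ n * (1 / (real N + 1))) \<longlonglongrightarrow> M / r ^ n * 0"
          by (intro tendsto_mult_left) (simp add: LIMSEQ_Suc[OF lim_1_over_n] add.commute
            flip: of_nat_Suc)
        hence "\<forall>\<^sub>F N in sequentially. M / r ^ n * (1 / (real N + 1)) < e"
          using e by (auto dest: order_tendstoD(2))
        thus "\<forall>\<^sub>F N in sequentially. \<forall>z\<in>cball y d. dist (g N z) (slice_coef (x(j := z)) i f n) < e"
        proof eventually_elim
          case (elim N)
          show ?case
            unfolding dist_norm using le_less_trans[OF le elim] by blast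
        qed
      qed
      thus "\<exists>d>0. cball y d \<subseteq> ball 0 R \<and>
          uniform_limit (cball y d) g (\<lambda>z. slice_coef (x(j := z)) i f n) sequentially"
        using d by blast
    qed simp
  qed
qed

text \<open>Osgood's lemma, by induction on the set of variables in which one expands; the other
  variables keep the values given by \<open>x0\<close>.\<close>

lemma osgood_induct:
  fixes S :: "('m::finite) set"
  assumes r: "0 < r" "r < R" and x0: "\<And>j. norm (x0 j) < R"
  shows "sep_holo S R M f \<Longrightarrow> \<exists>a. (\<forall>k. norm (a k) \<le> M / r ^ mdeg k) \<and>
    (\<forall>x. (\<forall>j\<in>S. norm (x j) < r) \<and> (\<forall>j. j \<notin> S \<longrightarrow> x j = x0 j) \<longrightarrow>
      ((\<lambda>k. a k * (\<Prod>j\<in>S. x j ^ k j)) has_sum f x) {k. \<forall>j. j \<notin> S \<longrightarrow> k j = 0})"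
  using finite[of S]
proof (induction S arbitrary: M f rule: finite_induct)
  case empty
  have eq: "{k :: 'm mindex. \<forall>j. k j = 0} = {\<lambda>_. 0}" by auto
  have M: "norm (f x0) \<le> M" using empty x0 unfolding sep_holo_def by blast
  show ?case
  proof (intro exI[of _ "\<lambda>k. if k = (\<lambda>_. 0) then f x0 else 0"] conjI allI impI)
    show "norm (if k = (\<lambda>_. 0) then f x0 else 0) \<le> M / r ^ mdeg k" for k :: "'m mindex"
      using M r order_trans[OF norm_ge_zero M] by (auto simp: mdeg_def)
    fix x assume "(\<forall>j\<in>{}. norm (x j) < r) \<and> (\<forall>j. j \<notin> {} \<longrightarrow> x j = x0 j)"
    hence "x = x0" by auto
    thus "((\<lambda>k. (if k = (\<lambda>_. 0) then f x0 else 0) * (\<Prod>j\<in>{}. x j ^ k j)) has_sum f x)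
        {k. \<forall>j. j \<notin> {} \<longrightarrow> k j = 0}"
      by (auto simp: eq intro!: has_sum_finiteI)
  qed
next
  case (insert i S)
  note f = insert.prems
  let ?c = "\<lambda>n x. slice_coef x i f n"
  let ?KS = "{k :: 'm mindex. \<forall>j. j \<notin> S \<longrightarrow> k j = 0}"
  let ?KI = "{k :: 'm mindex. \<forall>j. j \<notin> insert i S \<longrightarrow> k j = 0}"
  let ?P = "\<lambda>n a. (\<forall>k. norm (a k) \<le> M / r ^ n / r ^ mdeg k) \<and>
    (\<forall>x. (\<forall>j\<in>S. norm (x j) < r) \<and> (\<forall>j. j \<notin> S \<longrightarrow> x j = x0 j) \<longrightarrow>
      ((\<lambda>k. a k * (\<Prod>j\<in>S. x j ^ k j)) has_sum ?c n x) ?KS)"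
  have "\<exists>a. ?P n a" for n
    by (rule insert.IH[OF slice_coef_sep_holo[OF f insert.hyps(2) r]])
  hence "\<exists>a. \<forall>n. ?P n (a n)" by (intro choice allI)
  then obtain a where P: "\<forall>n. ?P n (a n)" ..
  have a: "norm (a n k) \<le> M / r ^ n / r ^ mdeg k" for n k
    using spec[OF P, of n] by blast
  have a_sum: "((\<lambda>k. a n k * (\<Prod>j\<in>S. x j ^ k j)) has_sum ?c n x) ?KS"
    if "\<forall>j\<in>S. norm (x j) < r" "\<forall>j. j \<notin> S \<longrightarrow> x j = x0 j" for n x
    using spec[OF P, of n] that by blast
  define b where "b k = a (k i) (k(i := 0))" for k
  have mdeg: "mdeg (k(i := 0)) + k i = mdeg k" for k :: "'m mindex"
  proof -
    have "mdeg (\<lambda>v. (k(i := 0)) v + (if v = i then k i else 0)) = mdeg k"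
      by (rule arg_cong[where f = mdeg]) auto
    thus ?thesis unfolding mdeg_add by (simp add: mdeg_def)
  qed
  have b: "norm (b k) \<le> M / r ^ mdeg k" for k
  proof -
    have "M / r ^ mdeg k = M / r ^ k i / r ^ mdeg (k(i := 0))"
      by (subst mdeg[of k, symmetric]) (simp add: power_add mult.commute)
    thus ?thesis using a[of "k i" "k(i := 0)"] by (simp only: b_def)
  qed
  have "((\<lambda>k. b k * (\<Prod>j\<in>insert i S. x j ^ k j)) has_sum f x) ?KI"
    if x: "\<forall>j\<in>insert i S. norm (x j) < r" "\<forall>j. j \<notin> insert i S \<longrightarrow> x j = x0 j" for x
  proof -
    let ?g = "\<lambda>k. b k * (\<Prod>j\<in>insert i S. x j ^ k j)"
    let ?q = "\<lambda>j. if j \<in> insert i S then norm (x j) / r else 0"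
    have M: "0 \<le> M" using order_trans[OF norm_ge_zero b[of "\<lambda>_. 0"]] by (simp add: mdeg_def)
    have xR: "norm (x j) < R" for j using x r x0 by (cases "j \<in> insert i S") force+
    have "(\<lambda>k. M * (\<Prod>j\<in>UNIV. ?q j ^ k j)) summable_on UNIV"
      using x r by (intro summable_on_cmult_right summable_on_geometric_multi) auto
    hence "(\<lambda>k. M * (\<Prod>j\<in>UNIV. ?q j ^ k j)) summable_on ?KI"
      by (rule summable_on_subset) auto
    hence "(\<lambda>k. norm (?g k)) summable_on ?KI"
    proof (rule Infinite_Sum.abs_summable_on_comparison_test')
      fix k assume k: "k \<in> ?KI"
      have "norm (?g k) \<le> M / r ^ mdeg k * (\<Prod>j\<in>insert i S. norm (x j) ^ k j)"
        unfolding norm_mult prod_norm[symmetric] norm_power using M r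
        by (intro mult_right_mono b prod_nonneg) auto
      also have "(\<Prod>j\<in>insert i S. norm (x j) ^ k j) =
          (\<Prod>j\<in>insert i S. r ^ k j * ?q j ^ k j)"
        using r by (intro prod.cong) (auto simp: power_divide)
      also have "\<dots> = (\<Prod>j\<in>UNIV. r ^ k j * ?q j ^ k j)"
        using k by (intro prod.mono_neutral_left) auto
      also have "\<dots> = r ^ mdeg k * (\<Prod>j\<in>UNIV. ?q j ^ k j)"
        by (simp add: prod.distrib mdeg_def power_sum)
      finally show "norm (?g k) \<le> M * (\<Prod>j\<in>UNIV. ?q j ^ k j)"
        using r by simp
    qed
    hence sg: "?g summable_on ?KI" by (rule abs_summable_summable)
    have bij: "bij_betw (\<lambda>(n, k). k(i := n)) (UNIV \<times> ?KS) ?KI"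
      by (rule bij_betwI[of _ _ _ "\<lambda>k. (k i, k(i := 0))"])
        (use insert.hyps(2) in \<open>auto simp: fun_eq_iff\<close>)
    have gk: "?g (k(i := n)) = a n k * (\<Prod>j\<in>S. x j ^ k j) * x i ^ n" if "k \<in> ?KS" for n k
    proof -
      have "k i = 0" using that insert.hyps(2) by blast
      hence "k(i := n, i := 0) = k" by auto
      moreover have "(\<Prod>j\<in>S. x j ^ (k(i := n)) j) = (\<Prod>j\<in>S. x j ^ k j)"
        using insert.hyps(2) by (intro prod.cong) auto
      ultimately show ?thesis
        using insert.hyps by (simp add: b_def mult_ac)
    qed
    let ?G = "\<lambda>(n, k). ?g (k(i := n))"
    have sG: "?G summable_on (UNIV \<times> ?KS)"
      using summable_on_reindex_bij_betw[OF bij, of ?g] sg by (simp add: case_prod_unfold)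
    have "(?G has_sum f x) (UNIV \<times> ?KS)"
    proof (rule has_sum_SigmaI[OF _ _ sG])
      fix n :: nat
      \<comment> \<open>The coefficient does not depend on the \<open>i\<close>-th variable, which may be reset to the value that
        the induction hypothesis requires.\<close>
      let ?x = "x(i := x0 i)"
      have "((\<lambda>k. a n k * (\<Prod>j\<in>S. ?x j ^ k j)) has_sum ?c n ?x) ?KS"
        using x insert.hyps(2) by (intro a_sum) auto
      also have "(\<lambda>k. a n k * (\<Prod>j\<in>S. ?x j ^ k j)) = (\<lambda>k. a n k * (\<Prod>j\<in>S. x j ^ k j))"
        using insert.hyps(2) by (intro ext arg_cong2[where f = "(*)"] refl prod.cong) auto
      finally have "((\<lambda>k. a n k * (\<Prod>j\<in>S. x j ^ k j)) has_sum ?c n x) ?KS"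
        unfolding slice_coef_upd .
      hence "((\<lambda>k. a n k * (\<Prod>j\<in>S. x j ^ k j) * x i ^ n) has_sum ?c n x * x i ^ n) ?KS"
        by (rule has_sum_cmult_left)
      thus "((\<lambda>k. ?G (n, k)) has_sum ?c n x * x i ^ n) ?KS"
        by (subst has_sum_cong[where g = "\<lambda>k. a n k * (\<Prod>j\<in>S. x j ^ k j) * x i ^ n"])
          (use gk in auto)
    next
      have "(\<lambda>n. ?c n x * x i ^ n) sums f (x(i := x i))"
        by (rule slice_coef_props(2)[OF f insertI1 xR r xR])
      moreover have "summable (\<lambda>n. norm (?c n x * x i ^ n))"
      proof (rule summable_comparison_test'[of "\<lambda>n. M * (norm (x i) / r) ^ n" 0])
        show "summable (\<lambda>n. M * (norm (x i) / r) ^ n)"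
          using x r by (intro summable_mult summable_geometric) auto
        fix n
        have "norm (?c n x) * norm (x i) ^ n \<le> M / r ^ n * norm (x i) ^ n"
          by (intro mult_right_mono slice_coef_props(1)[OF f insertI1 xR r]) auto
        thus "norm (norm (?c n x * x i ^ n)) \<le> M * (norm (x i) / r) ^ n"
          by (simp add: norm_mult norm_power power_divide)
      qed
      ultimately show "((\<lambda>n. ?c n x * x i ^ n) has_sum f x) UNIV"
        using norm_summable_imp_has_sum by fastforce
    qed
    thus ?thesis
      using has_sum_reindex_bij_betw[OF bij, of ?g "f x"] by (simp add: case_prod_unfold)
  qed
  thus ?case using b by (intro exI[of _ b]) auto
qed

text \<open>Cauchy's estimates give absolute convergence on a smaller polydisc.\<close>

lemma bdd_at_coef_bound:
  fixes A :: "('m::finite) mser"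
  assumes "\<And>k. norm (coef A k) \<le> M / r ^ mdeg k" "0 < r"
  shows "bdd_at (r / 2) A"
proof (rule summable_imp_bdd_at)
  have "(\<lambda>k. M * (\<Prod>i\<in>(UNIV :: 'm set). (1 / 2) ^ k i)) summable_on UNIV"
    by (intro summable_on_cmult_right summable_on_geometric_multi) auto
  hence "(\<lambda>k. norm (coef A k * monomial (\<chi> i. of_real (r / 2)) k)) summable_on UNIV"
  proof (rule Infinite_Sum.abs_summable_on_comparison_test')
    fix k :: "'m mindex"
    have "norm (coef A k * monomial (\<chi> i. of_real (r / 2)) k) = norm (coef A k) * (r / 2) ^ mdeg k"
      using assms(2) by (simp add: norm_mult monomial_def norm_power mdeg_def power_sum flip: prod_norm)
    also have "\<dots> \<le> M / r ^ mdeg k * (r / 2) ^ mdeg k"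
      using assms by (intro mult_right_mono) auto
    also have "\<dots> = M * (1 / 2) ^ mdeg k"
      using assms(2) by (simp add: power_divide)
    finally show "norm (coef A k * monomial (\<chi> i. of_real (r / 2)) k) \<le>
        M * (\<Prod>i\<in>(UNIV :: 'm set). (1 / 2) ^ k i)"
      by (simp add: mdeg_def power_sum)
  qed
  thus "(\<lambda>k. coef A k * monomial (\<chi> i. of_real (r / 2)) k) summable_on UNIV"
    by (rule abs_summable_summable)
qed (use assms in auto)

lemma osgood_box:
  fixes f :: "complex ^ ('m::finite) \<Rightarrow> complex"
  assumes r: "0 < r" "r < R"
    and bound: "\<And>h. h \<in> box_at R \<Longrightarrow> norm (f h) \<le> M"
    and sep: "\<And>h i. h \<in> box_at R \<Longrightarrow> (\<lambda>t. f (h + axis i t)) field_differentiable (at 0)"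
  obtains A where "\<And>k. norm (coef A k) \<le> M / r ^ mdeg k" "expands f A 0"
proof -
  let ?f = "\<lambda>x. f (\<chi> j. x j)"
  have "sep_holo UNIV R M ?f"
    unfolding sep_holo_def
  proof (intro allI impI conjI ballI)
    fix x :: "'m \<Rightarrow> complex" assume x: "\<forall>j. norm (x j) < R"
    show "norm (?f x) \<le> M" using x by (intro bound) (simp add: box_at_def)
    fix i
    show "(\<lambda>z. ?f (x(i := z))) holomorphic_on ball 0 R"
      unfolding holomorphic_on_def
    proof
      fix z :: complex assume z: "z \<in> ball 0 R"
      let ?h = "\<chi> j. (x(i := z)) j"
      have "?h \<in> box_at R" using x z by (simp add: box_at_def)
      from sep[OF this, of i] obtain D where
        "((\<lambda>t. f (?h + axis i t)) has_field_derivative D) (at (z - z))"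
        unfolding field_differentiable_def diff_self by blast
      hence "((\<lambda>t. f (?h + axis i (t - z))) has_field_derivative D * 1) (at z)"
        by (intro DERIV_chain2[where f = "\<lambda>t. f (?h + axis i t)"]) (auto intro!: derivative_eq_intros)
      moreover have "(\<lambda>t. f (?h + axis i (t - z))) = (\<lambda>t. ?f (x(i := t)))"
      proof
        fix t
        have "?h + axis i (t - z) = (\<chi> j. (x(i := t)) j)"
          by (simp add: vec_eq_iff axis_def)
        thus "f (?h + axis i (t - z)) = ?f (x(i := t))" by simp
      qed
      ultimately show "(\<lambda>t. ?f (x(i := t))) field_differentiable (at z within ball 0 R)"
        unfolding field_differentiable_def by (metis has_field_derivative_at_within)
    qed
  qed
  from osgood_induct[OF r _ this, of "\<lambda>_. 0"] r obtain a where
    a: "\<And>k. norm (a k) \<le> M / r ^ mdeg k"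
    "\<And>x. (\<forall>j. norm (x j) < r) \<Longrightarrow> ((\<lambda>k. a k * (\<Prod>j\<in>UNIV. x j ^ k j)) has_sum ?f x) UNIV"
    by auto
  have bd: "bdd_at (r / 2) (Mser a)" using a(1) r by (intro bdd_at_coef_bound) auto
  have "f (0 + h) = evalm (Mser a) h" if h: "h \<in> box_at (r / 2)" for h
  proof (rule has_sum_unique)
    have "\<forall>j. norm (h $ j) < r"
      using h box_at_mono[of "r / 2" r] r by (auto simp: box_at_def)
    thus "((\<lambda>k. coef (Mser a) k * monomial h k) has_sum f (0 + h)) UNIV"
      using a(2)[of "\<lambda>j. h $ j"] by (simp add: monomial_def)
    show "((\<lambda>k. coef (Mser a) k * monomial h k) has_sum evalm (Mser a) h) UNIV"
      by (rule evalm_has_sum[OF bd box_at_bound[OF h]])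
  qed
  hence "expands f (Mser a) 0" using bd r unfolding expands_def by (intro exI[of _ "r / 2"]) auto
  thus ?thesis using a(1) by (intro that[of "Mser a"]) auto
qed

lemma holo_expands:
  fixes f :: "complex ^ ('m::finite) \<Rightarrow> complex"
  assumes U: "open U" "z \<in> U" and cont: "continuous_on U f"
    and sep: "\<And>w i. w \<in> U \<Longrightarrow> (\<lambda>t. f (w + axis i t)) field_differentiable (at 0)"
  shows "\<exists>A. expands f A z"
proof -
  obtain e where e: "0 < e" "cball z e \<subseteq> U"
    using U open_contains_cball by blast
  have "compact (f ` cball z e)"
    using cont e by (intro compact_continuous_image) (auto intro: continuous_on_subset)
  then obtain M where M: "\<And>w. w \<in> cball z e \<Longrightarrow> norm (f w) \<le> M"
    using compact_imp_bounded bounded_iff by (metis imageI)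
  obtain R where R: "0 < R" "\<And>h. h \<in> box_at R \<Longrightarrow> z + h \<in> ball z e"
    using box_in_open[of "ball z e" z] e(1) by auto
  obtain A where "expands (\<lambda>h. f (z + h)) A 0"
  proof (rule osgood_box[of "R / 2" R "\<lambda>h. f (z + h)" M])
    fix h :: "complex ^ 'm" assume h: "h \<in> box_at R"
    hence b: "z + h \<in> cball z e" using R(2) by force
    thus "norm (f (z + h)) \<le> M" by (rule M)
    show "(\<lambda>t. f (z + (h + axis i t))) field_differentiable (at 0)" for i
      using sep[of "z + h" i] b e by (auto simp: add.assoc)
  qed (use R in auto)
  thus ?thesis unfolding expands_def by auto
qed

section \<open>Substitution and summation commute\<close>

lemma finite_mdeg_le [simp]: "finite {k :: ('m::finite) mindex. mdeg k \<le> n}"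
proof -
  have "{k :: 'm mindex. mdeg k \<le> n} = (\<Union>d\<in>{..n}. {k. mdeg k = d})" by auto
  thus ?thesis by simp
qed

lemma gN_nabs_eq:
  "gN nabs r n A = (\<Sum>k | mdeg k \<le> n. norm (coef A k) * r ^ mdeg k)" for A :: "('m::finite) mser"
proof -
  have "gN nabs r n A = (\<Sum>d\<le>n. \<Sum>k | mdeg k = d. norm (coef A k) * r ^ mdeg k)"
    unfolding gN_def nabs_def sum_distrib_right by (intro sum.cong refl) auto
  also have "\<dots> = (\<Sum>k\<in>(\<Union>d\<in>{..n}. {k. mdeg k = d}). norm (coef A k) * r ^ mdeg k)"
    by (rule sum.UNION_disjoint[symmetric]) auto
  also have "(\<Union>d\<in>{..n}. {k :: 'm mindex. mdeg k = d}) = {k. mdeg k \<le> n}" by auto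
  finally show ?thesis .
qed

lemma mdeg_pk: "mdeg (pk k l) = mdeg k + l" for k :: "('m::finite) mindex"
  by (simp add: mdeg_def UNIV_option sum.reindex)

text \<open>Distinct pairs \<open>(k, l)\<close> give distinct monomials, so the double sums are partial sums of the series
  in all variables.\<close>

lemma bdd_at_imp_xy_bound:
  fixes A :: "('m::finite) option mser"
  assumes "bdd_at r A" "0 < r"
  obtains C where "xy_bound (y_fps A) r r C"
proof -
  obtain C where C: "\<And>n. gN nabs r n A \<le> C" using assms unfolding bdd_at_def by blast
  have "(\<Sum>l\<le>L. gN nabs r n (fps_nth (y_fps A) l) * r ^ l) \<le> C" for n L
  proof -
    have "(\<Sum>l\<le>L. gN nabs r n (fps_nth (y_fps A) l) * r ^ l) =
        (\<Sum>l\<le>L. \<Sum>k | mdeg k \<le> n. norm (coef A (pk k l)) * r ^ mdeg (pk k l))"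
      by (simp add: gN_nabs_eq coef_y_fps sum_distrib_right mdeg_pk power_add mult.assoc)
    also have "\<dots> = (\<Sum>u\<in>{..L} \<times> {k. mdeg k \<le> n}.
        norm (coef A (pk (snd u) (fst u))) * r ^ mdeg (pk (snd u) (fst u)))"
      by (simp add: sum.cartesian_product case_prod_unfold)
    also have "\<dots> = (\<Sum>K\<in>(\<lambda>u. pk (snd u) (fst u)) ` ({..L} \<times> {k. mdeg k \<le> n}).
        norm (coef A K) * r ^ mdeg K)"
    proof (rule sum.reindex[symmetric, unfolded comp_def], rule inj_onI)
      fix u v :: "nat \<times> 'm mindex" assume eq: "pk (snd u) (fst u) = pk (snd v) (fst v)"
      have "fst u = fst v" using fun_cong[OF eq, of None] by simp
      moreover have "snd u i = snd v i" for i using fun_cong[OF eq, of "Some i"] by simp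
      ultimately show "u = v" by (auto simp: prod_eq_iff)
    qed
    also have "\<dots> \<le> (\<Sum>K | mdeg K \<le> n + L. norm (coef A K) * r ^ mdeg K)"
      using assms(2) by (intro sum_mono2) (auto simp: mdeg_pk)
    also have "\<dots> \<le> C" using C by (simp flip: gN_nabs_eq)
    finally show ?thesis .
  qed
  thus ?thesis using assms(2) by (intro that[of C]) (simp add: xy_bound_def)
qed

lemma xy_bound_term:
  assumes "xy_bound F r \<rho> C" shows "gN nabs r n (fps_nth F l) * \<rho> ^ l \<le> C"
proof -
  have r: "0 < r" "0 < \<rho>" using assms by (auto simp: xy_bound_def)
  have "gN nabs r n (fps_nth F l) * \<rho> ^ l \<le> (\<Sum>l\<le>l. gN nabs r n (fps_nth F l) * \<rho> ^ l)"
    using r by (intro member_le_sum[of l "{..l}" "\<lambda>l. gN nabs r n (fps_nth F l) * \<rho> ^ l"])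
      (auto intro!: mult_nonneg_nonneg nabs.N_nonneg)
  also have "\<dots> \<le> C" using assms by (simp add: xy_bound_def)
  finally show ?thesis .
qed

lemma xy_bound_coef_bdd:
  assumes "xy_bound F r \<rho> C" shows "bdd_at r (fps_nth F l)"
proof -
  have "0 < \<rho>" using assms by (simp add: xy_bound_def)
  hence "gN nabs r n (fps_nth F l) \<le> C / \<rho> ^ l" for n
    using xy_bound_term[OF assms, of n l] by (simp add: field_simps)
  thus ?thesis unfolding bdd_at_def by blast
qed

lemma bdd_at_one: "0 \<le> r \<Longrightarrow> bdd_at r 1"
  unfolding bdd_at_def using nabs.N_one by blast

lemma bdd_at_zero: "bdd_at r 0"
  unfolding bdd_at_def by auto

lemma evalm_one: "evalm 1 h = 1"
proof -
  have "(\<lambda>d. hpart h 1 d) sums (\<Sum>d\<in>{0}. hpart h 1 d)"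
    by (rule sums_finite) (auto simp: hpart_def coef_1_mdeg)
  thus ?thesis by (simp add: evalm_def sums_iff hpart_0 coef_simps)
qed

lemma evalm_zero: "evalm 0 h = 0"
  by (simp add: evalm_def hpart_def coef_simps)

lemma bdd_evalm_power:
  assumes "bdd_at r a" "0 \<le> r" "\<And>i. norm (h $ i) \<le> r"
  shows "bdd_at r (a ^ n) \<and> evalm (a ^ n) h = evalm a h ^ n"
  by (induction n) (auto simp: evalm_one assms intro!: bdd_at_one bdd_at_mult
      evalm_mult[OF _ _ assms(2,3), THEN trans])

lemma bdd_evalm_sum:
  assumes "\<And>x. x \<in> S \<Longrightarrow> bdd_at r (g x)" "0 \<le> r" "\<And>i. norm (h $ i) \<le> r" "finite S"
  shows "bdd_at r (sum g S) \<and> evalm (sum g S) h = (\<Sum>x\<in>S. evalm (g x) h)"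
  using assms(4,1)
  by (induction S rule: finite_induct)
    (auto simp: evalm_zero bdd_at_zero assms(2) intro!: bdd_at_add
      evalm_add[OF _ _ assms(2,3), THEN trans])

lemma norm_evalm_le:
  assumes "\<And>n. gN nabs r n a \<le> C" "0 \<le> r" "\<And>i. norm (h $ i) \<le> r"
  shows "norm (evalm a h) \<le> C"
proof -
  have bd: "bdd_at r a" using assms(1) unfolding bdd_at_def by blast
  have "norm (evalm a h) \<le> (\<Sum>d. nabs a d * r ^ d)"
    unfolding evalm_def
    by (rule norm_suminf_le[OF norm_hpart_le_box[OF assms(3)]])
      (use bd assms(2) in \<open>simp add: bdd_at_iff_summable\<close>)
  also have "\<dots> \<le> C"
  proof (rule suminf_le_const)
    show "summable (\<lambda>d. nabs a d * r ^ d)" using bd assms(2) by (simp add: bdd_at_iff_summable)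
    fix n
    have "(\<Sum>d<n. nabs a d * r ^ d) \<le> gN nabs r n a"
      unfolding gN_def using assms(2) by (intro sum_mono2) (auto simp: nabs.nonneg)
    also have "\<dots> \<le> C" by (rule assms(1))
    finally show "(\<Sum>d<n. nabs a d * r ^ d) \<le> C" .
  qed
  finally show ?thesis .
qed

lemma evalm_join_sums:
  fixes A :: "('m::finite) option mser"
  assumes A: "bdd_at r A" and F: "xy_bound (y_fps A) r r C"
    and x: "\<And>i. norm (x $ i) \<le> r" and y: "norm y \<le> r"
  shows "(\<lambda>l. evalm (fps_nth (y_fps A) l) x * y ^ l) sums evalm A (join x y)"
proof -
  have j: "norm (join x y $ v) \<le> r" for v
    using x y by (cases v) auto
  have "((\<lambda>K. coef A K * monomial (join x y) K) has_sum evalm A (join x y)) UNIV"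
    by (rule evalm_has_sum[OF A j])
  hence "((\<lambda>(k, l). coef A (pk k l) * monomial x k * y ^ l) has_sum evalm A (join x y))
      (UNIV \<times> UNIV)"
    by (simp add: has_sum_join_iff)
  hence "((\<lambda>(l, k). coef A (pk k l) * monomial x k * y ^ l) has_sum evalm A (join x y))
      (UNIV \<times> UNIV)"
    by (subst (asm) has_sum_swap) (simp add: case_prod_unfold)
  moreover have "((\<lambda>k. (case (l, k) of (l, k) \<Rightarrow> coef A (pk k l) * monomial x k * y ^ l)) has_sum
      (evalm (fps_nth (y_fps A) l) x * y ^ l)) UNIV" for l
    using has_sum_cmult_left[OF evalm_has_sum[OF xy_bound_coef_bdd[OF F, of l] x], of "y ^ l"]
    by (simp add: coef_y_fps)
  ultimately have "((\<lambda>l. evalm (fps_nth (y_fps A) l) x * y ^ l) has_sum evalm A (join x y)) UNIV"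
    by (rule has_sum_Sigma')
  thus ?thesis by (rule has_sum_imp_sums)
qed

lemma N_sum_bound:
  assumes "xy_bound F s \<rho> C" "gN nabs s n \<phi> \<le> \<rho>"
  shows "(\<Sum>l\<le>L. gN nabs s n (fps_nth F l) * gN nabs s n \<phi> ^ l) \<le> C"
proof -
  have "(\<Sum>l\<le>L. gN nabs s n (fps_nth F l) * gN nabs s n \<phi> ^ l) \<le>
      (\<Sum>l\<le>L. gN nabs s n (fps_nth F l) * \<rho> ^ l)"
    using assms by (intro sum_mono mult_left_mono power_mono nabs.N_nonneg) (auto simp: xy_bound_def)
  also have "\<dots> \<le> C" using assms(1) by (simp add: xy_bound_def)
  finally show ?thesis .
qed

text \<open>On a polydisc on which \<open>\<phi>\<close> stays within the radius of convergence in \<open>y\<close>, the remainder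
  of \<open>subst_y F \<phi>\<close> after \<open>N\<close> powers of \<open>y\<close> is bounded independently of \<open>N\<close> and has order
  larger than \<open>N\<close>. Hence it tends to \<open>0\<close> on the polydisc of half the radius.\<close>

lemma evalm_subst_y:
  fixes A :: "('m::finite) option mser"
  assumes A: "bdd_at r A" and F: "xy_bound (y_fps A) r r C"
    and \<phi>: "ord_ge 1 \<phi>" "\<And>n. gN nabs s n \<phi> \<le> r" and s: "0 < s" "s \<le> r"
    and h: "h \<in> box_at (s / 2)"
  shows "bdd_at s (subst_y (y_fps A) \<phi>)"
    and "evalm (subst_y (y_fps A) \<phi>) h = evalm A (join h (evalm \<phi> h))"
proof -
  let ?F = "y_fps A"
  let ?P = "\<lambda>N. \<Sum>l\<le>N. fps_nth ?F l * \<phi> ^ l"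
  let ?E = "\<lambda>N. subst_y ?F \<phi> - ?P N"
  have Fs: "xy_bound ?F s r C" using xy_bound_mono[OF F s] .
  have NS: "gN nabs s n (subst_y ?F \<phi>) \<le> C" for n
    using nabs.N_subst_y[OF \<phi>(1), of s n ?F] N_sum_bound[OF Fs \<phi>(2), of n n] s by simp
  thus bS: "bdd_at s (subst_y ?F \<phi>)" unfolding bdd_at_def by blast
  have NP: "gN nabs s n (?P N) \<le> C" for n N
  proof -
    have "gN nabs s n (?P N) \<le> (\<Sum>l\<le>N. gN nabs s n (fps_nth ?F l) * gN nabs s n \<phi> ^ l)"
      using s by (intro order_trans[OF nabs.N_sum] sum_mono order_trans[OF nabs.N_mult]
          mult_left_mono nabs.N_power nabs.N_nonneg) auto
    also have "\<dots> \<le> C" by (rule N_sum_bound[OF Fs \<phi>(2)])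
    finally show ?thesis .
  qed
  have h2: "norm (h $ i) \<le> s / 2" for i by (rule box_at_bound[OF h])
  have hs: "norm (h $ i) \<le> s" for i using h2[of i] s by linarith
  have b\<phi>: "bdd_at s \<phi>" using \<phi>(2) unfolding bdd_at_def by blast
  have bP: "bdd_at s (fps_nth ?F l * \<phi> ^ l)" for l
    using bdd_at_mult[OF xy_bound_coef_bdd[OF Fs]] bdd_evalm_power[OF b\<phi> _ hs] s by auto
  have eP: "evalm (?P N) h = (\<Sum>l\<le>N. evalm (fps_nth ?F l) h * evalm \<phi> h ^ l)" for N
  proof -
    have "evalm (?P N) h = (\<Sum>l\<le>N. evalm (fps_nth ?F l * \<phi> ^ l) h)"
      using bdd_evalm_sum[of "{..N}" s "\<lambda>l. fps_nth ?F l * \<phi> ^ l" h] bP hs s by auto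
    moreover have "evalm (fps_nth ?F l * \<phi> ^ l) h = evalm (fps_nth ?F l) h * evalm \<phi> h ^ l" for l
      using evalm_mult[OF xy_bound_coef_bdd[OF Fs], of "\<phi> ^ l" h] bdd_evalm_power[OF b\<phi> _ hs] hs s
      by auto
    ultimately show ?thesis by simp
  qed
  have E: "norm (evalm (?E N) h) \<le> (1 / 2) ^ Suc N * (2 * C)" for N
  proof (rule norm_evalm_le[OF _ _ h2])
    fix n
    have "gN nabs (s / 2) n (?E N) \<le> (s / 2 / s) ^ Suc N * gN nabs s n (?E N)"
      using s by (intro nabs.N_scale subst_y_trunc \<phi>(1)) auto
    also have "\<dots> \<le> (s / 2 / s) ^ Suc N * (2 * C)"
      using s NS[of n] NP[of n N] nabs.N_diff[of s n "subst_y ?F \<phi>" "?P N"]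
      by (intro mult_left_mono) auto
    finally show "gN nabs (s / 2) n (?E N) \<le> (1 / 2) ^ Suc N * (2 * C)" using s by simp
  qed (use s in auto)
  have "evalm (?E N) h = evalm (subst_y ?F \<phi>) h - evalm (?P N) h" for N
    using NP s by (intro evalm_diff[OF bS _ _ hs]) (auto simp: bdd_at_def)
  hence le: "norm (evalm (?P N) h - evalm (subst_y ?F \<phi>) h) \<le> (1 / 2) ^ Suc N * (2 * C)" for N
    using E[of N] by (simp add: norm_minus_commute)
  have "(\<lambda>N. evalm (?P N) h - evalm (subst_y ?F \<phi>) h) \<longlonglongrightarrow> 0"
  proof (rule Lim_null_comparison)
    show "\<forall>\<^sub>F N in sequentially. norm (evalm (?P N) h - evalm (subst_y ?F \<phi>) h) \<le> (1 / 2) ^ Suc N * (2 * C)"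
      using le by auto
    have "(\<lambda>N. (1 / 2 :: real) ^ Suc N * (2 * C)) \<longlonglongrightarrow> 0 * (2 * C)"
      by (intro tendsto_mult_right LIMSEQ_Suc LIMSEQ_realpow_zero) auto
    thus "(\<lambda>N. (1 / 2 :: real) ^ Suc N * (2 * C)) \<longlonglongrightarrow> 0" by simp
  qed
  hence "(\<lambda>N. evalm (?P N) h) \<longlonglongrightarrow> evalm (subst_y ?F \<phi>) h"
    by (rule LIM_zero_cancel)
  moreover have "(\<lambda>N. evalm (?P N) h) \<longlonglongrightarrow> evalm A (join h (evalm \<phi> h))"
  proof -
    have y: "norm (evalm \<phi> h) \<le> r"
      using norm_evalm_le[OF \<phi>(2) _ hs] s by simp
    have "norm (h $ i) \<le> r" for i using hs[of i] s by linarith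
    from evalm_join_sums[OF A F this y] show ?thesis
      unfolding eP sums_def_le .
  qed
  ultimately show "evalm (subst_y ?F \<phi>) h = evalm A (join h (evalm \<phi> h))"
    by (rule LIMSEQ_unique)
qed

text \<open>Formal substitution computes the expansion of a composed function. This connects the formal and
  the analytic versions of a differential equation.\<close>

lemma expands_subst:
  fixes f :: "complex ^ ('m::finite) option \<Rightarrow> complex"
  assumes f: "expands f A (join x0 y0)" and u: "expands (\<lambda>x. u x - y0) \<phi> x0"
    and \<phi>: "ord_ge 1 \<phi>"
  shows "expands (\<lambda>x. f (join x (u x))) (subst_y (y_fps A) \<phi>) x0"
proof -
  obtain r where r: "0 < r" "bdd_at r A" "\<And>h. h \<in> box_at r \<Longrightarrow> f (join x0 y0 + h) = evalm A h"
    using expandsE[OF f zero_less_one] by blast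
  have r2: "bdd_at (r / 2) A" "0 < r / 2" using r(1) bdd_at_mono[OF r(2), of "r / 2"] by auto
  obtain C where C: "xy_bound (y_fps A) (r / 2) (r / 2) C"
    using bdd_at_imp_xy_bound[OF r2] by blast
  obtain t where t: "0 < t" "t \<le> r / 2" "bdd_at t \<phi>" "\<And>h. h \<in> box_at t \<Longrightarrow> u (x0 + h) - y0 = evalm \<phi> h"
    using expandsE[OF u r2(2)] by blast
  have "x_conv \<phi>" using t by (auto simp: x_conv_iff)
  then obtain s where s: "0 < s" "s \<le> t" "\<And>n. gN nabs s n \<phi> \<le> r / 2"
    using small_radius[OF \<phi> _ r2(2) t(1)] by blast
  have sr: "s \<le> r / 2" using s t by linarith
  have "f (join (x0 + h) (u (x0 + h))) = evalm (subst_y (y_fps A) \<phi>) h" if h: "h \<in> box_at (s / 2)" for h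
  proof -
    have ht: "h \<in> box_at t" using h s box_at_mono[of "s / 2" t] by auto
    have hs: "norm (h $ i) \<le> s" for i using box_at_bound[OF h, of i] s by linarith
    have y: "norm (evalm \<phi> h) \<le> r / 2" using norm_evalm_le[OF s(3) _ hs] s by simp
    have "h \<in> box_at r" using h s sr r(1) box_at_mono[of "s / 2" r] by auto
    hence "join h (evalm \<phi> h) \<in> box_at r" using y r(1) by (simp add: join_in_box_at)
    moreover have "join (x0 + h) (u (x0 + h)) = join x0 y0 + join h (evalm \<phi> h)"
      using t(4)[OF ht] by (simp add: join_add algebra_simps)
    ultimately show ?thesis
      using r(3) evalm_subst_y(2)[OF r2(1) C \<phi> s(3,1) sr h] by simp
  qed
  moreover have "bdd_at (s / 2) (subst_y (y_fps A) \<phi>)"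
    using bdd_at_mono[OF evalm_subst_y(1)[OF r2(1) C \<phi> s(3,1) sr, of 0], of "s / 2"] s by simp
  ultimately show ?thesis
    using s unfolding expands_def by (intro exI[of _ "s / 2"]) auto
qed

section \<open>A formal root of a convergent series converges\<close>

definition trunc :: "nat \<Rightarrow> ('m::finite) mser \<Rightarrow> 'm mser" where
  "trunc n a = Mser (\<lambda>k. if mdeg k \<le> n then coef a k else 0)"

definition hom_part :: "nat \<Rightarrow> ('m::finite) mser \<Rightarrow> 'm mser" where
  "hom_part n a = Mser (\<lambda>k. if mdeg k = n then coef a k else 0)"

lemma coef_trunc: "coef (trunc n a) k = (if mdeg k \<le> n then coef a k else 0)"
  and coef_hom_part: "coef (hom_part n a) k = (if mdeg k = n then coef a k else 0)"
  by (simp_all add: trunc_def hom_part_def)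

lemma ord_ge_trunc_diff: "ord_ge (Suc n) (a - trunc n a)"
  by (auto simp: ord_ge_def coef_simps coef_trunc)

lemma ord_ge_trunc: "ord_ge m a \<Longrightarrow> ord_ge m (trunc n a)"
  by (auto simp: ord_ge_def coef_trunc)

lemma ord_ge_hom_part_diff: "ord_ge n a \<Longrightarrow> ord_ge (Suc n) (a - hom_part n a)"
  by (auto simp: ord_ge_def coef_simps coef_hom_part)

lemma hpart_hom_part: "hpart \<xi> (hom_part n a) d = (if d = n then hpart \<xi> a d else 0)"
  by (auto simp: hpart_def coef_hom_part)

lemma hpart_trunc: "hpart \<xi> (trunc n a) d = (if d \<le> n then hpart \<xi> a d else 0)"
  by (auto simp: hpart_def coef_trunc)

lemma hpart_hom_part_mult: "hpart \<xi> (hom_part n a * b) (n + d) = hpart \<xi> a n * hpart \<xi> b d"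
proof -
  have "hpart \<xi> (hom_part n a * b) (n + d) =
      (\<Sum>e\<in>{n}. hpart \<xi> (hom_part n a) e * hpart \<xi> b (n + d - e))"
    unfolding hpart_mult by (rule sum.mono_neutral_right) (auto simp: hpart_hom_part)
  thus ?thesis by (simp add: hpart_hom_part)
qed

lemma bdd_at_trunc: "bdd_at r (trunc n a)" if "0 \<le> r" for a :: "('m::finite) mser"
proof -
  have "(\<lambda>d. nabs (trunc n a) d * r ^ d) sums (\<Sum>d\<le>n. nabs (trunc n a) d * r ^ d)"
    by (rule sums_finite) (auto simp: nabs_def coef_trunc)
  thus ?thesis using that by (simp add: bdd_at_iff_summable sums_iff)
qed

lemma nabs_hom_part_diff: "nabs (a - hom_part n a) d \<le> nabs a d"
  unfolding nabs_def by (intro sum_mono) (auto simp: coef_simps coef_hom_part)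

text \<open>Powers with exponent at least two gain the order \<open>q\<close> when differences are taken.\<close>

lemma ord_ge_power_diff:
  assumes a: "ord_ge q a" and b: "ord_ge q b" and d: "ord_ge p (a - b)"
  shows "ord_ge (p + q) (a ^ (j + 2) - b ^ (j + 2))"
proof (induction j)
  case 0
  have eq: "a ^ (0 + 2) - b ^ (0 + 2) = (a - b) * (a + b)"
    by (simp add: power2_eq_square algebra_simps)
  show ?case unfolding eq by (rule ord_ge_mult[OF d ord_ge_add[OF a b]])
next
  case (Suc j)
  have eq: "a ^ (Suc j + 2) - b ^ (Suc j + 2) = a * (a ^ (j + 2) - b ^ (j + 2)) + (a - b) * b ^ (j + 2)"
    by (simp add: algebra_simps)
  have "ord_ge (p + q) ((a - b) * b ^ (j + 2))"
    using ord_ge_mult[OF d ord_ge_mult_right[OF b, of "b ^ (j + 1)"]] by simp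
  thus ?case unfolding eq by (rule ord_ge_add[OF ord_ge_mult_left[OF Suc.IH]])
qed

text \<open>The choice of the radii in the majorant argument below: first \<open>s\<close> is chosen so that the
  terms of order at least two in \<open>s\<close> are small, then \<open>r\<close>.\<close>

lemma majorant_radii:
  fixes C c \<rho> r0 :: real
  assumes "0 \<le> C" "0 < c" "0 < \<rho>" "0 < r0"
  obtains r s where "0 < r" "r \<le> r0" "r \<le> 1" "0 < s" "s \<le> \<rho>"
    "(r / r0) ^ (2 * N + 1) * C + (r / r0) ^ (N + 1) * (C / \<rho>) * (s * r ^ N)
      + (s * r ^ N / \<rho>) ^ 2 * C \<le> c * r ^ N * (s * r ^ N)"
proof -
  define s where "s = min \<rho> (c * \<rho> ^ 2 / (3 * (C + 1)))"
  define r where "r = min (min r0 1) (min (c * s * r0 ^ (2 * N + 1) / (3 * (C + 1)))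
      (c * \<rho> * r0 ^ (N + 1) / (3 * (C + 1))))"
  have s: "0 < s" "s \<le> \<rho>" "s \<le> c * \<rho> ^ 2 / (3 * (C + 1))"
    using assms by (auto simp: s_def)
  have r: "0 < r" "r \<le> r0" "r \<le> 1" "r \<le> c * s * r0 ^ (2 * N + 1) / (3 * (C + 1))"
    "r \<le> c * \<rho> * r0 ^ (N + 1) / (3 * (C + 1))"
    using assms s by (auto simp: r_def)
  have le: "C * x \<le> y / 3" if "x \<le> y / (3 * (C + 1))" "0 < x" for x y :: real
  proof -
    have "C * x \<le> (C + 1) * x" using that by simp
    also have "\<dots> \<le> (C + 1) * (y / (3 * (C + 1)))" using that assms by (intro mult_left_mono) auto
    also have "\<dots> = y / 3"
    proof -
      have "b * (y / (3 * b)) = y / 3" if "0 < b" for b using that by simp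
      from this[of "C + 1"] show ?thesis using assms by simp
    qed
    finally show ?thesis .
  qed
  have 1: "(r / r0) ^ (2 * N + 1) * C \<le> c * s / 3 * r ^ (2 * N)"
  proof -
    have "(r / r0) ^ (2 * N + 1) * C = C * r / r0 ^ (2 * N + 1) * r ^ (2 * N)"
      by (simp add: power_divide)
    also have "\<dots> \<le> (c * s * r0 ^ (2 * N + 1) / 3) / r0 ^ (2 * N + 1) * r ^ (2 * N)"
      using le[OF r(4,1)] r(1) assms by (intro mult_right_mono divide_right_mono) auto
    finally show ?thesis using assms by simp
  qed
  have 2: "(r / r0) ^ (N + 1) * (C / \<rho>) * (s * r ^ N) \<le> c * s / 3 * r ^ (2 * N)"
  proof -
    have "(r / r0) ^ (N + 1) * (C / \<rho>) * (s * r ^ N) = C * r / (\<rho> * r0 ^ (N + 1)) * (s * r ^ (2 * N))"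
      by (simp add: power_divide mult_2 mult_2_right power_add mult_ac)
    also have "\<dots> \<le> (c * \<rho> * r0 ^ (N + 1) / 3) / (\<rho> * r0 ^ (N + 1)) * (s * r ^ (2 * N))"
      using le[OF r(5,1)] r(1) s assms by (intro mult_right_mono divide_right_mono) auto
    finally show ?thesis using assms by simp
  qed
  have 3: "(s * r ^ N / \<rho>) ^ 2 * C \<le> c * s / 3 * r ^ (2 * N)"
  proof -
    have "(s * r ^ N / \<rho>) ^ 2 * C = C * s / \<rho> ^ 2 * (s * r ^ (2 * N))"
      by (simp add: power_divide power_mult_distrib power2_eq_square mult_2 power_add)
    also have "\<dots> \<le> (c * \<rho> ^ 2 / 3) / \<rho> ^ 2 * (s * r ^ (2 * N))"
      using le[OF s(3,1)] r(1) s assms by (intro mult_right_mono divide_right_mono) auto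
    finally show ?thesis using assms by simp
  qed
  have sum: "c * s / 3 * r ^ (2 * N) + c * s / 3 * r ^ (2 * N) + c * s / 3 * r ^ (2 * N) =
      c * r ^ N * (s * r ^ N)"
  proof -
    have sq: "r ^ (2 * N) = r ^ N * r ^ N" by (simp add: mult_2 power_add)
    have "c * s / 3 * (q * q) = c * q * (s * q) / 3" for q by (simp add: mult_ac)
    hence third: "c * s / 3 * r ^ (2 * N) = c * r ^ N * (s * r ^ N) / 3" unfolding sq .
    have "x / 3 + x / 3 + x / 3 = x" for x :: real by simp
    thus ?thesis unfolding third .
  qed
  show ?thesis
    by (rule that[OF r(1-3) s(1,2)])
      (rule order_trans[OF add_mono[OF add_mono[OF 1 2] 3] eq_refl[OF sum]])
qed

text \<open>Newton's method on a formal solution \<open>Z\<close> of \<open>H (x, Z) = 0\<close>. The linear coefficient \<open>H\<^sub>1\<close>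
  has order \<open>N\<close>, and its leading form is bounded away from \<open>0\<close> at the points \<open>\<xi>\<close> considered.
  Since \<open>Z\<close> has order larger than \<open>N\<close>, the part of degree \<open>N + d\<close> of the equation expresses the
  product of this leading form with the part of degree \<open>d\<close> of \<open>Z\<close> by parts of \<open>Z\<close> of lower
  degree. The weighted sums of the absolute values of the parts of \<open>Z\<close> at \<open>\<xi>\<close> are then bounded
  inductively, with radii that do not depend on \<open>\<xi>\<close>.\<close>

lemma newton_bound:
  fixes H :: "('m::finite) mser fps"
  assumes H: "xy_bound H r0 \<rho> C" and Z: "ord_ge (Suc N) Z" and eq: "subst_y H Z = 0"
    and H1: "ord_ge N (fps_nth H 1)" and c: "0 < c"
  obtains r B where "0 < r" "\<forall>\<xi> n. (\<forall>i. norm (\<xi> $ i) \<le> 1) \<and> c \<le> norm (hpart \<xi> (fps_nth H 1) N) \<longrightarrow>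
    gN (\<lambda>a d. norm (hpart \<xi> a d)) r n Z \<le> B"
proof -
  let ?H = "fps_nth H"
  have pos: "0 < r0" "0 < \<rho>" and HC: "\<And>n L. (\<Sum>l\<le>L. gN nabs r0 n (?H l) * \<rho> ^ l) \<le> C"
    using H by (auto simp: xy_bound_def)
  have C0: "0 \<le> C"
  proof -
    have "0 \<le> gN nabs r0 0 (?H 0)" using pos by (intro nabs.N_nonneg) auto
    thus ?thesis using HC[of 0 0] by simp
  qed
  have Z1: "ord_ge 1 Z" by (rule ord_ge_mono[OF Z]) simp
  have tr: "ord_ge (Suc M) (\<Sum>l\<le>M. ?H l * Z ^ l)" for M
    using ord_ge_uminus[OF subst_y_trunc[OF Z1, of M H]] eq by simp
  have split: "(\<Sum>l\<le>M. ?H l * W l) = ?H 0 * W 0 + (?H 1 * W 1 + (\<Sum>l\<in>{2..M}. ?H l * W l))"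
    if "1 \<le> M" for M W
  proof -
    have "{..M} = {0} \<union> ({1} \<union> {2..M})" using that by auto
    hence "(\<Sum>l\<le>M. ?H l * W l) = (\<Sum>l\<in>{0} \<union> ({1} \<union> {2..M}). ?H l * W l)" by (rule sum.cong) auto
    also have "\<dots> = ?H 0 * W 0 + (?H 1 * W 1 + (\<Sum>l\<in>{2..M}. ?H l * W l))"
      by (subst sum.union_disjoint; simp)+
    finally show ?thesis .
  qed
  have H0: "ord_ge (2 * N + 1) (?H 0)"
  proof -
    have a: "ord_ge (2 * N + 1) (\<Sum>l\<le>2 * N + 1. ?H l * Z ^ l)"
      by (rule ord_ge_mono[OF tr]) simp
    have b: "ord_ge (2 * N + 1) (?H 1 * Z)"
      using ord_ge_mult[OF H1 Z] by (simp add: mult_2)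
    have "ord_ge (2 * N + 1) (Z ^ l)" if "l \<in> {2..2 * N + 1}" for l
    proof (rule ord_ge_mono[OF ord_ge_power[OF Z]])
      have "2 * Suc N \<le> l * Suc N" using that by (intro mult_right_mono) auto
      thus "2 * N + 1 \<le> l * Suc N" by simp
    qed
    hence c: "ord_ge (2 * N + 1) (\<Sum>l\<in>{2..2 * N + 1}. ?H l * Z ^ l)"
      by (intro ord_ge_sum ord_ge_mult_left) auto
    have "?H 0 = (\<Sum>l\<le>2 * N + 1. ?H l * Z ^ l) - (?H 1 * Z + (\<Sum>l\<in>{2..2 * N + 1}. ?H l * Z ^ l))"
      by (subst split) auto
    thus ?thesis using ord_ge_diff[OF a ord_ge_add[OF b c]] by simp
  qed
  obtain r s where r: "0 < r" "r \<le> r0" "r \<le> 1" and s: "0 < s" "s \<le> \<rho>"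
    and rs: "(r / r0) ^ (2 * N + 1) * C + (r / r0) ^ (N + 1) * (C / \<rho>) * (s * r ^ N)
      + (s * r ^ N / \<rho>) ^ 2 * C \<le> c * r ^ N * (s * r ^ N)"
    by (rule majorant_radii[OF C0 c pos(2,1), of N])
  define \<tau> where "\<tau> = s * r ^ N"
  have \<tau>: "0 < \<tau>" "\<tau> \<le> \<rho>"
  proof -
    show "0 < \<tau>" using r s by (simp add: \<tau>_def)
    have "s * r ^ N \<le> s * 1" using r s by (intro mult_left_mono power_le_one) auto
    thus "\<tau> \<le> \<rho>" unfolding \<tau>_def using s by linarith
  qed
  have "gN (\<lambda>a d. norm (hpart \<xi> a d)) r n Z \<le> \<tau>"
    if \<xi>: "\<And>i. norm (\<xi> $ i) \<le> 1" and cle: "c \<le> norm (hpart \<xi> (?H 1) N)" for \<xi> n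
  proof (induction n)
    case 0
    have "hpart \<xi> Z 0 = 0" using Z1 by (auto simp: hpart_def ord_ge_def)
    thus ?case using \<tau> by (simp add: gN_def)
  next
    case (Suc n)
    let ?\<nu> = "\<lambda>a d. norm (hpart \<xi> a d)"
    let ?M = "N + Suc n"
    let ?h = "hom_part N (?H 1)"
    let ?T = "trunc n Z"
    let ?X = "?H 0 + ((?H 1 - ?h) * ?T + (\<Sum>l\<in>{2..?M}. ?H l * ?T ^ l))"
    have r0: "0 \<le> r" using r by simp
    have D: "ord_ge (Suc n) (Z - ?T)" by (rule ord_ge_trunc_diff)
    \<comment> \<open>Up to degree \<open>N + Suc n\<close>, the equation may be written with the truncation \<open>?T\<close> in place of \<open>Z\<close>
      except in the product with the leading form.\<close>
    have hX_ord: "ord_ge (Suc ?M) (?h * Z - (- ?X))"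
    proof -
      have eq: "?h * Z - (- ?X) = (\<Sum>l\<le>?M. ?H l * Z ^ l) -
          ((?H 1 - ?h) * (Z - ?T) + (\<Sum>l\<in>{2..?M}. ?H l * (Z ^ l - ?T ^ l)))"
        by (subst split) (auto simp: algebra_simps sum_subtractf)
      have lin: "ord_ge (Suc ?M) ((?H 1 - ?h) * (Z - ?T))"
        using ord_ge_mult[OF ord_ge_hom_part_diff[OF H1] D] by simp
      have pow: "ord_ge (Suc ?M) (Z ^ l - ?T ^ l)" if "l \<in> {2..?M}" for l
      proof -
        have "l = (l - 2) + 2" using that by auto
        then obtain j where "l = j + 2" by blast
        thus ?thesis using ord_ge_power_diff[OF Z ord_ge_trunc[OF Z] D, of j] by (simp add: add.commute)
      qed
      show ?thesis unfolding eq
        by (rule ord_ge_diff[OF tr ord_ge_add[OF lin ord_ge_sum[OF ord_ge_mult_left[OF pow]]]])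
    qed
    have hX: "gN ?\<nu> r ?M (?h * Z) = gN ?\<nu> r ?M ?X"
      unfolding nhom.N_cong[OF hX_ord] by (rule nhom.N_uminus)
    \<comment> \<open>Multiplication by the leading form multiplies the degree-\<open>d\<close> part at \<open>\<xi>\<close> by a number of absolute
      value at least \<open>c\<close> and moves it to degree \<open>N + d\<close>.\<close>
    have "c * r ^ N * gN ?\<nu> r (Suc n) Z \<le> gN ?\<nu> r ?M (?h * Z)"
    proof -
      have "c * r ^ N * gN ?\<nu> r (Suc n) Z = (\<Sum>d\<le>Suc n. c * ?\<nu> Z d * r ^ (N + d))"
        by (simp add: gN_def sum_distrib_left power_add mult_ac del: sum.atMost_Suc)
      also have "\<dots> \<le> (\<Sum>d\<le>Suc n. ?\<nu> (?h * Z) (N + d) * r ^ (N + d))"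
        unfolding hpart_hom_part_mult norm_mult
        using cle r0 by (intro sum_mono mult_right_mono) auto
      also have "\<dots> = (\<Sum>e\<in>(+) N ` {..Suc n}. ?\<nu> (?h * Z) e * r ^ e)"
        by (subst sum.reindex) auto
      also have "\<dots> \<le> gN ?\<nu> r ?M (?h * Z)"
        unfolding gN_def using r0 by (intro sum_mono2) auto
      finally show ?thesis .
    qed
    also have "\<dots> \<le> gN ?\<nu> r ?M (?H 0) + (gN ?\<nu> r ?M (?H 1 - ?h) * gN ?\<nu> r ?M ?T
        + (\<Sum>l\<in>{2..?M}. gN ?\<nu> r ?M (?H l) * gN ?\<nu> r ?M ?T ^ l))"
      unfolding hX
      by (intro order_trans[OF nhom.N_add] add_mono order_refl order_trans[OF nhom.N_sum] sum_mono
          order_trans[OF nhom.N_mult] mult_left_mono nhom.N_power nhom.N_nonneg r0)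
    also have "\<dots> \<le> (r / r0) ^ (2 * N + 1) * C + ((r / r0) ^ (N + 1) * (C / \<rho>) * \<tau> + (\<tau> / \<rho>) ^ 2 * C)"
    proof -
      have nu: "gN ?\<nu> r ?M a \<le> gN nabs r ?M a" for a
        unfolding gN_def using r0 by (intro sum_mono mult_right_mono norm_hpart_le \<xi>) auto
      have HN: "gN nabs r0 ?M (?H l) * \<rho> ^ l \<le> C" for l by (rule xy_bound_term[OF H])
      have T: "gN ?\<nu> r ?M ?T \<le> \<tau>"
      proof -
        have "gN ?\<nu> r ?M ?T = gN ?\<nu> r n Z"
          unfolding gN_def by (rule sum.mono_neutral_cong_right) (auto simp: hpart_trunc)
        thus ?thesis using Suc.IH by simp
      qed
      have 0: "gN ?\<nu> r ?M (?H 0) \<le> (r / r0) ^ (2 * N + 1) * C"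
      proof -
        have "gN ?\<nu> r ?M (?H 0) \<le> (r / r0) ^ (2 * N + 1) * gN nabs r0 ?M (?H 0)"
          by (rule order_trans[OF nu nabs.N_scale[OF H0 r0 r(2) pos(1)]])
        also have "\<dots> \<le> (r / r0) ^ (2 * N + 1) * C"
          using HN[of 0] r pos by (intro mult_left_mono) auto
        finally show ?thesis .
      qed
      have 1: "gN ?\<nu> r ?M (?H 1 - ?h) \<le> (r / r0) ^ (N + 1) * (C / \<rho>)"
      proof -
        have "gN ?\<nu> r ?M (?H 1 - ?h) \<le> (r / r0) ^ (N + 1) * gN nabs r0 ?M (?H 1 - ?h)"
          by (rule order_trans[OF nu nabs.N_scale[OF ord_ge_hom_part_diff[OF H1] r0 r(2) pos(1),
                  unfolded Suc_eq_plus1]])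
        also have "\<dots> \<le> (r / r0) ^ (N + 1) * (C / \<rho>)"
        proof (rule mult_left_mono)
          have "gN nabs r0 ?M (?H 1 - ?h) \<le> gN nabs r0 ?M (?H 1)"
            unfolding gN_def using pos by (intro sum_mono mult_right_mono nabs_hom_part_diff) auto
          also have "\<dots> \<le> C / \<rho>" using HN[of 1] pos by (simp add: field_simps)
          finally show "gN nabs r0 ?M (?H 1 - ?h) \<le> C / \<rho>" .
        qed (use r pos in auto)
        finally show ?thesis .
      qed
      have 2: "(\<Sum>l\<in>{2..?M}. gN ?\<nu> r ?M (?H l) * gN ?\<nu> r ?M ?T ^ l) \<le> (\<tau> / \<rho>) ^ 2 * C"
      proof -
        have "(\<Sum>l\<in>{2..?M}. gN ?\<nu> r ?M (?H l) * gN ?\<nu> r ?M ?T ^ l) \<le>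
            (\<Sum>l\<in>{2..?M}. (\<tau> / \<rho>) ^ 2 * (gN nabs r0 ?M (?H l) * \<rho> ^ l))"
        proof (rule sum_mono)
          fix l assume l: "l \<in> {2..?M}"
          have "gN ?\<nu> r ?M (?H l) * gN ?\<nu> r ?M ?T ^ l \<le> gN nabs r0 ?M (?H l) * \<tau> ^ l"
            using r r0 order_trans[OF nu nabs_N_mono_r[OF r0 r(2)]]
            by (intro mult_mono power_mono T nhom.N_nonneg zero_le_power nabs.N_nonneg) auto
          also have "\<dots> \<le> gN nabs r0 ?M (?H l) * ((\<tau> / \<rho>) ^ 2 * \<rho> ^ l)"
          proof (rule mult_left_mono)
            have "\<tau> ^ l = (\<tau> / \<rho>) ^ l * \<rho> ^ l" using pos by (simp add: power_divide)
            also have "\<dots> \<le> (\<tau> / \<rho>) ^ 2 * \<rho> ^ l"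
              using l \<tau> pos by (intro mult_right_mono power_decreasing) auto
            finally show "\<tau> ^ l \<le> (\<tau> / \<rho>) ^ 2 * \<rho> ^ l" .
          qed (use pos in \<open>auto intro: nabs.N_nonneg\<close>)
          finally show "gN ?\<nu> r ?M (?H l) * gN ?\<nu> r ?M ?T ^ l \<le>
              (\<tau> / \<rho>) ^ 2 * (gN nabs r0 ?M (?H l) * \<rho> ^ l)"
            by (simp only: mult_ac)
        qed
        also have "\<dots> = (\<tau> / \<rho>) ^ 2 * (\<Sum>l\<in>{2..?M}. gN nabs r0 ?M (?H l) * \<rho> ^ l)"
          by (rule sum_distrib_left[symmetric])
        also have "\<dots> \<le> (\<tau> / \<rho>) ^ 2 * C"
        proof (rule mult_left_mono)
          have "(\<Sum>l\<in>{2..?M}. gN nabs r0 ?M (?H l) * \<rho> ^ l) \<le>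
              (\<Sum>l\<le>?M. gN nabs r0 ?M (?H l) * \<rho> ^ l)"
            using pos by (intro sum_mono2) (auto intro!: mult_nonneg_nonneg nabs.N_nonneg)
          also have "\<dots> \<le> C" by (rule HC)
          finally show "(\<Sum>l\<in>{2..?M}. gN nabs r0 ?M (?H l) * \<rho> ^ l) \<le> C" .
        qed simp
        finally show ?thesis .
      qed
      have "gN ?\<nu> r ?M (?H 1 - ?h) * gN ?\<nu> r ?M ?T \<le> (r / r0) ^ (N + 1) * (C / \<rho>) * \<tau>"
        using r pos C0 \<tau> by (intro mult_mono 1 T nhom.N_nonneg r0) auto
      thus ?thesis using 0 2 by linarith
    qed
    also have "\<dots> \<le> c * r ^ N * \<tau>" using rs by (simp add: \<tau>_def)
    finally show ?case using c r by simp
  qed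
  thus ?thesis using r(1) by (intro that[of r \<tau>]) auto
qed

subsection \<open>From a small open set of points to the coefficients\<close>

lemma higher_pderiv_coeff:
  "fact n * coeff ((pderiv ^^ j) p) n = fact (n + j) * coeff p (n + j)" for p :: "complex poly"
proof (induction j arbitrary: n)
  case (Suc j)
  have "fact n * coeff ((pderiv ^^ Suc j) p) n = fact (Suc n) * coeff ((pderiv ^^ j) p) (Suc n)"
    by (simp add: coeff_pderiv mult_ac)
  also have "\<dots> = fact (n + Suc j) * coeff p (n + Suc j)" using Suc.IH[of "Suc n"] by simp
  finally show ?case .
qed simp

lemma poly_coeff_bound:
  fixes p :: "complex poly"
  assumes "0 < \<rho>" "\<And>s. norm s \<le> \<rho> \<Longrightarrow> norm (poly p s) \<le> M"
  shows "norm (coeff p j) \<le> M / \<rho> ^ j"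
proof -
  have "(deriv ^^ j) (poly p) = poly ((pderiv ^^ j) p)"
    by (induction j) (auto intro!: DERIV_imp_deriv poly_DERIV)
  hence "(deriv ^^ j) (poly p) 0 = fact j * coeff p j"
    using higher_pderiv_coeff[of 0 j p] by (simp add: poly_0_coeff_0)
  moreover have "norm ((deriv ^^ j) (poly p) 0) \<le> fact j * M / \<rho> ^ j"
    using assms by (intro Cauchy_inequality) (auto intro!: holomorphic_intros continuous_intros)
  ultimately have "fact j * norm (coeff p j) \<le> fact j * (M / \<rho> ^ j)"
    by (simp add: norm_mult)
  thus ?thesis by (rule mult_left_le_imp_le) simp
qed

text \<open>A form of degree \<open>d\<close> that is bounded near \<open>\<xi>0\<close> is bounded on the whole unit polydisc, at the
  cost of a factor exponential in \<open>d\<close>: on each line through \<open>\<xi>0\<close> it is a polynomial of degree at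
  most \<open>d\<close>.\<close>

lemma form_bound:
  fixes a :: "('m::finite) mser"
  assumes \<xi>0: "\<And>i. norm (\<xi>0 $ i) \<le> 1" and \<rho>: "0 < \<rho>" "\<rho> \<le> 1"
    and M: "\<And>h. (\<And>i. norm (h $ i) \<le> 2 * \<rho>) \<Longrightarrow> norm (hpart (\<xi>0 + h) a d) \<le> M"
    and \<eta>: "\<And>i. norm (\<eta> $ i) \<le> 1"
  shows "norm (hpart \<eta> a d) \<le> M * (2 / \<rho>) ^ d"
proof -
  define p where "p = (\<Sum>k | mdeg k = d. Polynomial.smult (coef a k)
      (\<Prod>i\<in>UNIV. [: \<xi>0 $ i, \<eta> $ i - \<xi>0 $ i :] ^ k i))"
  have p: "poly p s = hpart (\<xi>0 + s *s (\<eta> - \<xi>0)) a d" for s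
    by (simp add: p_def hpart_def poly_sum poly_prod monomial_def right_diff_distrib)
  have deg: "degree p \<le> d"
    unfolding p_def
  proof (intro degree_sum_le finite_mdeg)
    fix k :: "'m mindex" assume k: "k \<in> {k. mdeg k = d}"
    have "degree (\<Prod>i\<in>UNIV. [: \<xi>0 $ i, \<eta> $ i - \<xi>0 $ i :] ^ k i) \<le>
        (\<Sum>i\<in>UNIV. degree ([: \<xi>0 $ i, \<eta> $ i - \<xi>0 $ i :] ^ k i))"
      by (rule degree_prod_sum_le[unfolded comp_def]) simp
    also have "\<dots> \<le> (\<Sum>i\<in>UNIV. k i)"
    proof (rule sum_mono)
      fix i
      have "degree ([: \<xi>0 $ i, \<eta> $ i - \<xi>0 $ i :] ^ k i) \<le> degree [: \<xi>0 $ i, \<eta> $ i - \<xi>0 $ i :] * k i"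
        by (rule degree_power_le)
      also have "\<dots> \<le> 1 * k i" by (intro mult_right_mono) auto
      finally show "degree ([: \<xi>0 $ i, \<eta> $ i - \<xi>0 $ i :] ^ k i) \<le> k i" by simp
    qed
    also have "\<dots> = d" using k by (simp add: mdeg_def)
    finally show "degree (Polynomial.smult (coef a k)
        (\<Prod>i\<in>UNIV. [: \<xi>0 $ i, \<eta> $ i - \<xi>0 $ i :] ^ k i)) \<le> d"
      using degree_smult_le order_trans by blast
  qed
  have ps: "norm (poly p s) \<le> M" if "norm s \<le> \<rho>" for s
    unfolding p
  proof (rule M)
    fix i
    have "norm (\<eta> $ i - \<xi>0 $ i) \<le> 2" using norm_triangle_ineq4[of "\<eta> $ i" "\<xi>0 $ i"] \<eta>[of i] \<xi>0[of i] by linarith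
    hence "norm s * norm (\<eta> $ i - \<xi>0 $ i) \<le> \<rho> * 2" using that \<rho> by (intro mult_mono) auto
    moreover have "(s *s (\<eta> - \<xi>0)) $ i = s * (\<eta> $ i - \<xi>0 $ i)" by (simp add: right_diff_distrib)
    ultimately show "norm ((s *s (\<eta> - \<xi>0)) $ i) \<le> 2 * \<rho>" by (simp only: norm_mult mult.commute)
  qed
  have M0: "0 \<le> M" using order_trans[OF norm_ge_zero ps[of 0]] \<rho> by simp
  have "hpart \<eta> a d = poly p 1" by (simp add: p)
  also have "\<dots> = (\<Sum>j\<le>degree p. coeff p j)" by (simp add: poly_altdef)
  also have "norm \<dots> \<le> (\<Sum>j\<le>degree p. M / \<rho> ^ d)"
  proof (rule sum_norm_le)
    fix j assume "j \<in> {..degree p}"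
    hence "\<rho> ^ d \<le> \<rho> ^ j" using deg \<rho> by (intro power_decreasing) auto
    hence "M / \<rho> ^ j \<le> M / \<rho> ^ d" using M0 \<rho> by (intro divide_left_mono) auto
    thus "norm (coeff p j) \<le> M / \<rho> ^ d"
      using poly_coeff_bound[OF \<rho>(1) ps, of j] by linarith
  qed
  also have "\<dots> \<le> 2 ^ d * (M / \<rho> ^ d)"
  proof -
    have "real (d + 1) \<le> 2 ^ d" by (induction d) auto
    hence "real (degree p + 1) \<le> 2 ^ d" using deg by linarith
    hence "real (degree p + 1) * (M / \<rho> ^ d) \<le> 2 ^ d * (M / \<rho> ^ d)"
      using M0 \<rho> by (intro mult_right_mono) auto
    thus ?thesis by simp
  qed
  finally show ?thesis by (simp add: power_divide mult.commute)
qed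

text \<open>Cauchy's estimate for a form on the unit polydisc, read off from the expansion given by Osgood's
  lemma.\<close>

lemma form_coef_bound:
  fixes a :: "('m::finite) mser"
  assumes "\<And>\<eta>. (\<And>i. norm (\<eta> $ i) \<le> 1) \<Longrightarrow> norm (hpart \<eta> a d) \<le> M" and k: "mdeg k = d"
  shows "norm (coef a k) \<le> M * 2 ^ d"
proof -
  let ?a = "hom_part d a"
  have ex: "expands (\<lambda>z. hpart z a d) ?a 0"
  proof -
    have "expands (\<lambda>z. \<Sum>e\<le>d. hpart z ?a e) ?a 0"
      by (rule expands_finite) (simp add: coef_hom_part)
    thus ?thesis by (simp add: hpart_hom_part)
  qed
  obtain A where A: "\<And>k. norm (coef A k) \<le> M / (1 / 2) ^ mdeg k" "expands (\<lambda>z. hpart z a d) A 0"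
  proof (rule osgood_box[of "1 / 2" 1 "\<lambda>z. hpart z a d" M])
    fix h :: "complex ^ 'm" assume "h \<in> box_at 1"
    thus "norm (hpart h a d) \<le> M" by (intro assms(1) box_at_bound)
    fix i
    show "(\<lambda>t. hpart (h + axis i t) a d) field_differentiable (at 0)"
    proof (cases d)
      case 0
      thus ?thesis by (simp add: hpart_0)
    next
      case (Suc e)
      from partial_deriv_eq(1)[OF hpart_has_derivative[of a e h UNIV]]
      show ?thesis unfolding Suc field_differentiable_def by blast
    qed
  qed auto
  have "A = ?a" by (rule expands_unique[OF A(2) ex])
  hence "coef A k = coef a k" by (simp add: coef_hom_part k)
  thus ?thesis using A(1)[of k] k by (simp add: power_divide)
qed

text \<open>Convergence at the points of a small polydisc suffices, wherever its centre is, provided the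
  bound is uniform.\<close>

lemma x_conv_of_local_bound:
  fixes Z :: "('m::finite) mser"
  assumes r: "0 < r" and \<xi>0: "\<And>i. norm (\<xi>0 $ i) \<le> 1" and \<rho>: "0 < \<rho>" "\<rho> \<le> 1"
    and B: "\<And>h n. (\<And>i. norm (h $ i) \<le> 2 * \<rho>) \<Longrightarrow> gN (\<lambda>a d. norm (hpart (\<xi>0 + h) a d)) r n Z \<le> B"
  shows "x_conv Z"
proof -
  have "norm (coef Z k) \<le> B / (r * \<rho> / 4) ^ mdeg k" for k
  proof -
    let ?d = "mdeg k"
    have "norm (hpart (\<xi>0 + h) Z ?d) \<le> B / r ^ ?d" if "\<And>i. norm (h $ i) \<le> 2 * \<rho>" for h
    proof -
      have "norm (hpart (\<xi>0 + h) Z ?d) * r ^ ?d \<le> gN (\<lambda>a d. norm (hpart (\<xi>0 + h) a d)) r ?d Z"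
        unfolding gN_def using r
        by (intro member_le_sum[of ?d "{..?d}" "\<lambda>d. norm (hpart (\<xi>0 + h) Z d) * r ^ d"]) auto
      also have "\<dots> \<le> B" by (rule B[OF that])
      finally show ?thesis using r by (simp add: field_simps)
    qed
    from form_coef_bound[OF form_bound[OF \<xi>0 \<rho> this] refl]
    have "norm (coef Z k) \<le> B / r ^ ?d * (2 / \<rho>) ^ ?d * 2 ^ ?d" by simp
    also have "\<dots> = B / (r * \<rho> / 4) ^ ?d"
      by (simp add: power_divide power_mult_distrib flip: power_mult_distrib[of 2 2])
    finally show ?thesis .
  qed
  hence "bdd_at (r * \<rho> / 4 / 2) Z" using r \<rho> by (intro bdd_at_coef_bound[of Z B "r * \<rho> / 4"]) auto
  thus ?thesis using r \<rho> unfolding x_conv_iff by (intro exI[of _ "r * \<rho> / 4 / 2"]) auto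
qed

text \<open>A nonzero form does not vanish identically near the origin, by uniqueness of the coefficients.\<close>

lemma form_nonzero:
  fixes a :: "('m::finite) mser"
  assumes "mdeg k = N" "coef a k \<noteq> 0"
  obtains \<xi> where "\<xi> \<in> box_at 1" "hpart \<xi> a N \<noteq> 0"
proof (rule ccontr)
  assume contra: "\<not> thesis"
  let ?a = "trunc N (hom_part N a)"
  have "evalm ?a h = 0" if "h \<in> box_at 1" for h
  proof -
    have "hpart h ?a d = 0" for d
      using contra that \<open>\<And>\<xi>. \<xi> \<in> box_at 1 \<Longrightarrow> hpart \<xi> a N \<noteq> 0 \<Longrightarrow> thesis\<close>
      by (auto simp: hpart_trunc hpart_hom_part)
    thus ?thesis by (simp add: evalm_def)
  qed
  hence "?a = 0" using bdd_at_trunc[of 1 N] by (intro evalm_eq_0_imp_0[of 1]) auto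
  hence "coef ?a k = 0" by (simp add: coef_simps)
  thus False using assms by (simp add: coef_trunc coef_hom_part)
qed

subsection \<open>Reduction to a simple root\<close>

lemma higher_fps_deriv_0:
  "fps_nth ((fps_deriv ^^ n) F) 0 = of_nat (fact n) * fps_nth F n" for F :: "'a::comm_ring_1 fps"
  by (induction n arbitrary: F)
    (simp_all add: funpow_Suc_right algebra_simps del: funpow.simps of_nat_fact)

text \<open>If all derivatives of \<open>F\<close> in \<open>y\<close> vanished along \<open>\<phi>\<close>, so would \<open>F\<close>: a coefficient \<open>F\<^sub>l\<close> with
  a term of smallest possible degree in \<open>x\<close> is detected by the \<open>l\<close>-th derivative, as the other
  contributions to that degree carry a factor \<open>\<phi>\<close>.\<close>

lemma exists_nonvanishing_derivative:
  assumes "F \<noteq> 0" "ord_ge 1 \<phi>"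
  shows "\<exists>n. subst_y ((fps_deriv ^^ n) F) \<phi> \<noteq> 0"
proof -
  let ?Q = "\<lambda>d. \<exists>l k. mdeg k = d \<and> coef (fps_nth F l) k \<noteq> 0"
  have "\<exists>d. ?Q d"
  proof (rule ccontr)
    assume "\<nexists>d. ?Q d"
    hence "F = 0" by (intro mser_fps_eqI) (auto simp: coef_simps)
    thus False using assms by simp
  qed
  then obtain d where d: "?Q d" "\<forall>e<d. \<not> ?Q e"
    unfolding exists_least_iff[of ?Q] by blast
  then obtain l k where lk: "mdeg k = d" "coef (fps_nth F l) k \<noteq> 0" by blast
  have F: "\<forall>m. ord_ge d (fps_nth F m)" using d(2) unfolding ord_ge_def by blast
  have ord: "\<forall>m. ord_ge d (fps_nth ((fps_deriv ^^ j) F) m)" for j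
    by (induction j) (auto simp: F intro!: ord_ge_mult_left)
  let ?G = "(fps_deriv ^^ l) F"
  have "coef (subst_y ?G \<phi>) k = (\<Sum>m\<le>d. coef (fps_nth ?G m * \<phi> ^ m) k)"
    by (simp add: subst_y_def lk)
  also have "\<dots> = (\<Sum>m\<in>{0}. coef (fps_nth ?G m * \<phi> ^ m) k)"
  proof (rule sum.mono_neutral_right)
    show "\<forall>m\<in>{..d} - {0}. coef (fps_nth ?G m * \<phi> ^ m) k = 0"
    proof
      fix m assume m: "m \<in> {..d} - {0}"
      have "ord_ge (d + m) (fps_nth ?G m * \<phi> ^ m)"
        using ord ord_ge_power1[OF assms(2)] by (intro ord_ge_mult) auto
      thus "coef (fps_nth ?G m * \<phi> ^ m) k = 0" using lk m by (auto simp: ord_ge_def)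
    qed
  qed auto
  also have "\<dots> = coef (of_nat (fact l) * fps_nth F l) k"
    by (simp add: higher_fps_deriv_0 del: of_nat_fact)
  also have "\<dots> \<noteq> 0" using lk by (simp add: coef_of_nat_mult)
  finally have "subst_y ?G \<phi> \<noteq> 0" by (auto simp: coef_simps)
  thus ?thesis by blast
qed

text \<open>The smallest number \<open>n\<close> of differentiations after which \<open>F\<close> does not vanish along \<open>\<phi>\<close> is
  positive, so \<open>\<phi>\<close> is a simple root of the derivative of order \<open>n - 1\<close>. Expanding that derivative
  at the truncation of \<open>\<phi>\<close> to degree \<open>N\<close> puts it into the form required for Newton's method: the
  linear coefficient agrees with its value along \<open>\<phi>\<close> up to degree \<open>N\<close>.\<close>

theorem formal_root_converges:
  fixes F :: "('m::finite) mser fps"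
  assumes F: "xy_conv F" "F \<noteq> 0" and \<phi>: "ord_ge 1 \<phi>" and root: "subst_y F \<phi> = 0"
  shows "x_conv \<phi>"
proof -
  let ?D = "\<lambda>n. (fps_deriv ^^ n) F"
  define n where "n = (LEAST n. subst_y (?D n) \<phi> \<noteq> 0)"
  have n: "subst_y (?D n) \<phi> \<noteq> 0"
    unfolding n_def using exists_nonvanishing_derivative[OF F(2) \<phi>] by (rule LeastI_ex)
  hence "n \<noteq> 0" using root by (auto intro: ccontr)
  then obtain n' where n': "n = Suc n'" using not0_implies_Suc by blast
  define G where "G = ?D n'"
  have "subst_y (?D n') \<phi> = 0"
    using not_less_Least[of n' "\<lambda>n. subst_y (?D n) \<phi> \<noteq> 0"] n' by (auto simp flip: n_def)
  hence G0: "subst_y G \<phi> = 0" by (simp add: G_def)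
  have "xy_conv (?D j)" for j by (induction j) (auto simp: F xy_conv_deriv)
  hence Gc: "xy_conv G" by (simp add: G_def)
  define \<delta> where "\<delta> = subst_y (fps_deriv G) \<phi>"
  have "\<delta> \<noteq> 0" using n by (simp add: \<delta>_def G_def n')
  hence "\<exists>k. coef \<delta> k \<noteq> 0" by (metis coef_simps(1) mser_eqI)
  hence "\<exists>N. \<exists>k. mdeg k = N \<and> coef \<delta> k \<noteq> 0" by blast
  then obtain N where N: "\<exists>k. mdeg k = N \<and> coef \<delta> k \<noteq> 0"
    "\<forall>e<N. \<not> (\<exists>k. mdeg k = e \<and> coef \<delta> k \<noteq> 0)"
    unfolding exists_least_iff[of "\<lambda>N. \<exists>k. mdeg k = N \<and> coef \<delta> k \<noteq> 0"] by blast
  have \<delta>N: "ord_ge N \<delta>" using N(2) unfolding ord_ge_def by blast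
  define P where "P = trunc N \<phi>"
  define Z where "Z = \<phi> - P"
  define H where "H = shift_y G P"
  have P: "ord_ge 1 P" "x_conv P"
    using ord_ge_trunc[OF \<phi>] bdd_at_trunc[of 1] unfolding P_def x_conv_iff
    by (auto intro!: exI[of _ "1 :: real"])
  have Z: "ord_ge (Suc N) Z" unfolding Z_def P_def by (rule ord_ge_trunc_diff)
  have Z1: "ord_ge 1 Z" by (rule ord_ge_mono[OF Z]) simp
  obtain r0 \<rho> C where H: "xy_bound H r0 \<rho> C"
    using xy_conv_shift[OF Gc P] unfolding H_def xy_conv_def by blast
  have HZ: "subst_y H Z = 0"
    unfolding H_def subst_y_shift[OF P(1) Z1] using G0 by (simp add: Z_def)
  have "ord_ge (Suc N) (fps_nth H 1 - \<delta>)"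
  proof -
    have "fps_nth H 1 = subst_y (fps_deriv G) P"
      unfolding H_def shift_y_def fps_nth_Abs_fps hasse_1 ..
    moreover have "ord_ge (Suc N) (P - \<phi>)"
      using Z unfolding Z_def by (rule ord_ge_sym)
    ultimately show ?thesis
      unfolding \<delta>_def by (simp add: subst_y_cong[OF P(1) \<phi>])
  qed
  hence H\<delta>: "coef (fps_nth H 1) k = coef \<delta> k" if "mdeg k \<le> N" for k
    using that by (auto intro: ord_ge_coef)
  have H1: "ord_ge N (fps_nth H 1)" using \<delta>N H\<delta> by (auto simp: ord_ge_def)
  obtain k where k: "mdeg k = N" "coef (fps_nth H 1) k \<noteq> 0" using N(1) H\<delta> by auto
  obtain \<xi>0 where \<xi>0: "\<xi>0 \<in> box_at 1" "hpart \<xi>0 (fps_nth H 1) N \<noteq> 0"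
    using form_nonzero[OF k] by blast
  define c where "c = norm (hpart \<xi>0 (fps_nth H 1) N) / 2"
  have c: "0 < c" using \<xi>0 by (simp add: c_def)
  have cont: "continuous_on UNIV (\<lambda>\<xi>. hpart \<xi> (fps_nth H 1) N)"
    unfolding hpart_def monomial_def by (intro continuous_intros)
  let ?U = "{\<xi>. c < norm (hpart \<xi> (fps_nth H 1) N)} \<inter> box_at 1"
  have "open ?U"
    by (intro open_Int open_box_at open_Collect_less continuous_intros cont)
  moreover have "\<xi>0 \<in> ?U" using \<xi>0 c by (simp add: c_def)
  ultimately obtain e where e: "0 < e" "\<And>h. h \<in> box_at e \<Longrightarrow> \<xi>0 + h \<in> ?U"
    using box_in_open by blast
  obtain r B where rB: "0 < r" "\<forall>\<xi> n. (\<forall>i. norm (\<xi> $ i) \<le> 1) \<and>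
      c \<le> norm (hpart \<xi> (fps_nth H 1) N) \<longrightarrow> gN (\<lambda>a d. norm (hpart \<xi> a d)) r n Z \<le> B"
    by (rule newton_bound[OF H Z HZ H1 c])
  define \<rho>' where "\<rho>' = min 1 (e / 4)"
  have "x_conv Z"
  proof (rule x_conv_of_local_bound[OF rB(1)])
    show "norm (\<xi>0 $ i) \<le> 1" for i by (rule box_at_bound[OF \<xi>0(1)])
    show "0 < \<rho>'" "\<rho>' \<le> 1" using e by (auto simp: \<rho>'_def)
    fix h :: "complex ^ 'm" and n assume h: "\<And>i. norm (h $ i) \<le> 2 * \<rho>'"
    have "norm (h $ i) < e" for i using h[of i] e by (auto simp: \<rho>'_def)
    hence U: "\<xi>0 + h \<in> ?U" using e(2)[of h] by (simp add: box_at_def)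
    show "gN (\<lambda>a d. norm (hpart (\<xi>0 + h) a d)) r n Z \<le> B"
      using U rB(2) by (auto dest: box_at_bound)
  qed
  then obtain s where s: "0 < s" "bdd_at s Z" unfolding x_conv_iff by blast
  have "bdd_at s (P + Z)" using s bdd_at_trunc[of s N \<phi>] unfolding P_def by (intro bdd_at_add) auto
  thus ?thesis using s(1) unfolding x_conv_iff Z_def by auto
qed

section \<open>The formal Frobenius theorem\<close>

lemma ord_ge_Suc_of_pd:
  assumes "\<And>i. ord_ge n (pd i a)" "coef a (\<lambda>_. 0) = 0" shows "ord_ge (Suc n) a"
  unfolding ord_ge_def
proof (intro allI impI)
  fix k :: "'a mindex" assume k: "mdeg k < Suc n"
  show "coef a k = 0"
  proof (cases "k = (\<lambda>_. 0)")
    case False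
    then obtain i where i: "k i \<noteq> 0" by auto
    have "mdeg (k(i := k i - 1)) < n" using mdeg_minus_1[of k i, OF i] k by simp
    hence "coef (pd i a) (k(i := k i - 1)) = 0" using assms(1) unfolding ord_ge_def by blast
    thus ?thesis using i by (simp add: coef_pd)
  qed (use assms(2) in simp)
qed

text \<open>If two solutions agree below degree \<open>n\<close>, so do the right hand sides, and hence the derivatives.\<close>

lemma frobenius_unique:
  assumes "ord_ge 1 u" "ord_ge 1 v"
    and "\<And>i. pd i u = subst_y (G i) u" "\<And>i. pd i v = subst_y (G i) v"
  shows "u = v"
proof -
  have "ord_ge n (u - v)" for n
  proof (induction n)
    case (Suc n)
    have "ord_ge n (pd i (u - v))" for i
      using subst_y_cong[OF assms(1,2) Suc] by (simp add: pd_diff assms)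
    moreover have "coef (u - v) (\<lambda>_. 0) = 0"
      using ord_ge_diff[OF assms(1,2)] by (auto simp: ord_ge_def mdeg_eq_0)
    ultimately show ?case by (rule ord_ge_Suc_of_pd)
  qed simp
  thus ?thesis using ord_ge_zeroI[of "u - v"] by simp
qed

lemma coef_Xv_pd: "coef (Xv i * pd i a) k = of_nat (k i) * coef a k"
  by (simp add: coef_Xv_mult coef_pd)

lemma coef_euler: "coef (\<Sum>i\<in>UNIV. Xv i * pd i a) k = of_nat (mdeg k) * coef a k"
  by (simp add: coef_sum coef_Xv_pd mdeg_def sum_distrib_right)

lemma ord_ge_Xv: "ord_ge 1 (Xv i)"
  by (auto simp: ord_ge_def Xv_def mdeg_eq_0 fun_eq_iff)

lemma ord_ge_Xv_mult: "ord_ge n a \<Longrightarrow> ord_ge (Suc n) (Xv i * a)"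
  using ord_ge_mult[OF ord_ge_Xv] by fastforce

lemma nabs_Xv_mult: "nabs (Xv i * a) (Suc d) = nabs a d"
  unfolding nabs_def by (subst sum_mdeg_pred[where i = i]) (auto simp: coef_Xv_mult)

lemma gN_Xv_mult: "gN nabs t (Suc n) (Xv i * a) = t * gN nabs t n a"
proof -
  have "nabs (Xv i * a) 0 = 0"
    by (simp add: nabs_def mdeg_zero_set coef_Xv_mult)
  thus ?thesis
    unfolding gN_def
    by (subst sum.atMost_Suc_shift) (simp add: nabs_Xv_mult sum_distrib_left mult.left_commute)
qed

text \<open>The equations \<open>\<partial>u / \<partial>x\<^sub>i = G\<^sub>i (x, u)\<close> imply the single equation obtained by summing their
  multiples by \<open>x\<^sub>i\<close>. On the left the Euler operator multiplies the part of degree \<open>d\<close> by \<open>d\<close>, and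
  on the right that part only depends on parts of \<open>u\<close> of lower degree. So this equation is a
  fixed point equation for the operator below, which gains one degree.\<close>

definition euler_step :: "('m::finite \<Rightarrow> 'm mser fps) \<Rightarrow> 'm mser \<Rightarrow> 'm mser" where
  "euler_step G u =
     Mser (\<lambda>k. coef (\<Sum>i\<in>UNIV. Xv i * subst_y (G i) u) k / of_nat (mdeg k))"

lemma coef_euler_step:
  "of_nat (mdeg k) * coef (euler_step G u) k = coef (\<Sum>i\<in>UNIV. Xv i * subst_y (G i) u) k"
proof (cases "mdeg k = 0")
  case True
  have "ord_ge 1 (\<Sum>i\<in>UNIV. Xv i * subst_y (G i) u)"
    by (intro ord_ge_sum ord_ge_mult_right ord_ge_Xv)
  thus ?thesis using True by (simp add: ord_ge_def)
qed (simp add: euler_step_def)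

lemma ord_ge_euler_step: "ord_ge 1 (euler_step G u)"
  by (auto simp: ord_ge_def euler_step_def)

lemma euler_step_contract:
  assumes "ord_ge 1 u" "ord_ge 1 v" "ord_ge n (u - v)"
  shows "ord_ge (Suc n) (euler_step G u - euler_step G v)"
proof -
  have "(\<Sum>i\<in>UNIV. Xv i * subst_y (G i) u) - (\<Sum>i\<in>UNIV. Xv i * subst_y (G i) v) =
      (\<Sum>i\<in>UNIV. Xv i * (subst_y (G i) u - subst_y (G i) v))"
    by (simp add: right_diff_distrib sum_subtractf)
  moreover have "ord_ge (Suc n) \<dots>"
    by (intro ord_ge_sum ord_ge_Xv_mult subst_y_cong assms)
  ultimately have "ord_ge (Suc n)
      ((\<Sum>i\<in>UNIV. Xv i * subst_y (G i) u) - (\<Sum>i\<in>UNIV. Xv i * subst_y (G i) v))" by simp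
  thus ?thesis
    by (auto simp: ord_ge_def coef_simps euler_step_def simp flip: diff_divide_distrib)
qed

text \<open>The iterates stabilise degree by degree; the coefficient of \<open>x\<^sup>k\<close> is final after \<open>|k|\<close> steps.\<close>

lemma euler_step_fixed_point:
  obtains u where "ord_ge 1 u" "euler_step G u = u"
proof -
  define U where "U n = (euler_step G ^^ n) 0" for n
  have U1: "ord_ge 1 (U n)" for n
  proof (cases n)
    case (Suc m)
    show ?thesis unfolding U_def Suc funpow.simps comp_def by (rule ord_ge_euler_step)
  qed (simp add: U_def)
  have step: "ord_ge (Suc n) (U (Suc n) - U n)" for n
  proof (induction n)
    case 0
    show ?case using ord_ge_diff[OF U1 U1] by simp
  next
    case (Suc n)
    thus ?case using euler_step_contract[OF U1 U1 Suc, of G] by (simp add: U_def)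
  qed
  have chain: "ord_ge (Suc m) (U n - U m)" if "m \<le> n" for m n
    using that
  proof (induction n rule: dec_induct)
    case (step n)
    show ?case
      by (rule ord_ge_trans[OF ord_ge_mono[OF \<open>\<And>n. ord_ge (Suc n) (U (Suc n) - U n)\<close>] step.IH])
        (use step.hyps in simp)
  qed (simp add: ord_ge_def coef_simps)
  define u where "u = Mser (\<lambda>k. coef (U (mdeg k)) k)"
  have u: "ord_ge (Suc n) (u - U n)" for n
  proof -
    have "coef (U (mdeg k)) k = coef (U n) k" if "mdeg k \<le> n" for k
      using ord_ge_coef[OF chain[OF that], of k] by simp
    thus ?thesis by (auto simp: ord_ge_def coef_simps u_def)
  qed
  have u1: "ord_ge 1 u" using ord_ge_add[OF u[of 0, folded One_nat_def] U1[of 0]] by simp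
  have "euler_step G u = u"
  proof (rule mser_eqI_ord)
    fix n
    have "ord_ge (Suc n) (euler_step G u - euler_step G (U n))"
      by (rule ord_ge_mono[OF euler_step_contract[OF u1 U1 u]]) simp
    moreover have "ord_ge (Suc n) (euler_step G (U n) - u)"
      using ord_ge_mono[OF ord_ge_sym[OF u[of "Suc n"]], of "Suc n"] by (simp add: U_def)
    ultimately show "ord_ge (Suc n) (euler_step G u - u)" by (rule ord_ge_trans)
  qed
  thus ?thesis using u1 by (intro that[of u])
qed

lemma common_xy_bound:
  fixes G :: "'i::finite \<Rightarrow> ('m::finite) mser fps"
  assumes "\<And>i. xy_conv (G i)"
  obtains r \<rho> C where "0 \<le> C" "\<And>i. xy_bound (G i) r \<rho> C"
proof -
  have "\<exists>r \<rho> C. xy_bound (G i) r \<rho> C" for i using assms unfolding xy_conv_def .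
  then obtain r \<rho> C where b: "\<And>i. xy_bound (G i) (r i) (\<rho> i) (C i)" by metis
  define r' where "r' = Min (range r)"
  define \<rho>' where "\<rho>' = Min (range \<rho>)"
  define C' where "C' = (\<Sum>i\<in>UNIV. \<bar>C i\<bar>)"
  have r': "0 < r'" "\<And>i. r' \<le> r i" and \<rho>': "0 < \<rho>'" "\<And>i. \<rho>' \<le> \<rho> i"
    using b by (auto simp: r'_def \<rho>'_def xy_bound_def)
  have "xy_bound (G i) r' \<rho>' C'" for i
  proof -
    have "xy_bound (G i) r' (\<rho> i) (C i)" by (rule xy_bound_mono[OF b r'])
    hence le: "(\<Sum>l\<le>L. gN nabs r' n (fps_nth (G i) l) * \<rho> i ^ l) \<le> C i" for n L
      by (simp add: xy_bound_def)
    have "(\<Sum>l\<le>L. gN nabs r' n (fps_nth (G i) l) * \<rho>' ^ l) \<le> C'" for n L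
    proof -
      have "(\<Sum>l\<le>L. gN nabs r' n (fps_nth (G i) l) * \<rho>' ^ l) \<le>
          (\<Sum>l\<le>L. gN nabs r' n (fps_nth (G i) l) * \<rho> i ^ l)"
        using r' \<rho>' by (intro sum_mono mult_left_mono power_mono nabs.N_nonneg) auto
      also have "\<dots> \<le> \<bar>C i\<bar>" using le[of n L] by linarith
      also have "\<dots> \<le> C'" unfolding C'_def by (rule member_le_sum) auto
      finally show ?thesis .
    qed
    thus ?thesis using r' \<rho>' by (simp add: xy_bound_def)
  qed
  moreover have "0 \<le> C'" by (simp add: C'_def sum_nonneg)
  ultimately show ?thesis by (intro that[of C' r' \<rho>'])
qed

text \<open>Division by the degree does not increase coefficients and multiplication by \<open>x\<^sub>i\<close> supplies a factor
  \<open>t\<close>. So if the partial sum for \<open>u\<close> up to degree \<open>n\<close> stays below \<open>\<rho>\<close>, the right hand side is bounded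
  by \<open>C\<close>, and the next partial sum by \<open>t\<close> times \<open>C\<close> times the number of variables.\<close>

lemma euler_step_fixed_point_converges:
  assumes G: "\<And>i. xy_conv (G i)" and u: "ord_ge 1 u" "euler_step G u = u"
  shows "x_conv (u :: ('m::finite) mser)"
proof -
  obtain r \<rho> C where C: "0 \<le> C" and b: "\<And>i. xy_bound (G i) r \<rho> C"
    using common_xy_bound[of G] G by metis
  have pos: "0 < r" "0 < \<rho>" using b by (auto simp: xy_bound_def)
  define t where "t = min r (\<rho> / (CARD('m) * (C + 1)))"
  have t: "0 < t" "t \<le> r" "t \<le> \<rho> / (CARD('m) * (C + 1))"
    using pos C by (auto simp: t_def)
  have bt: "xy_bound (G i) t \<rho> C" for i by (rule xy_bound_mono[OF b t(1,2)])
  let ?R = "\<Sum>i\<in>UNIV. Xv i * subst_y (G i) u"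
  have le: "nabs u d \<le> nabs ?R d" for d
    unfolding nabs_def
  proof (rule sum_mono)
    fix k :: "'m mindex"
    show "norm (coef u k) \<le> norm (coef ?R k)"
    proof (cases "mdeg k = 0")
      case True
      thus ?thesis using u(1) by (simp add: ord_ge_def)
    next
      case False
      have "norm (coef u k) \<le> real (mdeg k) * norm (coef u k)"
        using False mult_right_mono[of 1 "real (mdeg k)" "norm (coef u k)"] by simp
      also have "\<dots> = norm (of_nat (mdeg k) * coef (euler_step G u) k)"
        by (simp add: norm_mult u(2))
      finally show ?thesis by (simp only: coef_euler_step)
    qed
  qed
  have "gN nabs t n u \<le> \<rho>" for n
  proof (induction n)
    case 0
    have "nabs u 0 = 0" using u(1) by (intro nabs.local) (auto simp: ord_ge_def)
    thus ?case using pos by (simp add: gN_def)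
  next
    case (Suc n)
    have "gN nabs t (Suc n) u \<le> gN nabs t (Suc n) ?R"
      unfolding gN_def using t by (intro sum_mono mult_right_mono le) auto
    also have "\<dots> \<le> (\<Sum>i\<in>UNIV. gN nabs t (Suc n) (Xv i * subst_y (G i) u))"
      using t by (intro nabs.N_sum) auto
    also have "\<dots> \<le> (\<Sum>i\<in>(UNIV :: 'm set). t * C)"
      unfolding gN_Xv_mult
    proof (intro sum_mono mult_left_mono)
      fix i
      show "gN nabs t n (subst_y (G i) u) \<le> C"
        using nabs.N_subst_y[OF u(1), of t n "G i"] N_sum_bound[OF bt[of i] Suc, of n] t by simp
    qed (use t in auto)
    also have "\<dots> = t * (CARD('m) * C)" by simp
    also have "\<dots> \<le> t * (CARD('m) * (C + 1))"
      using t by (intro mult_left_mono) auto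
    also have "\<dots> \<le> \<rho>"
    proof -
      have "0 < real CARD('m) * (C + 1)" using C by simp
      thus ?thesis using t(3) by (simp only: pos_le_divide_eq)
    qed
    finally show ?case .
  qed
  thus ?thesis using t(1) unfolding x_conv_def by blast
qed

text \<open>The mixed second derivatives of \<open>u\<close> cancel, and by integrability so do the terms that do not contain
  a defect.\<close>

lemma subst_y_integrable:
  assumes u: "ord_ge 1 u"
    and int: "pdF j (G i) + fps_deriv (G i) * G j = pdF i (G j) + fps_deriv (G j) * G i"
  shows "pd j (pd i u - subst_y (G i) u) - pd i (pd j u - subst_y (G j) u) =
    subst_y (fps_deriv (G j)) u * (pd i u - subst_y (G i) u)
    - subst_y (fps_deriv (G i)) u * (pd j u - subst_y (G j) u)"
proof -
  have "subst_y (pdF j (G i)) u + subst_y (fps_deriv (G i)) u * subst_y (G j) u =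
      subst_y (pdF i (G j)) u + subst_y (fps_deriv (G j)) u * subst_y (G i) u"
    using arg_cong[OF int, of "\<lambda>F. subst_y F u"] by (simp only: subst_y_add subst_y_mult[OF u])
  thus ?thesis
    by (simp add: pd_diff subst_y_chain[OF u] pd_commute[of j i] algebra_simps)
qed

text \<open>Let \<open>w\<^sub>j\<close> be the defects of a solution of the summed equation. Then the sum of the
  \<open>x\<^sub>i w\<^sub>i\<close> vanishes, and by integrability the differences of the mixed derivatives of the \<open>w\<^sub>i\<close> are
  linear combinations of the \<open>w\<^sub>i\<close>. Differentiating the former by \<open>x\<^sub>j\<close> shows that one plus the
  Euler operator maps \<open>w\<^sub>j\<close> to a linear combination of the \<open>x\<^sub>k w\<^sub>i\<close>, which has larger order.\<close>

lemma frobenius_exists: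
  fixes G :: "'m::finite \<Rightarrow> 'm mser fps"
  assumes int: "\<And>i j. pdF j (G i) + fps_deriv (G i) * G j = pdF i (G j) + fps_deriv (G j) * G i"
    and G: "\<And>i. xy_conv (G i)"
  obtains u where "ord_ge 1 u" "x_conv u" "\<And>i. pd i u = subst_y (G i) u"
proof -
  obtain u where u: "ord_ge 1 u" "euler_step G u = u"
    by (rule euler_step_fixed_point[of G])
  define w where "w i = pd i u - subst_y (G i) u" for i
  have "(\<Sum>i\<in>UNIV. Xv i * pd i u) = (\<Sum>i\<in>UNIV. Xv i * subst_y (G i) u)"
    using coef_euler_step[of _ G u] by (intro mser_eqI) (simp add: coef_euler u(2))
  hence w0: "(\<Sum>i\<in>UNIV. Xv i * w i) = 0"
    by (simp add: w_def right_diff_distrib sum_subtractf)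
  define S where "S i = subst_y (fps_deriv (G i)) u" for i
  have wij: "pd j (w i) = pd i (w j) + (S j * w i - S i * w j)" for i j
    using subst_y_integrable[OF u(1) int[of j i]] by (simp add: w_def S_def algebra_simps)
  have wE: "w j + (\<Sum>i\<in>UNIV. Xv i * pd i (w j)) = - (\<Sum>i\<in>UNIV. Xv i * (S j * w i - S i * w j))"
    for j
  proof -
    have "0 = pd j (\<Sum>i\<in>UNIV. Xv i * w i)" by (simp add: w0)
    also have "\<dots> = (\<Sum>i\<in>UNIV. pd j (Xv i) * w i) + (\<Sum>i\<in>UNIV. Xv i * pd j (w i))"
      by (simp add: pd_sum pd_mult sum.distrib)
    also have "(\<Sum>i\<in>UNIV. pd j (Xv i) * w i) = (\<Sum>i\<in>UNIV. if i = j then w i else 0)"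
      by (intro sum.cong) (auto simp: pd_Xv)
    also have "\<dots> = w j" by simp
    also have "(\<Sum>i\<in>UNIV. Xv i * pd j (w i)) =
        (\<Sum>i\<in>UNIV. Xv i * pd i (w j)) + (\<Sum>i\<in>UNIV. Xv i * (S j * w i - S i * w j))"
      by (simp add: wij[of j] distrib_left sum.distrib)
    finally have "w j + (\<Sum>i\<in>UNIV. Xv i * pd i (w j)) +
        (\<Sum>i\<in>UNIV. Xv i * (S j * w i - S i * w j)) = 0"
      by (simp only: add.assoc)
    thus ?thesis by (simp only: eq_neg_iff_add_eq_0)
  qed
  have "\<forall>j. ord_ge n (w j)" for n
  proof (induction n)
    case (Suc n)
    show ?case
    proof
      fix j
      have R: "ord_ge (Suc n) (- (\<Sum>i\<in>UNIV. Xv i * (S j * w i - S i * w j)))"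
        using Suc by (intro ord_ge_uminus ord_ge_sum ord_ge_Xv_mult ord_ge_diff ord_ge_mult_left) auto
      have "coef (w j) k = 0" if "mdeg k < Suc n" for k
      proof -
        have "coef (w j + (\<Sum>i\<in>UNIV. Xv i * pd i (w j))) k = 0"
          unfolding wE using R that by (simp add: ord_ge_def)
        hence "of_nat (Suc (mdeg k)) * coef (w j) k = 0"
          by (simp add: coef_simps coef_euler algebra_simps)
        thus ?thesis by (simp only: mult_eq_0_iff of_nat_eq_0_iff) simp
      qed
      thus "ord_ge (Suc n) (w j)" by (simp add: ord_ge_def)
    qed
  qed simp
  hence "w j = 0" for j by (intro ord_ge_zeroI) auto
  hence "pd i u = subst_y (G i) u" for i by (simp add: w_def)
  thus ?thesis
    using u euler_step_fixed_point_converges[OF G u] by (intro that[of u])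
qed

section \<open>Analytic systems and complete integrability\<close>

lemma expands_eq_near:
  fixes z :: "complex ^ ('m::finite)"
  assumes "expands f A z" "expands g A z" shows "\<forall>\<^sub>F w in nhds z. f w = g w"
proof -
  obtain r where r: "0 < r" "\<forall>h\<in>box_at r. f (z + h) = evalm A h \<and> g (z + h) = evalm A h"
    using expandsE2[OF assms zero_less_one] by blast
  have "f w = g w" if "w \<in> {w. w - z \<in> box_at r}" for w
    using r(2)[THEN bspec, of "w - z"] that by simp
  thus ?thesis
    unfolding eventually_nhds using r(1) open_box_around[of z r]
    by (intro exI[of _ "{w. w - z \<in> box_at r}"]) auto
qed

lemma holo_imp_continuous_on:
  assumes "holo_x_on f U" shows "continuous_on U f"
proof (intro continuous_at_imp_continuous_on ballI)
  fix w assume "w \<in> U"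
  then obtain f' where "(f has_derivative f') (at w)"
    using assms unfolding holo_x_on_def holo_on_def by blast
  thus "isCont f w" by (rule has_derivative_continuous)
qed

lemma holo_imp_expands:
  fixes f :: "complex ^ ('m::finite) \<Rightarrow> complex"
  assumes "open U" "z \<in> U" and f: "holo_x_on f U"
  shows "\<exists>A. expands f A z"
proof (rule holo_expands[OF assms(1,2)])
  have der: "\<exists>f'. (f has_derivative f') (at w) \<and> (\<forall>c v. f' (c *s v) = c * f' v)" if "w \<in> U" for w
    using f that unfolding holo_x_on_def holo_on_def by blast
  show "continuous_on U f" by (rule holo_imp_continuous_on[OF f])
  fix w i assume "w \<in> U"
  then obtain f' where f': "(f has_derivative f') (at w)" "\<And>c v. f' (c *s v) = c * f' v"
    using der by blast
  have "((\<lambda>t. w + t *s axis i 1) has_derivative (\<lambda>t. t *s axis i 1)) (at (0::complex))"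
    by (auto intro!: derivative_eq_intros bounded_linear_imp_has_derivative[OF bounded_linear_smult])
  from has_derivative_compose[OF this, of f f'] f'(1)
  have "((\<lambda>t. f (w + t *s axis i 1)) has_derivative (\<lambda>t. f' (t *s axis i 1))) (at 0)" by simp
  moreover have "(\<lambda>t. f' (t *s axis i 1)) = (*) (f' (axis i 1))"
    by (auto simp: f'(2) mult.commute)
  moreover have "(\<lambda>t. f (w + t *s axis i 1)) = (\<lambda>t. f (w + axis i t))"
    by (rule ext, subst axis_scale[of i]) (rule refl)
  ultimately have "((\<lambda>t. f (w + axis i t)) has_field_derivative f' (axis i 1)) (at 0)"
    by (simp add: has_field_derivative_def)
  thus "(\<lambda>t. f (w + axis i t)) field_differentiable (at 0)"
    unfolding field_differentiable_def by blast
qed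

definition opt_dom :: "((complex ^ 'm) \<times> complex) set \<Rightarrow> (complex ^ ('m option)) set" where
  "opt_dom D = (\<lambda>z. (xpart z, z $ None)) -` D"

lemma bounded_linear_xpart: "bounded_linear (xpart :: complex ^ ('m option) \<Rightarrow> complex ^ ('m::finite))"
proof -
  have "linear (xpart :: complex ^ ('m option) \<Rightarrow> complex ^ 'm)"
    by (rule linearI) (simp_all add: xpart_def vec_eq_iff)
  thus ?thesis by (simp add: linear_conv_bounded_linear)
qed

lemma bounded_linear_split:
  "bounded_linear (\<lambda>z :: complex ^ (('m::finite) option). (xpart z, z $ None))"
  by (intro bounded_linear_Pair bounded_linear_xpart bounded_linear_vec_nth)

lemma open_opt_dom: "open D \<Longrightarrow> open (opt_dom D)" for D :: "((complex ^ ('m::finite)) \<times> complex) set"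
  unfolding opt_dom_def
  by (intro open_vimage linear_continuous_on bounded_linear_split)

lemma join_in_opt_dom [simp]: "join x y \<in> opt_dom D \<longleftrightarrow> (x, y) \<in> D"
  by (simp add: opt_dom_def)

lemma opt_dom_eq_image: "opt_dom D = (\<lambda>(x, y). join x y) ` D"
  by (force simp: opt_dom_def join_xpart image_iff)

lemma bounded_linear_join: "bounded_linear (\<lambda>(x :: complex ^ ('m::finite), y). join x y)"
proof -
  have "linear (\<lambda>(x :: complex ^ 'm, y). join x y)"
    by (rule linearI) (auto simp: vec_eq_iff join_def split: option.split)
  thus ?thesis by (simp add: linear_conv_bounded_linear)
qed

lemma connected_opt_dom:
  fixes D :: "((complex ^ ('m::finite)) \<times> complex) set"
  assumes "connected D" shows "connected (opt_dom D)"
  unfolding opt_dom_eq_image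
  by (rule connected_continuous_image[OF linear_continuous_on[OF bounded_linear_join] assms])

lemma holo_opt:
  fixes f :: "(complex ^ ('m::finite)) \<times> complex \<Rightarrow> complex"
  assumes "holo_xy_on f D" shows "holo_x_on (opt f) (opt_dom D)"
  unfolding holo_x_on_def holo_on_def
proof
  fix z :: "complex ^ ('m option)" assume "z \<in> opt_dom D"
  hence "(xpart z, z $ None) \<in> D" by (simp add: opt_dom_def)
  then obtain f' where f': "(f has_derivative f') (at (xpart z, z $ None))"
    "\<forall>c v. f' ((\<lambda>c (v, w). (c *s v, c * w)) c v) = c * f' v"
    using assms unfolding holo_xy_on_def holo_on_def by blast
  have "(opt f has_derivative (\<lambda>v. f' (xpart v, v $ None))) (at z)"
    unfolding opt_def[abs_def]
    by (rule has_derivative_compose[OF bounded_linear_imp_has_derivative[OF bounded_linear_split] f'(1)])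
  moreover have "f' (xpart (c *s v), (c *s v) $ None) = c * f' (xpart v, v $ None)" for c v
  proof -
    have "xpart (c *s v) = c *s xpart v" by (simp add: xpart_def vec_eq_iff)
    thus ?thesis using f'(2)[rule_format, of c "(xpart v, v $ None)"] by simp
  qed
  ultimately show "\<exists>g. (opt f has_derivative g) (at z) \<and> (\<forall>c v. g (c *s v) = c * g v)"
    by blast
qed

text \<open>The functions whose vanishing expresses integrability, in the variables indexed by
  \<open>'m option\<close>.\<close>

definition obstruction ::
    "('m \<Rightarrow> nat) \<Rightarrow> ('m \<Rightarrow> (complex ^ 'm) \<times> complex \<Rightarrow> complex) \<Rightarrow> 'm \<Rightarrow> 'm \<Rightarrow>
     complex ^ ('m option) \<Rightarrow> complex" where
  "obstruction p f i j z =
     ((z $ Some j) ^ p j * partial_deriv (Some j) (opt (f i)) z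
        + partial_deriv None (opt (f i)) z * opt (f j) z)
     - ((z $ Some i) ^ p i * partial_deriv (Some i) (opt (f j)) z
        + partial_deriv None (opt (f j)) z * opt (f i) z)"

lemma coord_power_expands:
  "\<exists>A. expands (\<lambda>z. (z $ v) ^ n) A w" for w :: "complex ^ ('m::finite)"
proof (rule holo_expands[OF open_UNIV UNIV_I])
  show "continuous_on UNIV (\<lambda>z :: complex ^ 'm. (z $ v) ^ n)"
    by (intro continuous_intros)
  show "(\<lambda>t. ((w + axis i t) $ v) ^ n) field_differentiable (at 0)" for w :: "complex ^ 'm" and i
    by (cases "i = v") (auto simp: axis_def intro!: derivative_intros)
qed

text \<open>A solution with value \<open>c\<close> at the base point is expanded after subtracting \<open>c\<close>, since only series
  without constant term can be substituted; its derivatives are not affected.\<close>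

lemma expands_shift_const:
  assumes "expands (\<lambda>x. u x - c) A z" shows "expands (partial_deriv i u) (pd i A) z"
proof -
  have "partial_deriv i (\<lambda>x. u x - c) = partial_deriv i u"
  proof
    fix x
    have "((\<lambda>t. u (x + axis i t) - c) has_field_derivative D) (at 0) \<longleftrightarrow>
        ((\<lambda>t. u (x + axis i t)) has_field_derivative D) (at 0)" for D
      using DERIV_diff[of "\<lambda>t. u (x + axis i t)" D 0 UNIV "\<lambda>_. c" 0]
        DERIV_add[of "\<lambda>t. u (x + axis i t) - c" D 0 UNIV "\<lambda>_. c" 0] by auto
    thus "partial_deriv i (\<lambda>x. u x - c) x = partial_deriv i u x"
      by (simp add: partial_deriv_def deriv_def)
  qed
  thus ?thesis using expands_partial_deriv[OF assms, of i] by simp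
qed

lemma expands_shift_has_derivative:
  assumes "expands (\<lambda>x. u x - c) A z"
  shows "\<forall>\<^sub>F x in nhds z. \<exists>f'. (u has_derivative f') (at x) \<and> (\<forall>c v. f' (c *s v) = c * f' v)"
proof -
  obtain r where r: "0 < r" "\<And>h. h \<in> box_at r \<Longrightarrow>
      ((\<lambda>x. u x - c) has_derivative (\<lambda>v. \<Sum>i\<in>UNIV. v $ i * evalm (pd i A) h)) (at (z + h))"
    using expands_has_derivative[OF assms] by blast
  have "\<exists>f'. (u has_derivative f') (at x) \<and> (\<forall>c v. f' (c *s v) = c * f' v)"
    if "x \<in> {w. w - z \<in> box_at r}" for x
  proof -
    let ?f' = "\<lambda>v. \<Sum>i\<in>UNIV. v $ i * evalm (pd i A) (x - z)"
    have "((\<lambda>x. u x - c) has_derivative ?f') (at x)" using r(2)[of "x - z"] that by simp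
    hence "((\<lambda>x. (u x - c) + c) has_derivative (\<lambda>v. ?f' v + 0)) (at x)"
      by (intro has_derivative_add has_derivative_const)
    hence "(u has_derivative ?f') (at x)" by simp
    moreover have "?f' (c *s v) = c * ?f' v" for c v by (simp add: sum_distrib_left mult_ac)
    ultimately show ?thesis by blast
  qed
  thus ?thesis
    unfolding eventually_nhds using r(1) open_box_around[of z r]
    by (intro exI[of _ "{w. w - z \<in> box_at r}"]) auto
qed

text \<open>Away from the coordinate hyperplanes the system is \<open>\<partial>y / \<partial>x\<^sub>i = g\<^sub>i (x, y)\<close> with
  \<open>g\<^sub>i = f\<^sub>i / x\<^sub>i\<^sup>p\<close>, and dividing the obstruction by the powers of the two variables gives the
  integrability condition for the \<open>g\<^sub>i\<close>.\<close>

lemma completely_integrable_if_obstruction_0: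
  fixes f :: "'m::finite \<Rightarrow> (complex ^ 'm) \<times> complex \<Rightarrow> complex"
  assumes D: "open D" and f: "\<And>i. holo_xy_on (f i) D"
    and obs: "\<And>i j z. z \<in> opt_dom D \<Longrightarrow> obstruction p f i j z = 0"
  shows "completely_integrable p f D"
  unfolding completely_integrable_def
proof (intro ballI, clarify)
  fix x0 y0 assume xy: "(x0, y0) \<in> D" "(x0, y0) \<notin> Sigma_set D"
  let ?z0 = "join x0 y0"
  let ?U = "opt_dom D \<inter> {z. \<forall>i. z $ Some i \<noteq> 0}"
  define g where "g i z = opt (f i) z / (z $ Some i) ^ p i" for i and z :: "complex ^ ('m option)"
  have "{z :: complex ^ ('m option). \<forall>i. z $ Some i \<noteq> 0} = (\<Inter>i\<in>UNIV. {z. z $ Some i \<noteq> 0})"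
    by auto
  moreover have "open {z :: complex ^ ('m option). z $ Some i \<noteq> 0}" for i
    by (intro open_Collect_neq continuous_intros)
  ultimately have "open {z :: complex ^ ('m option). \<forall>i. z $ Some i \<noteq> 0}"
    by (simp add: open_INT)
  hence U: "open ?U" by (rule open_Int[OF open_opt_dom[OF D]])
  have U_iff: "join x y \<in> ?U \<longleftrightarrow> (x, y) \<in> D - Sigma_set D" for x y
    by (auto simp: Sigma_set_def)
  have z0: "?z0 \<in> ?U" using xy U_iff by blast
  have opt_exp: "\<exists>A. expands (opt (f i)) A z" if "z \<in> ?U" for i z
    using holo_imp_expands[OF open_opt_dom[OF D] _ holo_opt[OF f]] that by blast
  have opt_deriv: "((\<lambda>t. opt (f i) (z + axis v t)) has_field_derivative
      partial_deriv v (opt (f i)) z) (at 0)" if z: "z \<in> ?U" for i v z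
  proof -
    obtain A where "expands (opt (f i)) A z" using opt_exp[OF z] by blast
    then obtain r where "0 < r" "\<And>h. h \<in> box_at r \<Longrightarrow>
        (opt (f i) has_derivative (\<lambda>v. \<Sum>i\<in>UNIV. v $ i * evalm (pd i A) h)) (at (z + h))"
      using expands_has_derivative by blast
    from this(2)[of 0] \<open>0 < r\<close>
    have "(opt (f i) has_derivative (\<lambda>v. \<Sum>i\<in>UNIV. v $ i * evalm (pd i A) 0)) (at z)" by simp
    from partial_deriv_eq[OF this, of v] show ?thesis by simp
  qed
  have g_exp: "\<exists>A. expands (g i) A z" if z: "z \<in> ?U" for i z
  proof (rule holo_expands[OF U z])
    have "continuous_on ?U (opt (f i))"
      by (rule continuous_on_subset[OF holo_imp_continuous_on[OF holo_opt[OF f]]]) blast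
    thus "continuous_on ?U (g i)"
      unfolding g_def by (intro continuous_intros) auto
    fix w v assume w: "w \<in> ?U"
    have "(\<lambda>t. opt (f i) (w + axis v t)) field_differentiable (at 0)"
      using opt_deriv[OF w] unfolding field_differentiable_def by blast
    moreover have "(\<lambda>t. (w + axis v t) $ Some i) field_differentiable (at 0)"
      by (cases "v = Some i") (auto simp: axis_def intro!: derivative_intros)
    ultimately show "(\<lambda>t. g i (w + axis v t)) field_differentiable (at 0)"
      unfolding g_def using w by (intro field_differentiable_divide field_differentiable_power) (auto simp: axis_def)
  qed
  have g_pd: "partial_deriv v (g i) z = partial_deriv v (opt (f i)) z / (z $ Some i) ^ p i"
    if z: "z \<in> ?U" and v: "v \<noteq> Some i" for i v z
  proof -
    have "(\<lambda>t. g i (z + axis v t)) = (\<lambda>t. opt (f i) (z + axis v t) / (z $ Some i) ^ p i)"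
      using v by (auto simp: g_def axis_def)
    thus ?thesis
      unfolding partial_deriv_def[of v "g i"]
      by (simp add: DERIV_imp_deriv[OF DERIV_cdivide[OF opt_deriv[OF z]]])
  qed
  \<comment> \<open>The power of \<open>x\<^sub>i\<close> in the denominator of \<open>g\<^sub>i\<close> is constant with respect to \<open>x\<^sub>j\<close> and \<open>y\<close>.\<close>
  have int_an: "partial_deriv (Some j) (g i) z + partial_deriv None (g i) z * g j z =
      partial_deriv (Some i) (g j) z + partial_deriv None (g j) z * g i z"
    if z: "z \<in> ?U" and "i \<noteq> j" for i j z
  proof -
    let ?a = "(z $ Some i) ^ p i" and ?b = "(z $ Some j) ^ p j"
    have ab: "?a \<noteq> 0" "?b \<noteq> 0" using z by auto
    have "obstruction p f i j z = 0" using z by (intro obs) blast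
    hence eq: "?b * partial_deriv (Some j) (opt (f i)) z + partial_deriv None (opt (f i)) z * opt (f j) z
        = ?a * partial_deriv (Some i) (opt (f j)) z + partial_deriv None (opt (f j)) z * opt (f i) z"
      by (simp add: obstruction_def)
    have "partial_deriv (Some j) (g i) z + partial_deriv None (g i) z * g j z =
        (?b * partial_deriv (Some j) (opt (f i)) z + partial_deriv None (opt (f i)) z * opt (f j) z) / (?a * ?b)"
      using that ab by (simp add: g_pd[OF z] g_def[of j] add_divide_distrib)
    also have "\<dots> = partial_deriv (Some i) (g j) z + partial_deriv None (g j) z * g i z"
      unfolding eq using that ab
      by (simp add: g_pd[OF z] g_def[of i] add_divide_distrib mult.commute)
    finally show ?thesis .
  qed
  have "\<exists>\<Gamma>. \<forall>i. expands (g i) (\<Gamma> i) ?z0" using g_exp[OF z0] by (intro choice allI)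
  then obtain \<Gamma> where \<Gamma>: "\<And>i. expands (g i) (\<Gamma> i) ?z0" by blast
  define G where "G i = y_fps (\<Gamma> i)" for i
  have Gc: "xy_conv (G i)" for i
  proof -
    obtain r where "0 < r" "bdd_at r (\<Gamma> i)" using \<Gamma>[of i] unfolding expands_def by blast
    then obtain C where "xy_bound (y_fps (\<Gamma> i)) r r C" using bdd_at_imp_xy_bound by blast
    thus ?thesis unfolding G_def xy_conv_def by blast
  qed
  have int: "pdF j (G i) + fps_deriv (G i) * G j = pdF i (G j) + fps_deriv (G j) * G i" for i j
  proof (cases "i = j")
    case False
    have "pd (Some j) (\<Gamma> i) + pd None (\<Gamma> i) * \<Gamma> j = pd (Some i) (\<Gamma> j) + pd None (\<Gamma> j) * \<Gamma> i"
      by (rule expands_unique_nhd[OF expands_add[OF expands_partial_deriv[OF \<Gamma>]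
              expands_mult[OF expands_partial_deriv[OF \<Gamma>] \<Gamma>]]
            expands_add[OF expands_partial_deriv[OF \<Gamma>]
              expands_mult[OF expands_partial_deriv[OF \<Gamma>] \<Gamma>]] U z0])
        (rule int_an[OF _ False])
    from arg_cong[OF this, of y_fps] show ?thesis
      by (simp add: G_def y_fps_add y_fps_mult y_fps_pd_Some y_fps_pd_None)
  qed simp
  \<comment> \<open>Every analytic solution expands into a formal one, and formal solutions are unique.\<close>
  have unique: "\<exists>\<phi>. expands (\<lambda>x. u x - y0) \<phi> x0 \<and> ord_ge 1 \<phi> \<and> (\<forall>i. pd i \<phi> = subst_y (G i) \<phi>)"
    if sol: "solution_near p f D x0 y0 u" for u
  proof -
    obtain V where V: "u x0 = y0" "open V" "x0 \<in> V" "holo_x_on u V"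
      and VD: "\<And>x. x \<in> V \<Longrightarrow> (x, u x) \<in> D - Sigma_set D"
      and eq: "\<And>x i. x \<in> V \<Longrightarrow> (x $ i) ^ p i * partial_deriv i u x = f i (x, u x)"
      using sol unfolding solution_near_def by blast
    have "holo_x_on (\<lambda>x. u x - y0) V"
      unfolding holo_x_on_def holo_on_def
    proof
      fix x assume "x \<in> V"
      then obtain f' where f': "(u has_derivative f') (at x)" "\<forall>c v. f' (c *s v) = c * f' v"
        using V(4) unfolding holo_x_on_def holo_on_def by blast
      have "((\<lambda>x. u x - y0) has_derivative f') (at x)"
        using has_derivative_diff[OF f'(1) has_derivative_const[of y0]] by simp
      thus "\<exists>f'. ((\<lambda>x. u x - y0) has_derivative f') (at x) \<and> (\<forall>c v. f' (c *s v) = c * f' v)"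
        using f'(2) by blast
    qed
    then obtain \<phi> where \<phi>: "expands (\<lambda>x. u x - y0) \<phi> x0"
      using holo_imp_expands[OF V(2,3)] by blast
    have "coef \<phi> (\<lambda>_. 0) = 0"
    proof -
      obtain r where r: "0 < r" "\<forall>h\<in>box_at r. u (x0 + h) - y0 = evalm \<phi> h"
        using \<phi> unfolding expands_def by blast
      show ?thesis using r(2)[THEN bspec, of 0] r(1) V(1) by (simp add: evalm_at_0)
    qed
    hence \<phi>1: "ord_ge 1 \<phi>" by (auto simp: ord_ge_def mdeg_eq_0)
    have "pd i \<phi> = subst_y (G i) \<phi>" for i
      unfolding G_def
    proof (rule expands_unique_nhd[OF expands_shift_const[OF \<phi>] expands_subst[OF \<Gamma> \<phi> \<phi>1] V(2,3)])
      fix x assume x: "x \<in> V"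
      hence "join x (u x) \<in> ?U" using VD U_iff by blast
      hence "x $ i \<noteq> 0" by auto
      thus "partial_deriv i u x = g i (join x (u x))"
        using eq[OF x, of i] by (simp add: g_def divide_simps mult.commute)
    qed
    thus ?thesis using \<phi> \<phi>1 by blast
  qed
  show "(\<exists>u. solution_near p f D x0 y0 u) \<and>
      (\<forall>u v. solution_near p f D x0 y0 u \<and> solution_near p f D x0 y0 v \<longrightarrow>
        (\<forall>\<^sub>F x in nhds x0. u x = v x))"
  proof (intro conjI allI impI)
    fix u v assume uv: "solution_near p f D x0 y0 u \<and> solution_near p f D x0 y0 v"
    obtain \<phi> where \<phi>: "expands (\<lambda>x. u x - y0) \<phi> x0" "ord_ge 1 \<phi>" "\<forall>i. pd i \<phi> = subst_y (G i) \<phi>"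
      using unique uv by blast
    obtain \<psi> where \<psi>: "expands (\<lambda>x. v x - y0) \<psi> x0" "ord_ge 1 \<psi>" "\<forall>i. pd i \<psi> = subst_y (G i) \<psi>"
      using unique uv by blast
    have "\<phi> = \<psi>" using \<phi> \<psi> by (intro frobenius_unique[of \<phi> \<psi> G]) auto
    hence "\<forall>\<^sub>F x in nhds x0. u x - y0 = v x - y0"
      using \<phi>(1) \<psi>(1) by (intro expands_eq_near) auto
    thus "\<forall>\<^sub>F x in nhds x0. u x = v x" by simp
  next
    obtain \<phi> where \<phi>: "ord_ge 1 \<phi>" "x_conv \<phi>" "\<And>i. pd i \<phi> = subst_y (G i) \<phi>"
      using frobenius_exists[OF int Gc] by blast
    define u where "u x = y0 + evalm \<phi> (x - x0)" for x
    have u: "expands (\<lambda>x. u x - y0) \<phi> x0"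
      using \<phi>(2) unfolding x_conv_iff expands_def by (auto simp: u_def)
    have u0: "u x0 = y0"
      using \<phi>(1) by (simp add: u_def evalm_at_0 ord_ge_def mdeg_eq_0)
    have "\<forall>\<^sub>F x in nhds x0. partial_deriv i u x = g i (join x (u x))" for i
    proof (rule expands_eq_near)
      show "expands (partial_deriv i u) (pd i \<phi>) x0" by (rule expands_shift_const[OF u])
      show "expands (\<lambda>x. g i (join x (u x))) (pd i \<phi>) x0"
        unfolding \<phi>(3) G_def by (rule expands_subst[OF \<Gamma> u \<phi>(1)])
    qed
    hence ev1: "\<forall>\<^sub>F x in nhds x0. \<forall>i. partial_deriv i u x = g i (join x (u x))"
      by (rule eventually_all_finite)
    have ev2: "\<forall>\<^sub>F x in nhds x0. \<exists>f'. (u has_derivative f') (at x) \<and> (\<forall>c v. f' (c *s v) = c * f' v)"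
      by (rule expands_shift_has_derivative[OF u])
    \<comment> \<open>The graph of \<open>u\<close> stays in the domain by continuity.\<close>
    have ev3: "\<forall>\<^sub>F x in nhds x0. (x, u x) \<in> D - Sigma_set D"
    proof -
      have "\<exists>f'. (u has_derivative f') (at x0)" using eventually_nhds_x_imp_x[OF ev2] by blast
      hence "isCont u x0" using has_derivative_continuous by blast
      from bounded_linear.continuous[OF bounded_linear_join continuous_Pair[OF continuous_ident this]]
      have "isCont (\<lambda>x. join x (u x)) x0" by simp
      hence "\<forall>\<^sub>F x in at x0. join x (u x) \<in> ?U"
        unfolding isCont_def by (rule topological_tendstoD[OF _ U]) (use z0 u0 in simp)
      hence "\<forall>\<^sub>F x in nhds x0. join x (u x) \<in> ?U"
        using z0 u0 by (simp add: eventually_nhds_conv_at)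
      thus ?thesis by (simp only: U_iff)
    qed
    have "\<forall>\<^sub>F x in nhds x0. (\<forall>i. partial_deriv i u x = g i (join x (u x))) \<and>
        (\<exists>f'. (u has_derivative f') (at x) \<and> (\<forall>c v. f' (c *s v) = c * f' v)) \<and>
        (x, u x) \<in> D - Sigma_set D"
      by (intro eventually_conj ev1 ev2 ev3)
    then obtain V where V: "open V" "x0 \<in> V"
      "\<And>x. x \<in> V \<Longrightarrow> (\<forall>i. partial_deriv i u x = g i (join x (u x))) \<and>
        (\<exists>f'. (u has_derivative f') (at x) \<and> (\<forall>c v. f' (c *s v) = c * f' v)) \<and>
        (x, u x) \<in> D - Sigma_set D"
      unfolding eventually_nhds by blast
    have "(x $ i) ^ p i * partial_deriv i u x = f i (x, u x)" if x: "x \<in> V" for x i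
    proof -
      have "join x (u x) \<in> ?U" using V(3)[OF x] U_iff by blast
      hence "x $ i \<noteq> 0" by auto
      thus ?thesis using V(3)[OF x] by (simp add: g_def)
    qed
    moreover have "holo_x_on u V" using V(3) unfolding holo_x_on_def holo_on_def by blast
    ultimately have "solution_near p f D x0 y0 u"
      unfolding solution_near_def using u0 V by blast
    thus "\<exists>u. solution_near p f D x0 y0 u" by blast
  qed
qed

section \<open>Convergence of formal solutions\<close>

text \<open>Cross-differentiation of the equations: the mixed second derivatives of \<open>\<phi>\<close> cancel.\<close>

lemma formal_solution_annihilates:
  fixes a :: "'m::finite \<Rightarrow> 'm mser fps"
  assumes \<phi>: "ord_ge 1 \<phi>" and sol: "\<And>i. Xv i ^ p i * pd i \<phi> = subst_y (a i) \<phi>" and ij: "i \<noteq> j"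
  shows "subst_y ((fps_const (Xv j ^ p j) * pdF j (a i) + fps_deriv (a i) * a j)
      - (fps_const (Xv i ^ p i) * pdF i (a j) + fps_deriv (a j) * a i)) \<phi> = 0"
proof -
  have mixed: "Xv j ^ p j * (Xv i ^ p i * pd j (pd i \<phi>)) =
      subst_y (fps_const (Xv j ^ p j) * pdF j (a i) + fps_deriv (a i) * a j) \<phi>"
    if "i \<noteq> j" for i j
  proof -
    have "Xv j ^ p j * (Xv i ^ p i * pd j (pd i \<phi>)) = Xv j ^ p j * pd j (Xv i ^ p i * pd i \<phi>)"
      using that by (simp add: pd_Xv_power)
    also have "\<dots> = Xv j ^ p j * subst_y (pdF j (a i)) \<phi>
        + subst_y (fps_deriv (a i)) \<phi> * (Xv j ^ p j * pd j \<phi>)"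
      unfolding sol[of i] subst_y_chain[OF \<phi>] by (simp add: algebra_simps)
    finally show ?thesis
      by (simp only: sol subst_y_add subst_y_mult[OF \<phi>] subst_y_const)
  qed
  have "Xv j ^ p j * (Xv i ^ p i * pd j (pd i \<phi>)) = Xv i ^ p i * (Xv j ^ p j * pd i (pd j \<phi>))"
    by (simp add: pd_commute[of j i] mult.left_commute)
  thus ?thesis
    using ij by (simp add: subst_y_diff mixed)
qed

theorem theorem2:
  fixes p :: "('m::finite) \<Rightarrow> nat"
    and f :: "'m \<Rightarrow> (complex ^ 'm) \<times> complex \<Rightarrow> complex"
    and D :: "((complex ^ 'm) \<times> complex) set"
    and \<phi> :: "'m mps"
  assumes "\<And>i. p i \<ge> 1"
    and "open D" and "connected D" and "(0, 0) \<in> D"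
    and "\<And>i. holo_xy_on (f i) D"
    and "\<And>i. f i (0, 0) = 0"
    and "\<not> completely_integrable p f D"
    and "formal_solution p f \<phi>"
  shows "converges_near_0 \<phi>"
proof -
  have exp: "\<exists>A. expands (opt (f i)) A z" if "z \<in> opt_dom D" for i z
    using holo_imp_expands[OF open_opt_dom[OF assms(2)] that holo_opt[OF assms(5)]] .
  obtain i j z where z: "z \<in> opt_dom D" "obstruction p f i j z \<noteq> 0"
    using completely_integrable_if_obstruction_0[OF assms(2), of f p] assms(5,7) by blast
  have ij: "i \<noteq> j" using z(2) by (auto simp: obstruction_def)
  have obs_exp: "\<exists>B. expands (obstruction p f i j) B w" if w: "w \<in> opt_dom D" for w
  proof -
    obtain A where A: "expands (opt (f i)) A w" using exp[OF w] by blast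
    obtain B where B: "expands (opt (f j)) B w" using exp[OF w] by blast
    obtain X where X: "expands (\<lambda>z. (z $ Some i) ^ p i) X w" using coord_power_expands by blast
    obtain Y where Y: "expands (\<lambda>z. (z $ Some j) ^ p j) Y w" using coord_power_expands by blast
    show ?thesis
      unfolding obstruction_def[abs_def]
      by (rule exI, rule expands_diff[OF
            expands_add[OF expands_mult[OF Y expands_partial_deriv[OF A]]
              expands_mult[OF expands_partial_deriv[OF A] B]]
            expands_add[OF expands_mult[OF X expands_partial_deriv[OF B]]
              expands_mult[OF expands_partial_deriv[OF B] A]]])
  qed
  have 0: "(0 :: complex ^ ('m option)) \<in> opt_dom D"
    using assms(4) join_in_opt_dom[of 0 0 D] by (simp only: join_0)
  have "\<exists>A. \<forall>i. expands (opt (f i)) (A i) 0" using exp[OF 0] by (intro choice allI)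
  then obtain A where A: "\<And>i. expands (opt (f i)) (A i) 0" by blast
  define \<Phi> where "\<Phi> = (Xv (Some j) ^ p j * pd (Some j) (A i) + pd None (A i) * A j)
      - (Xv (Some i) ^ p i * pd (Some i) (A j) + pd None (A j) * A i)"
  have \<Phi>: "expands (obstruction p f i j) \<Phi> 0"
    unfolding obstruction_def[abs_def] \<Phi>_def
    by (intro expands_diff expands_add expands_mult expands_partial_deriv expands_Xv_power A)
  have "\<Phi> \<noteq> 0"
    using identity_theorem[OF open_opt_dom[OF assms(2)] connected_opt_dom[OF assms(3)] obs_exp 0 _ z(1)]
      \<Phi> z(2) by auto
  hence ne: "y_fps \<Phi> \<noteq> 0" using y_fps_inject[of \<Phi> 0] by (auto simp: y_fps_0)
  obtain r where "0 < r" "bdd_at r \<Phi>" using \<Phi> unfolding expands_def by blast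
  then obtain C where "xy_bound (y_fps \<Phi>) r r C" using bdd_at_imp_xy_bound by blast
  hence cv: "xy_conv (y_fps \<Phi>)" unfolding xy_conv_def by blast
  define \<psi> where "\<psi> = Mser \<phi>"
  have \<psi>1: "ord_ge 1 \<psi>"
    using assms(8) by (simp add: formal_solution_def \<psi>_def ord_ge_def mdeg_eq_0)
  have sol: "Xv k ^ p k * pd k \<psi> = subst_y (y_fps (A k)) \<psi>" for k
  proof -
    have "mps_times_var_power k (p k) (coef (pd k \<psi>)) = mps_subst (taylor (f k)) (coef \<psi>)"
      using assms(8) by (simp add: formal_solution_def \<psi>_def pd_def)
    moreover have "mps_subst (taylor (f k)) (coef \<psi>) = coef (subst_y (y_fps (A k)) \<psi>)"
      by (rule mps_subst_coef) (simp add: taylor_eq[OF A] coef_y_fps)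
    ultimately show ?thesis
      by (simp add: mps_times_var_power_coef coef_inject)
  qed
  have "y_fps \<Phi> = (fps_const (Xv j ^ p j) * pdF j (y_fps (A i)) + fps_deriv (y_fps (A i)) * y_fps (A j))
      - (fps_const (Xv i ^ p i) * pdF i (y_fps (A j)) + fps_deriv (y_fps (A j)) * y_fps (A i))"
    by (simp only: \<Phi>_def y_fps_add y_fps_diff y_fps_mult y_fps_pd_Some y_fps_pd_None y_fps_Xv_Some_power)
  hence "subst_y (y_fps \<Phi>) \<psi> = 0"
    using formal_solution_annihilates[OF \<psi>1 sol ij] by simp
  hence "x_conv \<psi>" by (rule formal_root_converges[OF cv ne \<psi>1])
  thus ?thesis using x_conv_converges_near_0[of \<psi>] by (simp add: \<psi>_def)
qed

end
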